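(* If $\Delta$ is a hyperbolic manifold with fins and ornaments, then there is no $2$-dimensional tropical complex (i.e. tropical surface) with $\Delta$ as its underlying $\Delta$-complex; that is, there is no choice of structure constants $\alpha(v,e)$ on $\Delta$ making it a tropical surface.
   Context: Simplices of dimension $0,1,2$ of a $\Delta$-complex are called vertices, edges and facets. A $\Delta$-complex is regular if the faces of any fixed simplex are distinct. A weak tropical surface is a finite, connected, regular $\Delta$-complex whose cells have dimension at most $2$, together with integers $\alpha(v,e)$ (structure constants) for every endpoint $v$ of an edge $e$, such that for each edge $e$ with endpoints $v,w$ one has $\alpha(v,e)+\alpha(w,e)=\deg(e)$, where $\deg(e)$ is the number of facets containing $e$. At a vertex $v$, the local intersection matrix $M_v$ is the symmetric matrix with rows and columns indexed by the edges containing $v$, with entry $(M_v)_{e,e'}=\#\{\text{facets containing both } e \text{ and } e'\}$ if $e\ne e'$, and $(M_v)_{e,e}=-\alpha(w,e)$, where $w$ is the endpoint of $e$ other than $v$. A tropical surface ($2$-dimensional tropical complex) is a weak tropical surface such that for every vertex $v$, $M_v$ has exactly one positive eigenvalue (counted with multiplicity). A $2$-dimensional $\Delta$-complex $\Delta$ is a manifold with fins and ornaments if there exist a subcomplex $\Sigma$ (the manifold), subcomplexes $F_1,\ldots,F_n$ (the fins), and a subcomplex $O$ (the ornaments) such that: (1) $\Delta=\Sigma\cup F_1\cup\cdots\cup F_n\cup O$; (2) $\Sigma$ is homeomorphic to a connected $2$-dimensional topological manifold (without boundary); (3) for every $i$, $F_i$ is contractible and $F_i\cap\Sigma$ is a path;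 (4) for any $i>j$, $F_j\cap F_i$ is a subset of the endpoints of the path $F_i\cap\Sigma$; (5) $O\cap(\Sigma\cup F_1\cup\cdots\cup F_n)$ is a finite set of points. It is called hyperbolic if moreover $\Sigma$ has negative Euler characteristic. *)

theory Defs
  imports
    "HOL-Analysis.Analysis"
    "HOL-Homology.Homology"
    "Jordan_Normal_Form.Char_Poly"
begin

section \<open>Delta-complexes\<close>

text \<open>
  A Delta-complex is given by its sets of \<open>n\<close>-simplices and its face maps: \<open>face K n i \<sigma>\<close> is the
  face of the \<open>n\<close>-simplex \<open>\<sigma>\<close> opposite its \<open>i\<close>-th vertex.  Only the values of \<open>face\<close> on simplices
  of positive dimension \<open>n\<close> and indices \<open>i \<le> n\<close> are meaningful.  One and the same element of type
  \<open>'a\<close> may be used for simplices of different dimensions.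
\<close>

record 'a delta_data =
  simplices :: "nat \<Rightarrow> 'a set"
  face :: "nat \<Rightarrow> nat \<Rightarrow> 'a \<Rightarrow> 'a"

definition delta_complex :: "'a delta_data \<Rightarrow> bool" where
  "delta_complex K \<longleftrightarrow>
     (\<forall>n. \<forall>\<sigma>\<in>simplices K (Suc n). \<forall>i\<le>Suc n. face K (Suc n) i \<sigma> \<in> simplices K n) \<and>
     (\<forall>n. \<forall>\<sigma>\<in>simplices K (Suc (Suc n)). \<forall>j\<le>Suc (Suc n). \<forall>i<j.
        face K (Suc n) i (face K (Suc (Suc n)) j \<sigma>) =
        face K (Suc n) (j - 1) (face K (Suc (Suc n)) i \<sigma>))"

definition dimension_at_most :: "nat \<Rightarrow> 'a delta_data \<Rightarrow> bool" where
  "dimension_at_most d K \<longleftrightarrow> (\<forall>n>d. simplices K n = {})"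

definition finite_complex :: "'a delta_data \<Rightarrow> bool" where
  "finite_complex K \<longleftrightarrow> finite (SIGMA n:UNIV. simplices K n)"

text \<open>
  Requiring the codimension-one faces of every simplex to be distinct suffices: any two vertices
  of a simplex are the endpoints of one of its edges, so the vertices of every simplex are
  distinct, and hence so are its faces of any dimension.
\<close>

definition regular_complex :: "'a delta_data \<Rightarrow> bool" where
  "regular_complex K \<longleftrightarrow>
     (\<forall>n\<ge>1. \<forall>\<sigma>\<in>simplices K n. inj_on (\<lambda>i. face K n i \<sigma>) {..n})"

definition subcomplex :: "(nat \<Rightarrow> 'a set) \<Rightarrow> 'a delta_data \<Rightarrow> bool" where
  "subcomplex S K \<longleftrightarrow>
     (\<forall>n. S n \<subseteq> simplices K n) \<and>
     (\<forall>n. \<forall>\<sigma>\<in>S (Suc n). \<forall>i\<le>Suc n. face K (Suc n) i \<sigma> \<in> S n)"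

definition restrict_complex :: "'a delta_data \<Rightarrow> (nat \<Rightarrow> 'a set) \<Rightarrow> 'a delta_data" where
  "restrict_complex K S = K\<lparr>simplices := S\<rparr>"

section \<open>Geometric realization\<close>

definition quotient_topology :: "'a topology \<Rightarrow> ('a \<Rightarrow> 'b) \<Rightarrow> 'b topology" where
  "quotient_topology X f =
     topology (\<lambda>U. U \<subseteq> f ` topspace X \<and> openin X {x \<in> topspace X. f x \<in> U})"

lemma openin_quotient_topology:
  "openin (quotient_topology X f) U \<longleftrightarrow>
     U \<subseteq> f ` topspace X \<and> openin X {x \<in> topspace X. f x \<in> U}"
proof -
  have 1: "{x \<in> topspace X. f x \<in> S \<inter> T} =
      {x \<in> topspace X. f x \<in> S} \<inter> {x \<in> topspace X. f x \<in> T}" for S T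
    by auto
  have 2: "{x \<in> topspace X. f x \<in> \<Union>\<K>} = (\<Union>S\<in>\<K>. {x \<in> topspace X. f x \<in> S})" for \<K>
    by auto
  have "istopology (\<lambda>U. U \<subseteq> f ` topspace X \<and> openin X {x \<in> topspace X. f x \<in> U})"
    unfolding istopology_def 1 2 by blast
  then show ?thesis
    by (simp add: quotient_topology_def)
qed

lemma topspace_quotient_topology [simp]:
  "topspace (quotient_topology X f) = f ` topspace X"
proof
  show "topspace (quotient_topology X f) \<subseteq> f ` topspace X"
    using openin_topspace [of "quotient_topology X f"]
    unfolding openin_quotient_topology by blast
  have "{x \<in> topspace X. f x \<in> f ` topspace X} = topspace X"
    by auto
  then have "openin (quotient_topology X f) (f ` topspace X)"
    by (simp add: openin_quotient_topology)
  then show "f ` topspace X \<subseteq> topspace (quotient_topology X f)"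
    by (rule openin_subset)
qed

lemma quotient_map_quotient_topology: "quotient_map X (quotient_topology X f) f"
  by (simp add: quotient_map_def openin_quotient_topology)

text \<open>A point of the disjoint union of simplices has the form \<open>((n, \<sigma>), t)\<close> with
  \<open>t \<in> standard_simplex n\<close>.\<close>

type_synonym 'a simplex_point = "(nat \<times> 'a) \<times> (nat \<Rightarrow> real)"

definition simplex_sum :: "'a delta_data \<Rightarrow> 'a simplex_point topology" where
  "simplex_sum K =
     sum_topology (\<lambda>(n, \<sigma>). subtopology (powertop_real UNIV) (standard_simplex n))
       (SIGMA n:UNIV. simplices K n)"

definition gluing :: "'a delta_data \<Rightarrow> 'a simplex_point rel" where
  "gluing K =
     {(((n, face K (Suc n) i \<sigma>), t), ((Suc n, \<sigma>), simplical_face i t)) | n i \<sigma> t.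
        \<sigma> \<in> simplices K (Suc n) \<and> i \<le> Suc n \<and> t \<in> standard_simplex n}"

definition realization :: "'a delta_data \<Rightarrow> 'a simplex_point set topology" where
  "realization K =
     quotient_topology (simplex_sum K) (\<lambda>p. (gluing K \<union> converse (gluing K))\<^sup>* `` {p})"

section \<open>Tropical surfaces\<close>

definition edges_at :: "'a delta_data \<Rightarrow> 'a \<Rightarrow> 'a set" where
  "edges_at K v = {e \<in> simplices K 1. \<exists>i\<le>1. face K 1 i e = v}"

definition facets_at :: "'a delta_data \<Rightarrow> 'a \<Rightarrow> 'a set" where
  "facets_at K e = {f \<in> simplices K 2. \<exists>i\<le>2. face K 2 i f = e}"

definition other_endpoint :: "'a delta_data \<Rightarrow> 'a \<Rightarrow> 'a \<Rightarrow> 'a" where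
  "other_endpoint K v e = (if face K 1 0 e = v then face K 1 1 e else face K 1 0 e)"

text \<open>Structure constants \<open>\<alpha> v e\<close> matter only when \<open>v\<close> is an endpoint of the edge \<open>e\<close>.\<close>

definition weak_tropical_surface :: "'a delta_data \<Rightarrow> ('a \<Rightarrow> 'a \<Rightarrow> int) \<Rightarrow> bool" where
  "weak_tropical_surface K \<alpha> \<longleftrightarrow>
     delta_complex K \<and> finite_complex K \<and> connected_space (realization K) \<and>
     regular_complex K \<and> dimension_at_most 2 K \<and>
     (\<forall>e\<in>simplices K 1. \<alpha> (face K 1 0 e) e + \<alpha> (face K 1 1 e) e = int (card (facets_at K e)))"

definition local_intersection ::
    "'a delta_data \<Rightarrow> ('a \<Rightarrow> 'a \<Rightarrow> int) \<Rightarrow> 'a \<Rightarrow> 'a \<Rightarrow> 'a \<Rightarrow> int" where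
  "local_intersection K \<alpha> v e e' =
     (if e = e' then - \<alpha> (other_endpoint K v e) e
      else int (card (facets_at K e \<inter> facets_at K e')))"

text \<open>The list \<open>es\<close> enumerates the edges at \<open>v\<close>, which index the rows and columns.\<close>

definition local_intersection_matrix ::
    "'a delta_data \<Rightarrow> ('a \<Rightarrow> 'a \<Rightarrow> int) \<Rightarrow> 'a \<Rightarrow> 'a list \<Rightarrow> real mat" where
  "local_intersection_matrix K \<alpha> v es =
     mat (length es) (length es)
       (\<lambda>(i, j). real_of_int (local_intersection K \<alpha> v (es ! i) (es ! j)))"

text \<open>Eigenvalues are counted with algebraic multiplicity, which for a symmetric real matrix
  agrees with the geometric one.\<close>

definition num_positive_eigenvalues :: "real mat \<Rightarrow> nat" where
  "num_positive_eigenvalues A =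
     (\<Sum>x | eigenvalue A x \<and> 0 < x. Polynomial.order x (char_poly A))"

text \<open>Reordering the enumeration \<open>es\<close> conjugates the matrix by a permutation matrix, so it does
  not affect the eigenvalues; \<open>edges_at K v\<close> is finite, so an enumeration exists.\<close>

definition tropical_surface :: "'a delta_data \<Rightarrow> ('a \<Rightarrow> 'a \<Rightarrow> int) \<Rightarrow> bool" where
  "tropical_surface K \<alpha> \<longleftrightarrow>
     weak_tropical_surface K \<alpha> \<and>
     (\<forall>v\<in>simplices K 0. \<forall>es. distinct es \<and> set es = edges_at K v \<longrightarrow>
        num_positive_eigenvalues (local_intersection_matrix K \<alpha> v es) = 1)"

section \<open>Manifolds with fins and ornaments\<close>

definition connected_2_manifold :: "'b topology \<Rightarrow> bool" where
  "connected_2_manifold X \<longleftrightarrow>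
     topspace X \<noteq> {} \<and> connected_space X \<and> Hausdorff_space X \<and> second_countable X \<and>
     (\<forall>x\<in>topspace X. \<exists>U V. openin X U \<and> x \<in> U \<and> openin (Euclidean_space 2) V \<and>
        subtopology X U homeomorphic_space subtopology (Euclidean_space 2) V)"

text \<open>\<open>is_path K S A\<close>: the subcomplex \<open>S\<close> is a path \<open>vs ! 0, es ! 0, vs ! 1, \<dots>\<close> with set of
  endpoints \<open>A\<close>.  A single vertex is a (degenerate) path.\<close>

definition is_path :: "'a delta_data \<Rightarrow> (nat \<Rightarrow> 'a set) \<Rightarrow> 'a set \<Rightarrow> bool" where
  "is_path K S A \<longleftrightarrow>
     (\<exists>vs es. length vs = Suc (length es) \<and> distinct vs \<and>
        S 0 = set vs \<and> S 1 = set es \<and> (\<forall>n\<ge>2. S n = {}) \<and>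
        (\<forall>i<length es. {face K 1 0 (es ! i), face K 1 1 (es ! i)} = {vs ! i, vs ! Suc i}) \<and>
        A = {hd vs, last vs})"

text \<open>Subcomplexes are families of sets of simplices, so their unions and intersections are taken
  dimension by dimension.  The fins are \<open>F 1, \<dots>, F k\<close>, and \<open>A i\<close> is the set of endpoints of the
  path in which \<open>F i\<close> meets \<open>S\<close>.\<close>

definition fins_and_ornaments_decomposition ::
    "'a delta_data \<Rightarrow> (nat \<Rightarrow> 'a set) \<Rightarrow> nat \<Rightarrow> (nat \<Rightarrow> nat \<Rightarrow> 'a set) \<Rightarrow> (nat \<Rightarrow> 'a set) \<Rightarrow> bool"
  where
  "fins_and_ornaments_decomposition K S k F Orn \<longleftrightarrow>
     subcomplex S K \<and> (\<forall>i\<in>{1..k}. subcomplex (F i) K) \<and> subcomplex Orn K \<and>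
     (\<forall>n. simplices K n = S n \<union> (\<Union>i\<in>{1..k}. F i n) \<union> Orn n) \<and>
     connected_2_manifold (realization (restrict_complex K S)) \<and>
     (\<exists>A. (\<forall>i\<in>{1..k}.
             contractible_space (realization (restrict_complex K (F i))) \<and>
             is_path K (\<lambda>n. F i n \<inter> S n) (A i)) \<and>
          (\<forall>i\<in>{1..k}. \<forall>j\<in>{1..k}. j < i \<longrightarrow>
             F j 0 \<inter> F i 0 \<subseteq> A i \<and> (\<forall>n\<ge>1. F j n \<inter> F i n = {}))) \<and>
     finite (Orn 0 \<inter> (S 0 \<union> (\<Union>i\<in>{1..k}. F i 0))) \<and>
     (\<forall>n\<ge>1. Orn n \<inter> (S n \<union> (\<Union>i\<in>{1..k}. F i n)) = {})"

definition two_dimensional :: "'a delta_data \<Rightarrow> bool" where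
  "two_dimensional K \<longleftrightarrow> dimension_at_most 2 K \<and> simplices K 2 \<noteq> {}"

definition manifold_with_fins_and_ornaments :: "'a delta_data \<Rightarrow> bool" where
  "manifold_with_fins_and_ornaments K \<longleftrightarrow>
     delta_complex K \<and> two_dimensional K \<and>
     (\<exists>S k F Orn. fins_and_ornaments_decomposition K S k F Orn)"

text \<open>Meaningful only for finite families \<open>S\<close> of simplices of dimension at most \<open>2\<close>, since
  \<open>card\<close> of an infinite set is \<open>0\<close>.\<close>

definition euler_characteristic :: "(nat \<Rightarrow> 'a set) \<Rightarrow> int" where
  "euler_characteristic S = int (card (S 0)) - int (card (S 1)) + int (card (S 2))"

definition hyperbolic_manifold_with_fins_and_ornaments :: "'a delta_data \<Rightarrow> bool" where
  "hyperbolic_manifold_with_fins_and_ornaments K \<longleftrightarrow>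
     delta_complex K \<and> two_dimensional K \<and>
     (\<exists>S k F Orn. fins_and_ornaments_decomposition K S k F Orn \<and> euler_characteristic S < 0)"

end

(*
  Suppose that structure constants exist.  Since M_v has one positive eigenvalue, the form it
  defines is negative semidefinite on some hyperplane; moreover such hyperplanes can be chosen
  separately for the connected components of the link of v, with its isotropic vectors in the
  kernel.  Outward orientation turns a closed 1-cochain c into a vector for every M_v, and the
  condition alpha(v,e) + alpha(w,e) = deg(e) makes the sum over all v of the values of these
  quadratic forms vanish.  Thus a closed cochain lying in all the hyperplanes lies in the kernels of
  all M_v, that is, it is harmonic.  Negative Euler characteristic means that there are fewer
  equations than unknowns for such cochains, so a nonzero one exists.

  On a fin c is locally the coboundary of a potential, to which a maximum principle applies: c
  vanishes on a fin as soon as it vanishes on its path.  It follows that c vanishes on no facet of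
  the surface.  Then each facet contributes exactly one sign change of c around a vertex: either one
  of its corners has outward values of opposite signs, or it has one edge with value 0, which lies
  in two facets and counts at both its ends.  As 3F = 2E and V - E + F < 0, the F sign changes
  exceed 2V, so some vertex v has at least three.  They cut the link of v in the surface into arcs
  of constant sign.  The restrictions of c to a suitable arc, extended over adjoining fins, and to
  its positive part span a plane on which the form M_v is nonnegative; a vector of the plane in the
  negative semidefinite hyperplane is then in the kernel of M_v, which fails at one of the three
  sign changes.
*)
theory Submission
  imports Defs
begin

section \<open>Symmetric matrices with one positive eigenvalue\<close>

text \<open>Three sign changes are what the arc needs. It can be extended over a fin only if it
  contains all or none of the path edges of that fin at the vertex. By condition (4) the path of at
  most one fin passes through the vertex, so at most two edges obstruct; the arcs through them own
  at most four of the at least six sides of the sign changes. Hyperplanes are chosen per component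
  of a link because the maximum principle needs an irreducible matrix, and fins may be pinched at
  vertices. The extra equations off the surface are balanced by letting the potential take a
  separate value on each component that misses the surface, so only the Euler characteristic of the
  surface matters. Facets on which \<open>c\<close> vanishes would ruin the count. The boundary of a
  region of such facets would have to follow the path of a fin up to an edge where \<open>c\<close>
  is nonzero; the order of the fins in (4) singles out the fin for which this can be shown. The
  manifold enters through three combinatorial facts: its links and its edge graph are connected, and
  each edge lies in two facets.\<close>

lemma det_dvd_two_columns:
  fixes A :: "'a::comm_ring_1 mat"
  assumes A: "A \<in> carrier_mat n n" and ij: "i < n" "j < n" "i \<noteq> j"
    and di: "\<And>r. r < n \<Longrightarrow> p dvd A $$ (r, i)" and dj: "\<And>r. r < n \<Longrightarrow> p dvd A $$ (r, j)"
  shows "p * p dvd det A"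
  unfolding det_col[OF A]
proof (rule dvd_sum)
  fix q assume "q \<in> {q. q permutes {0..<n}}"
  then have q: "q k < n" if "k < n" for k
    using that permutes_in_image[of q "{0..<n}" k] by auto
  \<comment> \<open>Each Leibniz term has one factor from column \<open>i\<close> and another from
    column \<open>j\<close>.\<close>
  have "(\<Prod>k<n. A $$ (q k, k)) =
      A $$ (q i, i) * (A $$ (q j, j) * (\<Prod>k\<in>{..<n} - {i} - {j}. A $$ (q k, k)))"
    using ij by (subst prod.remove[of _ i], simp, simp, subst prod.remove[of _ j], auto)
  also have "p * p dvd \<dots>"
    using di[OF q[OF ij(1)]] dj[OF q[OF ij(2)]] by (simp add: mult.assoc[symmetric] mult_dvd_mono)
  finally show "p * p dvd signof q * (\<Prod>k<n. A $$ (q k, k))"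
    by (rule dvd_mult)
qed

text \<open>Multiplying the characteristic matrix by an invertible constant matrix with the two
  eigenvectors among its columns makes two columns divisible by X - l, so the determinant gains the
  square of this factor. No diagonalization is involved. The zero pattern of \<open>v\<close> and
  \<open>w\<close> at \<open>i\<close> and \<open>j\<close> encodes their independence.\<close>

lemma order_char_poly_ge_2:
  fixes A :: "real mat" and v w :: "nat \<Rightarrow> real"
  assumes A: "A \<in> carrier_mat n n"
    and v: "\<And>r. r < n \<Longrightarrow> (\<Sum>k<n. A $$ (r,k) * v k) = l * v r"
    and w: "\<And>r. r < n \<Longrightarrow> (\<Sum>k<n. A $$ (r,k) * w k) = l * w r"
    and i: "i < n" "v i \<noteq> 0" "w i = 0" and j: "j < n" "w j \<noteq> 0"
  shows "2 \<le> Polynomial.order l (char_poly A)"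
proof -
  \<comment> \<open>The identity matrix with columns \<open>i\<close> and \<open>j\<close> replaced
    by \<open>v\<close> and \<open>w\<close>. \<open>PP\<close> is the same matrix with constant
    polynomials as entries, so its determinant does not vanish at \<open>l\<close>.\<close>
  define f where "f = (\<lambda>r c. if c = i then v r else if c = j then w r else if r = c then 1 else 0 :: real)"
  define P where "P = mat n n (\<lambda>(r,c). f r c)"
  define PP where "PP = mat n n (\<lambda>(r,c). [:f r c:])"
  have ij: "i \<noteq> j" using i j by auto
  have P: "P \<in> carrier_mat n n" and PP: "PP \<in> carrier_mat n n"
    by (auto simp: P_def PP_def)
  have "det P \<noteq> 0"
  proof
    assume "det P = 0"
    then obtain x where x: "x \<in> carrier_vec n" "x \<noteq> 0\<^sub>v n" "P *\<^sub>v x = 0\<^sub>v n"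
      using det_0_iff_vec_prod_zero[OF P] by auto
    have row: "(\<Sum>c<n. f r c * x $ c) = 0" if "r < n" for r
    proof -
      have "(P *\<^sub>v x) $ r = (\<Sum>c<n. f r c * x $ c)"
        using that x(1) by (simp add: P_def scalar_prod_def atLeast0LessThan)
      then show ?thesis using x(3) that by simp
    qed
    have expand: "(\<Sum>c<n. f r c * x $ c) = v r * x $ i + w r * x $ j + (if r = i \<or> r = j then 0 else x $ r)"
      if "r < n" for r
    proof -
      have "(\<Sum>c<n. f r c * x $ c) = v r * x $ i + (\<Sum>c\<in>{..<n}-{i}. f r c * x $ c)"
        using i by (subst sum.remove[of _ i]) (auto simp: f_def)
      also have "(\<Sum>c\<in>{..<n}-{i}. f r c * x $ c) = w r * x $ j + (\<Sum>c\<in>{..<n}-{i}-{j}. f r c * x $ c)"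
        using ij j by (subst sum.remove[of _ j]) (auto simp: f_def)
      also have "(\<Sum>c\<in>{..<n}-{i}-{j}. f r c * x $ c) = (\<Sum>c\<in>{..<n}-{i}-{j}. if c = r then x $ c else 0)"
        by (rule sum.cong) (auto simp: f_def)
      also have "\<dots> = (if r = i \<or> r = j then 0 else x $ r)"
        using that by (auto simp: sum.delta)
      finally show ?thesis by simp
    qed
    have xi: "x $ i = 0" using row[OF i(1)] expand[OF i(1)] i by simp
    have xj: "x $ j = 0" using row[OF j(1)] expand[OF j(1)] j xi by simp
    have "x $ r = 0" if "r < n" for r
      using row[OF that] expand[OF that] xi xj by (cases "r = i \<or> r = j") auto
    then have "x = 0\<^sub>v n" using x(1) by (intro eq_vecI) auto
    with x(2) show False by simp
  qed
  have polyPP: "poly (det PP) 0 \<noteq> 0"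
  proof -
    have "poly (det PP) 0 = det P"
      by (rule poly_det_cong[OF P PP]) (auto simp: P_def PP_def)
    then show ?thesis using \<open>det P \<noteq> 0\<close> by simp
  qed
  have detPP: "poly (det PP) l \<noteq> 0"
  proof -
    have "poly (det PP) l = det P"
      by (rule poly_det_cong[OF P PP]) (auto simp: P_def PP_def)
    then show ?thesis using \<open>det P \<noteq> 0\<close> by simp
  qed
  let ?C = "char_poly_matrix A"
  have C: "?C \<in> carrier_mat n n" using A by simp
  have Centry: "?C $$ (r,k) = (if r = k then [:0,1:] else 0) + [:- (A $$ (r,k)):]"
    if "r < n" "k < n" for r k
    using that A by (auto simp: char_poly_matrix_def)
  have prod_entry: "(?C * PP) $$ (r,c) = [:- l, 1:] * [:u r:]"
    if rc: "r < n" "c < n" and fc: "\<And>k. k < n \<Longrightarrow> f k c = u k"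
      and u: "(\<Sum>k<n. A $$ (r,k) * u k) = l * u r" for r c u
  proof -
    have "(?C * PP) $$ (r,c) = (\<Sum>k<n. ?C $$ (r,k) * [:f k c:])"
      using rc C by (simp add: PP_def scalar_prod_def atLeast0LessThan)
    also have "\<dots> = (\<Sum>k<n. (if r = k then [:0,1:] * [:u k:] else 0) - [:A $$ (r,k) * u k:])"
      by (rule sum.cong) (auto simp: Centry rc fc algebra_simps)
    also have "\<dots> = [:0,1:] * [:u r:] - [:\<Sum>k<n. A $$ (r,k) * u k:]"
    proof -
      have "(\<Sum>k<n. [:A $$ (r,k) * u k:]) = [:\<Sum>k<n. A $$ (r,k) * u k:]"
        by (induction n) auto
      then show ?thesis using rc by (simp add: sum_subtractf)
    qed
    also have "\<dots> = [:- l, 1:] * [:u r:]"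
      by (simp add: u)
    finally show ?thesis .
  qed
  have "[:- l, 1:] * [:- l, 1:] dvd det (?C * PP)"
  proof (rule det_dvd_two_columns[of _ n i j])
    show "?C * PP \<in> carrier_mat n n" using C PP by auto
    show "[:- l, 1:] dvd (?C * PP) $$ (r, i)" if "r < n" for r
    proof -
      have "(?C * PP) $$ (r, i) = [:- l, 1:] * [:v r:]"
        by (rule prod_entry) (use that i v in \<open>auto simp: f_def\<close>)
      then show ?thesis by (metis dvd_triv_left)
    qed
    show "[:- l, 1:] dvd (?C * PP) $$ (r, j)" if "r < n" for r
    proof -
      have "(?C * PP) $$ (r, j) = [:- l, 1:] * [:w r:]"
        by (rule prod_entry) (use that j ij w in \<open>auto simp: f_def\<close>)
      then show ?thesis by (metis dvd_triv_left)
    qed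
  qed (use i j ij in auto)
  then have dvd: "[:- l, 1:] ^ 2 dvd char_poly A * det PP"
    by (simp add: det_mult[OF C PP] char_poly_def power2_eq_square)
  have cp0: "char_poly A \<noteq> 0"
    using degree_monic_char_poly[OF A] by auto
  have pp0: "det PP \<noteq> 0" using detPP by auto
  have "2 \<le> Polynomial.order l (char_poly A * det PP)"
    using dvd cp0 pp0 by (simp add: order_divides)
  also have "\<dots> = Polynomial.order l (char_poly A)"
    using cp0 pp0 detPP by (simp add: order_mult order_0I)
  finally show ?thesis .
qed

section \<open>Quadratic forms and orthogonal eigenvectors\<close>

definition quadratic :: "'i set \<Rightarrow> ('i \<Rightarrow> 'i \<Rightarrow> real) \<Rightarrow> ('i \<Rightarrow> real) \<Rightarrow> ('i \<Rightarrow> real) \<Rightarrow> real" where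
  "quadratic I m x y = (\<Sum>i\<in>I. \<Sum>j\<in>I. m i j * x i * y j)"

lemma quadratic_add_left: "quadratic I m (\<lambda>i. x i + x' i) y = quadratic I m x y + quadratic I m x' y"
  by (simp add: quadratic_def algebra_simps sum.distrib)

lemma quadratic_scale_left: "quadratic I m (\<lambda>i. c * x i) y = c * quadratic I m x y"
  by (simp add: quadratic_def sum_distrib_left algebra_simps)

lemma quadratic_add_right: "quadratic I m x (\<lambda>i. y i + y' i) = quadratic I m x y + quadratic I m x y'"
  by (simp add: quadratic_def algebra_simps sum.distrib)

lemma quadratic_scale_right: "quadratic I m x (\<lambda>i. c * y i) = c * quadratic I m x y"
  by (simp add: quadratic_def sum_distrib_left algebra_simps)

lemmas quadratic_linear = quadratic_add_left quadratic_scale_left quadratic_add_right quadratic_scale_right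

lemma quadratic_commute:
  assumes "\<And>i j. i \<in> I \<Longrightarrow> j \<in> I \<Longrightarrow> m i j = m j i"
  shows "quadratic I m x y = quadratic I m y x"
proof -
  have "quadratic I m x y = (\<Sum>j\<in>I. \<Sum>i\<in>I. m i j * x i * y j)"
    unfolding quadratic_def by (rule sum.swap)
  also have "\<dots> = quadratic I m y x"
    unfolding quadratic_def by (intro sum.cong refl) (simp add: assms)
  finally show ?thesis .
qed

lemma quadratic_eq_sum_row: "quadratic I m x y = (\<Sum>i\<in>I. x i * (\<Sum>j\<in>I. m i j * y j))"
  by (simp add: quadratic_def sum_distrib_left algebra_simps)

lemma quadratic_cong:
  assumes "\<And>i. i \<in> I \<Longrightarrow> x i = x' i" "\<And>i. i \<in> I \<Longrightarrow> y i = y' i"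
  shows "quadratic I m x y = quadratic I m x' y'"
  unfolding quadratic_def using assms by (intro sum.cong refl) simp

lemma linear_term_zero:
  fixes a b :: real
  assumes "\<And>s. 0 \<le> a + s * b"
  shows "b = 0"
proof (rule ccontr)
  assume b: "b \<noteq> 0"
  show False using assms[of "- (a + 1) / b"] b by (simp add: field_simps)
qed

text \<open>A maximum of the form on the unit sphere of the orthogonal complement of
  \<open>u\<close> is an eigenvector, because the complement of an eigenvector is invariant. With
  \<open>u\<close> = 0 this yields a first eigenvector, and with that one as \<open>u\<close> a
  second.\<close>

lemma eigenvector_orthogonal:
  fixes m :: "nat \<Rightarrow> nat \<Rightarrow> real"
  assumes sym: "\<And>i j. i < n \<Longrightarrow> j < n \<Longrightarrow> m i j = m j i"
    and u: "\<And>i. i < n \<Longrightarrow> (\<Sum>j<n. m i j * u j) = \<mu> * u i"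
    and z: "(\<Sum>i<n. u i * z i) = 0" "0 < quadratic {..<n} m z z"
  obtains w l where "0 < l" "\<And>i. i < n \<Longrightarrow> (\<Sum>j<n. m i j * w j) = l * w i"
    "(\<Sum>i<n. u i * w i) = 0" "(\<Sum>i<n. w i * w i) = 1"
proof -
  let ?Q = "quadratic {..<n} m"
  \<comment> \<open>Coordinates from \<open>n\<close> on are fixed at 0 and the others confined to
    [-1, 1], so the box is compact in the space of all sequences.\<close>
  define B where "B = (PiE UNIV (\<lambda>i. if i < n then {-1..1} else {0}) :: (nat \<Rightarrow> real) set)"
  have "compactin (product_topology (\<lambda>i. euclidean) UNIV) B"
    unfolding B_def by (subst compactin_PiE) (auto simp: compactin_euclidean_iff)
  then have compB: "compact B"
    by (simp add: euclidean_product_topology compactin_euclidean_iff)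
  define S where "S = B \<inter> ({x. (\<Sum>i<n. x i * x i) = 1} \<inter> {x. (\<Sum>i<n. u i * x i) = 0})"
  have cont: "continuous_on A (\<lambda>x::nat \<Rightarrow> real. x i)" for A i
    by (rule continuous_on_subset[OF continuous_on_product_coordinates]) auto
  have "closed {x::nat \<Rightarrow> real. (\<Sum>i<n. x i * x i) = 1}"
    by (intro closed_Collect_eq continuous_intros cont)
  moreover have "closed {x::nat \<Rightarrow> real. (\<Sum>i<n. u i * x i) = 0}"
    by (intro closed_Collect_eq continuous_intros cont)
  ultimately have compS: "compact S"
    unfolding S_def by (intro compact_Int_closed compB closed_Int)
  have normalise: "\<exists>x\<in>S. \<exists>c. 0 < c \<and> c * c = (\<Sum>i<n. y i * y i) \<and> (\<forall>i<n. y i = c * x i)"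
    if y: "(\<Sum>i<n. u i * y i) = 0" "(\<Sum>i<n. y i * y i) \<noteq> 0" for y :: "nat \<Rightarrow> real"
  proof -
    let ?N = "\<Sum>i<n. y i * y i"
    have N: "0 < ?N" using y(2) by (smt (verit) sum_nonneg zero_le_square)
    let ?c = "sqrt ?N"
    let ?x = "\<lambda>i. if i < n then y i / ?c else 0"
    have c: "0 < ?c" "?c * ?c = ?N" using N by auto
    have "(\<Sum>i<n. ?x i * ?x i) = (\<Sum>i<n. y i * y i / ?N)"
      using c(2) by (intro sum.cong) auto
    also have "\<dots> = 1" using N by (simp add: sum_divide_distrib[symmetric])
    finally have x1: "(\<Sum>i<n. ?x i * ?x i) = 1" .
    have "(\<Sum>i<n. u i * ?x i) = (\<Sum>i<n. u i * y i / ?c)"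
      by (intro sum.cong) auto
    then have x2: "(\<Sum>i<n. u i * ?x i) = 0" using y(1) by (simp add: sum_divide_distrib[symmetric])
    have absx: "\<bar>?x i\<bar> \<le> 1" if "i < n" for i
    proof -
      have "?x i * ?x i \<le> (\<Sum>i<n. ?x i * ?x i)"
        using that by (intro member_le_sum) auto
      then have "(?x i)\<^sup>2 \<le> 1" using x1 by (simp add: power2_eq_square)
      then show ?thesis by (simp add: abs_square_le_1)
    qed
    have "?x i \<in> (if i < n then {-1..1} else {0})" for i
    proof (cases "i < n")
      case True
      have "- 1 \<le> ?x i" "?x i \<le> 1" using absx[OF True] by (simp_all only: abs_le_iff, linarith)
      then show ?thesis unfolding if_P[OF True] by (simp only: atLeastAtMost_iff)
    next
      case False
      then show ?thesis by (simp only: if_False singleton_iff)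
    qed
    then have "?x \<in> B" unfolding B_def PiE_UNIV_domain by blast
    then have "?x \<in> S" using x1 x2 by (simp add: S_def)
    then show ?thesis using c by (intro bexI[of _ ?x] exI[of _ ?c]) auto
  qed
  have z0: "(\<Sum>i<n. z i * z i) \<noteq> 0"
  proof
    assume "(\<Sum>i<n. z i * z i) = 0"
    then have "\<forall>i<n. z i = 0" by (subst (asm) sum_nonneg_eq_0_iff) auto
    then have "?Q z z = 0" by (simp add: quadratic_def)
    with z(2) show False by simp
  qed
  obtain z' c where z': "z' \<in> S" "0 < c" "\<forall>i<n. z i = c * z' i"
    using normalise[OF z(1) z0] by blast
  have "?Q z z = ?Q (\<lambda>i. c * z' i) (\<lambda>i. c * z' i)"
    using z'(3) by (intro quadratic_cong) auto
  also have "\<dots> = c * (c * ?Q z' z')" by (simp add: quadratic_linear)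
  finally have Qz': "0 < ?Q z' z'" using z(2) z'(2) by (simp add: zero_less_mult_iff)
  have "continuous_on S (\<lambda>x. ?Q x x)"
    unfolding quadratic_def by (intro continuous_intros cont)
  with compS z'(1) obtain w where w: "w \<in> S" "\<And>x. x \<in> S \<Longrightarrow> ?Q x x \<le> ?Q w w"
    using continuous_attains_sup[of S "\<lambda>x. ?Q x x"] by blast
  define l where "l = ?Q w w"
  have l: "0 < l" using w(2)[OF z'(1)] Qz' by (simp add: l_def)
  have w1: "(\<Sum>i<n. w i * w i) = 1" and w2: "(\<Sum>i<n. u i * w i) = 0"
    using w(1) by (auto simp: S_def)
  have max: "?Q y y \<le> l * (\<Sum>i<n. y i * y i)" if y: "(\<Sum>i<n. u i * y i) = 0" for y
  proof (cases "(\<Sum>i<n. y i * y i) = 0")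
    case True
    then have "\<forall>i<n. y i = 0" by (subst (asm) sum_nonneg_eq_0_iff) auto
    then show ?thesis by (simp add: quadratic_def)
  next
    case False
    then obtain x c where x: "x \<in> S" "0 < c" "c * c = (\<Sum>i<n. y i * y i)" "\<forall>i<n. y i = c * x i"
      using normalise[OF y] by blast
    have "?Q y y = ?Q (\<lambda>i. c * x i) (\<lambda>i. c * x i)"
      using x(4) by (intro quadratic_cong) auto
    also have "\<dots> = (c * c) * ?Q x x" by (simp add: quadratic_linear)
    also have "\<dots> \<le> (c * c) * l" using w(2)[OF x(1)] x(2) by (simp add: l_def)
    also have "(c * c) * l = l * (\<Sum>i<n. y i * y i)" unfolding x(3) by (rule mult.commute)
    finally show ?thesis .
  qed
  \<comment> \<open>The residual of the eigenvalue equation. It is shown to be orthogonal to every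
    \<open>h\<close> orthogonal to \<open>u\<close>, and then to be such an \<open>h\<close>
    itself.\<close>
  define g where "g = (\<lambda>i. l * w i - (\<Sum>j<n. m i j * w j))"
  have comm: "?Q x y = ?Q y x" for x y
    by (rule quadratic_commute) (simp add: sym)
  have pair: "(\<Sum>i<n. h i * g i) = l * (\<Sum>i<n. h i * w i) - ?Q h w" for h
  proof -
    have "(\<Sum>i<n. h i * g i) = (\<Sum>i<n. l * (h i * w i) - h i * (\<Sum>j<n. m i j * w j))"
      by (intro sum.cong refl) (simp only: g_def right_diff_distrib mult.left_commute)
    then show ?thesis by (simp only: sum_subtractf quadratic_eq_sum_row sum_distrib_left[of l, symmetric])
  qed
  have orth: "(\<Sum>i<n. h i * g i) = 0" if h: "(\<Sum>i<n. u i * h i) = 0" for h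
  proof -
    define b where "b = l * (\<Sum>i<n. h i * w i) - ?Q h w"
    define a where "a = l * (\<Sum>i<n. h i * h i) - ?Q h h"
    \<comment> \<open>The maximality bound at \<open>h\<close> + s \<open>w\<close>: the terms
      quadratic in \<open>s\<close> cancel since \<open>w\<close> is a unit vector with value
      \<open>l\<close>, and a nonnegative affine function remains.\<close>
    have "0 \<le> a + s * (2 * b)" for s :: real
    proof -
      let ?y = "\<lambda>i. h i + s * w i"
      have "(\<Sum>i<n. u i * ?y i) = (\<Sum>i<n. u i * h i) + s * (\<Sum>i<n. u i * w i)"
        by (simp add: distrib_left sum.distrib sum_distrib_left mult.left_commute)
      then have "?Q ?y ?y \<le> l * (\<Sum>i<n. ?y i * ?y i)"
        using h w2 by (intro max) simp
      also have "(\<Sum>i<n. ?y i * ?y i) = (\<Sum>i<n. h i * h i) + 2 * s * (\<Sum>i<n. h i * w i) + s * s * (\<Sum>i<n. w i * w i)"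
        by (simp add: algebra_simps sum.distrib sum_distrib_left)
      also have "?Q ?y ?y = ?Q h h + 2 * s * ?Q h w + s * s * l"
        using comm[of w h] by (simp only: quadratic_linear l_def) (simp add: algebra_simps)
      finally show ?thesis
        using w1 by (simp add: a_def b_def algebra_simps)
    qed
    then have "2 * b = 0" by (rule linear_term_zero)
    then show ?thesis by (simp add: b_def pair)
  qed
  have "(\<Sum>i<n. u i * g i) = l * (\<Sum>i<n. u i * w i) - ?Q u w" by (rule pair)
  also have "?Q u w = ?Q w u" by (rule comm)
  also have "\<dots> = (\<Sum>i<n. w i * (\<mu> * u i))"
    unfolding quadratic_eq_sum_row by (intro sum.cong) (auto simp: u)
  also have "\<dots> = \<mu> * (\<Sum>i<n. u i * w i)"
    by (simp only: sum_distrib_left mult.commute[of "w _"] mult.assoc)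
  finally have "(\<Sum>i<n. u i * g i) = 0" using w2 by simp
  from orth[OF this] have "(\<Sum>i<n. g i * g i) = 0" .
  then have "\<forall>i<n. g i = 0" by (subst (asm) sum_nonneg_eq_0_iff) auto
  then have eig: "(\<Sum>j<n. m i j * w j) = l * w i" if "i < n" for i
    using that by (simp add: g_def)
  show ?thesis by (rule that[OF l eig w2 w1])
qed

text \<open>The positive index of inertia is at most 1. Unlike an eigenvalue count, this form passes
  directly to principal submatrices and survives reindexing. Positivity makes \<open>x\<close> and
  \<open>y\<close> independent.\<close>

definition no_positive_plane :: "'i set \<Rightarrow> ('i \<Rightarrow> 'i \<Rightarrow> real) \<Rightarrow> bool" where
  "no_positive_plane I m \<longleftrightarrow>
     \<not> (\<exists>x y. \<forall>a b. (a, b) \<noteq> (0, 0) \<longrightarrow>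
          0 < quadratic I m (\<lambda>i. a * x i + b * y i) (\<lambda>i. a * x i + b * y i))"

text \<open>A positive plane contains a vector orthogonal to a first positive eigenvector and so
  produces a second, orthogonal one. Either the two eigenvalues differ, or their common value has
  algebraic multiplicity at least 2.\<close>

lemma no_positive_plane_if_one_positive_eigenvalue:
  fixes m :: "nat \<Rightarrow> nat \<Rightarrow> real"
  assumes sym: "\<And>i j. i < n \<Longrightarrow> j < n \<Longrightarrow> m i j = m j i"
    and one: "num_positive_eigenvalues (mat n n (\<lambda>(i,j). m i j)) = 1"
  shows "no_positive_plane {..<n} m"
proof (rule ccontr)
  assume "\<not> no_positive_plane {..<n} m"
  then obtain x y where pos: "\<And>a b. (a, b) \<noteq> (0, 0) \<Longrightarrow>
      0 < quadratic {..<n} m (\<lambda>i. a * x i + b * y i) (\<lambda>i. a * x i + b * y i)"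
    unfolding no_positive_plane_def by blast
  let ?A = "mat n n (\<lambda>(i,j). m i j)"
  have A: "?A \<in> carrier_mat n n" by simp
  have x0: "0 < quadratic {..<n} m x x" using pos[of 1 0] by simp
  obtain w1 l1 where w1: "0 < l1" "\<And>i. i < n \<Longrightarrow> (\<Sum>j<n. m i j * w1 j) = l1 * w1 i"
    "(\<Sum>i<n. w1 i * w1 i) = 1"
  proof (rule eigenvector_orthogonal[of n m "\<lambda>_. 0" 0 x])
    show "\<And>i j. i < n \<Longrightarrow> j < n \<Longrightarrow> m i j = m j i" by (rule sym)
    show "0 < quadratic {..<n} m x x" by (rule x0)
    fix w l
    assume "0 < l" "\<And>i. i < n \<Longrightarrow> (\<Sum>j<n. m i j * w j) = l * w i" "(\<Sum>i<n. w i * w i) = 1"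
    then show thesis by (rule that)
  qed simp_all
  obtain a b where ab: "(a, b) \<noteq> (0, 0)" "a * (\<Sum>i<n. w1 i * x i) + b * (\<Sum>i<n. w1 i * y i) = 0"
  proof (cases "(\<Sum>i<n. w1 i * y i) = 0")
    case True
    then show ?thesis using that[of 0 1] by simp
  next
    case False
    then show ?thesis using that[of "\<Sum>i<n. w1 i * y i" "- (\<Sum>i<n. w1 i * x i)"] by simp
  qed
  define z where "z = (\<lambda>i. a * x i + b * y i)"
  have "(\<Sum>i<n. w1 i * z i) = 0"
    using ab(2) by (simp add: z_def algebra_simps sum.distrib sum_distrib_left)
  note z1 = this
  have z2: "0 < quadratic {..<n} m z z" using pos[OF ab(1)] by (simp add: z_def)
  obtain w2 l2 where w2: "0 < l2" "\<And>i. i < n \<Longrightarrow> (\<Sum>j<n. m i j * w2 j) = l2 * w2 i"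
    "(\<Sum>i<n. w1 i * w2 i) = 0" "(\<Sum>i<n. w2 i * w2 i) = 1"
  proof (rule eigenvector_orthogonal[of n m w1 l1 z])
    show "\<And>i j. i < n \<Longrightarrow> j < n \<Longrightarrow> m i j = m j i" by (rule sym)
    show "(\<Sum>i<n. w1 i * z i) = 0" by (rule z1)
    show "0 < quadratic {..<n} m z z" by (rule z2)
    show "\<And>i. i < n \<Longrightarrow> (\<Sum>j<n. m i j * w1 j) = l1 * w1 i" by (rule w1(2))
    fix w l
    assume "0 < l" "\<And>i. i < n \<Longrightarrow> (\<Sum>j<n. m i j * w j) = l * w i" "(\<Sum>i<n. w1 i * w i) = 0" "(\<Sum>i<n. w i * w i) = 1"
    then show thesis by (rule that)
  qed
  have eig: "eigenvalue ?A l" if w: "\<And>i. i < n \<Longrightarrow> (\<Sum>j<n. m i j * w j) = l * w i" "(\<Sum>i<n. w i * w i) = 1"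
    for w l
  proof -
    have "vec n w \<noteq> 0\<^sub>v n"
    proof
      assume "vec n w = 0\<^sub>v n"
      then have "w i = 0" if "i < n" for i using that by (metis index_vec index_zero_vec(1))
      then show False using w(2) by simp
    qed
    moreover have "?A *\<^sub>v vec n w = l \<cdot>\<^sub>v vec n w"
      by (rule eq_vecI) (auto simp: scalar_prod_def atLeast0LessThan w(1))
    ultimately show ?thesis unfolding eigenvalue_def eigenvector_def by (intro exI[of _ "vec n w"]) auto
  qed
  have e1: "eigenvalue ?A l1" using eig w1 by blast
  have e2: "eigenvalue ?A l2" using eig w2 by blast
  have cp0: "char_poly ?A \<noteq> 0" using degree_monic_char_poly[OF A] by auto
  let ?E = "{x. eigenvalue ?A x \<and> 0 < x}"
  have fin: "finite ?E"
    using poly_roots_finite[OF cp0] by (rule rev_finite_subset) (auto simp: eigenvalue_root_char_poly[OF A])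
  have ord: "1 \<le> Polynomial.order l (char_poly ?A)" if "eigenvalue ?A l" for l
    using that cp0 by (simp add: eigenvalue_root_char_poly[OF A] order_root Suc_leI)
  have "2 \<le> (\<Sum>x\<in>?E. Polynomial.order x (char_poly ?A))"
  proof (cases "l1 = l2")
    case False
    have "2 \<le> (\<Sum>x\<in>{l1,l2}. Polynomial.order x (char_poly ?A))"
      using False ord[OF e1] ord[OF e2] by simp
    also have "\<dots> \<le> (\<Sum>x\<in>?E. Polynomial.order x (char_poly ?A))"
      using fin e1 e2 w1(1) w2(1) by (intro sum_mono2) auto
    finally show ?thesis .
  next
    case True
    have "\<exists>i<n. w1 i \<noteq> 0"
    proof (rule ccontr)
      assume "\<not> ?thesis"
      then have "(\<Sum>i<n. w1 i * w1 i) = 0" by simp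
      then show False using w1(3) by simp
    qed
    then obtain i where i: "i < n" "w1 i \<noteq> 0" by blast
    \<comment> \<open>Subtracting a multiple of \<open>w1\<close> gives the normal form that
      \<open>order_char_poly_ge_2\<close> expects: the second eigenvector vanishes at
      \<open>i\<close>.\<close>
    define w where "w = (\<lambda>k. w2 k - (w2 i / w1 i) * w1 k)"
    have wi: "w i = 0" using i by (simp add: w_def)
    have "\<exists>j<n. w j \<noteq> 0"
    proof (rule ccontr)
      assume "\<not> ?thesis"
      then have eq: "w2 k = (w2 i / w1 i) * w1 k" if "k < n" for k using that by (auto simp: w_def)
      have "(\<Sum>k<n. w1 k * w2 k) = (\<Sum>k<n. (w2 i / w1 i) * (w1 k * w1 k))"
        by (intro sum.cong) (auto simp: eq)
      also have "\<dots> = (w2 i / w1 i) * (\<Sum>k<n. w1 k * w1 k)" by (rule sum_distrib_left[symmetric])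
      finally have c0: "w2 i / w1 i = 0" unfolding w2(3) w1(3) by simp
      have "w2 k = 0" if "k < n" for k using eq[OF that] unfolding c0 by simp
      then show False using w2(4) by simp
    qed
    then obtain j where j: "j < n" "w j \<noteq> 0" by blast
    have wrow: "(\<Sum>k<n. m r k * w k) = l1 * w r" if "r < n" for r
    proof -
      have "(\<Sum>k<n. m r k * w k) = (\<Sum>k<n. m r k * w2 k) - (w2 i / w1 i) * (\<Sum>k<n. m r k * w1 k)"
        by (simp add: w_def algebra_simps sum_subtractf sum_distrib_left)
      then show ?thesis using w1(2)[OF that] w2(2)[OF that] True by (simp add: w_def algebra_simps)
    qed
    have "2 \<le> Polynomial.order l1 (char_poly ?A)"
      by (rule order_char_poly_ge_2[OF A, of w1 l1 w i j]) (use w1(2) wrow i j wi in auto)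
    also have "\<dots> \<le> (\<Sum>x\<in>?E. Polynomial.order x (char_poly ?A))"
      using fin e1 w1(1) by (intro member_le_sum) auto
    finally show ?thesis .
  qed
  then show False using one by (simp add: num_positive_eigenvalues_def)
qed

section \<open>Linear systems and negative semidefinite hyperplanes\<close>

lemma homogeneous_system_coeff:
  fixes a :: "'q \<Rightarrow> 'u \<Rightarrow> real"
  assumes "finite Q" "finite U" "card Q < card U"
  shows "\<exists>z. (\<exists>u\<in>U. z u \<noteq> 0) \<and> (\<forall>u. u \<notin> U \<longrightarrow> z u = 0) \<and> (\<forall>q\<in>Q. (\<Sum>u\<in>U. a q u * z u) = 0)"
  using assms
proof (induction Q arbitrary: U a rule: finite_induct)
  case empty
  then obtain u where "u \<in> U" by (metis card.empty card_gt_0_iff ex_in_conv)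
  then show ?case by (intro exI[of _ "\<lambda>x. if x = u then 1 else 0"]) auto
next
  case (insert q Q)
  show ?case
  proof (cases "\<forall>u\<in>U. a q u = 0")
    case True
    have "card Q < card U" using insert by simp
    from insert.IH[OF insert.prems(1) this, of a] True show ?thesis by force
  next
    case False
    then obtain u0 where u0: "u0 \<in> U" "a q u0 \<noteq> 0" by blast
    let ?U = "U - {u0}"
    have cU: "card Q < card ?U" using insert u0 by simp
    \<comment> \<open>Gaussian elimination: equation \<open>q\<close> has a pivot at
      \<open>u0\<close>, which is removed from the other equations; \<open>t\<close> below solves
      \<open>q\<close> for \<open>u0\<close>.\<close>
    define a' where "a' = (\<lambda>p u. a p u - a p u0 * a q u / a q u0)"
    obtain z where z: "\<exists>u\<in>?U. z u \<noteq> 0" "\<forall>u. u \<notin> ?U \<longrightarrow> z u = 0"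
      "\<forall>p\<in>Q. (\<Sum>u\<in>?U. a' p u * z u) = 0"
      using insert.IH[of ?U a'] cU insert.prems(1) by auto
    define t where "t = - (\<Sum>u\<in>?U. a q u * z u) / a q u0"
    let ?z = "z(u0 := t)"
    have split: "(\<Sum>u\<in>U. a p u * ?z u) = a p u0 * t + (\<Sum>u\<in>?U. a p u * z u)" for p
      using insert.prems(1) u0(1) by (subst sum.remove[of _ u0]) (auto intro!: sum.cong)
    have "(\<Sum>u\<in>U. a q u * ?z u) = 0" unfolding split using u0(2) by (simp add: t_def)
    moreover have "(\<Sum>u\<in>U. a p u * ?z u) = 0" if "p \<in> Q" for p
    proof -
      have "0 = (\<Sum>u\<in>?U. a' p u * z u)" using z(3) that by simp
      also have "\<dots> = (\<Sum>u\<in>?U. a p u * z u - a p u0 / a q u0 * (a q u * z u))"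
        by (intro sum.cong refl) (simp add: a'_def left_diff_distrib)
      also have "\<dots> = (\<Sum>u\<in>?U. a p u * z u) - a p u0 / a q u0 * (\<Sum>u\<in>?U. a q u * z u)"
        by (simp only: sum_subtractf sum_distrib_left)
      finally show ?thesis unfolding split by (simp add: t_def)
    qed
    moreover have "\<exists>u\<in>U. ?z u \<noteq> 0" using z(1) by auto
    moreover have "\<forall>u. u \<notin> U \<longrightarrow> ?z u = 0" using z(2) u0(1) by auto
    ultimately show ?thesis by (intro exI[of _ ?z]) auto
  qed
qed

section \<open>Linear systems given by functionals\<close>

definition linear_functional :: "(('u \<Rightarrow> real) \<Rightarrow> real) \<Rightarrow> bool" where
  "linear_functional L \<longleftrightarrow> (\<forall>a b y z. L (\<lambda>u. a * y u + b * z u) = a * L y + b * L z)"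

lemma linear_functional_combination:
  assumes "linear_functional L"
  shows "L (\<lambda>u. a * y u + b * z u) = a * L y + b * L z"
  using assms unfolding linear_functional_def
  by - (drule spec[of _ a], drule spec[of _ b], drule spec[of _ y], drule spec[of _ z], assumption)

lemma linear_functional_zero: "linear_functional L \<Longrightarrow> L (\<lambda>u. 0) = 0"
  using linear_functional_combination[of L 0 "\<lambda>_. 0" 0 "\<lambda>_. 0"] by simp

lemma linear_functional_finite_support:
  assumes L: "linear_functional L" and "finite U" and "\<And>u. u \<notin> U \<Longrightarrow> z u = 0"
  shows "L z = (\<Sum>u\<in>U. L (\<lambda>x. if x = u then 1 else 0) * z u)"
  using assms(2,3)
proof (induction U arbitrary: z rule: finite_induct)
  case empty
  then have "z = (\<lambda>u. 0)" by auto
  then show ?case using linear_functional_zero[OF L] by simp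
next
  case (insert v U)
  let ?e = "\<lambda>x. if x = v then 1 else 0 :: real"
  have "z = (\<lambda>u. z v * ?e u + 1 * (z(v := 0)) u)" by auto
  then have "L z = L (\<lambda>u. z v * ?e u + 1 * (z(v := 0)) u)" by (rule arg_cong)
  also have "\<dots> = z v * L ?e + 1 * L (z(v := 0))" by (rule linear_functional_combination[OF L])
  also have "L (z(v := 0)) = (\<Sum>u\<in>U. L (\<lambda>x. if x = u then 1 else 0) * (z(v := 0)) u)"
    by (rule insert.IH) (use insert.prems in auto)
  also have "\<dots> = (\<Sum>u\<in>U. L (\<lambda>x. if x = u then 1 else 0) * z u)"
    using insert.hyps by (intro sum.cong) auto
  finally show ?case using insert.hyps by simp
qed

text \<open>The coefficients are the values on indicator functions. Functionals spare writing out
  the coefficients of composite expressions such as those built from \<open>cochain\<close>.\<close>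

lemma homogeneous_system:
  assumes "finite Q" "finite U" "card Q < card U" and L: "\<And>q. q \<in> Q \<Longrightarrow> linear_functional (L q)"
  obtains z where "\<exists>u\<in>U. z u \<noteq> 0" "\<forall>u. u \<notin> U \<longrightarrow> z u = 0" "\<forall>q\<in>Q. L q z = 0"
proof -
  obtain z where z: "\<exists>u\<in>U. z u \<noteq> 0" "\<forall>u. u \<notin> U \<longrightarrow> z u = 0"
    "\<forall>q\<in>Q. (\<Sum>u\<in>U. L q (\<lambda>x. if x = u then 1 else 0) * z u) = 0"
    using homogeneous_system_coeff[OF assms(1-3), of "\<lambda>q u. L q (\<lambda>x. if x = u then 1 else 0)"] by blast
  have "\<forall>q\<in>Q. L q z = 0"
  proof
    fix q assume q: "q \<in> Q"
    have "L q z = (\<Sum>u\<in>U. L q (\<lambda>x. if x = u then 1 else 0) * z u)"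
      by (rule linear_functional_finite_support[OF L[OF q] assms(2)]) (use z(2) in blast)
    then show "L q z = 0" using z(3) q by simp
  qed
  with z(1,2) show ?thesis by (rule that)
qed

lemma linear_functionalI:
  assumes "\<And>a b y z. L (\<lambda>u. a * y u + b * z u) = a * L y + b * L z"
  shows "linear_functional L"
  unfolding linear_functional_def by (intro allI assms)

lemma linear_functional_eval: "linear_functional (\<lambda>z. z u)"
  by (rule linear_functionalI) (rule refl)

lemma linear_functional_const_zero: "linear_functional (\<lambda>z. 0)"
  by (rule linear_functionalI) simp

lemma linear_functional_add:
  assumes "linear_functional L"
    and "linear_functional L'"
  shows "linear_functional (\<lambda>z. L z + L' z)"
proof (rule linear_functionalI)
  fix a b y z
  show "(\<lambda>z. L z + L' z) (\<lambda>u. a * y u + b * z u) = a * (\<lambda>z. L z + L' z) y + b * (\<lambda>z. L z + L' z) z"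
    using linear_functional_combination[OF assms(1), of a y b z] linear_functional_combination[OF assms(2), of a y b z] by (simp add: algebra_simps)
qed

lemma linear_functional_diff:
  assumes "linear_functional L"
    and "linear_functional L'"
  shows "linear_functional (\<lambda>z. L z - L' z)"
proof (rule linear_functionalI)
  fix a b y z
  show "(\<lambda>z. L z - L' z) (\<lambda>u. a * y u + b * z u) = a * (\<lambda>z. L z - L' z) y + b * (\<lambda>z. L z - L' z) z"
    using linear_functional_combination[OF assms(1), of a y b z] linear_functional_combination[OF assms(2), of a y b z] by (simp add: algebra_simps)
qed

lemma linear_functional_minus:
  assumes "linear_functional L"
  shows "linear_functional (\<lambda>z. - L z)"
proof (rule linear_functionalI)
  fix a b y z
  show "(\<lambda>z. - L z) (\<lambda>u. a * y u + b * z u) = a * (\<lambda>z. - L z) y + b * (\<lambda>z. - L z) z"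
    using linear_functional_combination[OF assms(1), of a y b z] by (simp add: algebra_simps)
qed

lemma linear_functional_scale:
  assumes "linear_functional L"
  shows "linear_functional (\<lambda>z. c * L z)"
proof (rule linear_functionalI)
  fix a b y z
  show "(\<lambda>z. c * L z) (\<lambda>u. a * y u + b * z u) = a * (\<lambda>z. c * L z) y + b * (\<lambda>z. c * L z) z"
    using linear_functional_combination[OF assms(1), of a y b z] by (simp add: algebra_simps)
qed

lemma linear_functional_sum:
  assumes "\<And>i. i \<in> I \<Longrightarrow> linear_functional (L i)"
  shows "linear_functional (\<lambda>z. \<Sum>i\<in>I. L i z)"
proof (rule linear_functionalI)
  fix a b y z
  have "(\<Sum>i\<in>I. L i (\<lambda>u. a * y u + b * z u)) = (\<Sum>i\<in>I. a * L i y + b * L i z)"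
    by (intro sum.cong refl linear_functional_combination assms)
  then show "(\<Sum>i\<in>I. L i (\<lambda>u. a * y u + b * z u)) = a * (\<Sum>i\<in>I. L i y) + b * (\<Sum>i\<in>I. L i z)"
    by (simp only: sum.distrib sum_distrib_left)
qed

lemma linear_functional_if:
  "(P \<Longrightarrow> linear_functional L) \<Longrightarrow> (\<not> P \<Longrightarrow> linear_functional L') \<Longrightarrow>
    linear_functional (\<lambda>z. if P then L z else L' z)"
  by (cases P) auto

section \<open>Forms with at most one positive direction\<close>

lemma quadratic_shift:
  assumes "quadratic I m x y = quadratic I m y x"
  shows "quadratic I m (\<lambda>i. x i + s * y i) (\<lambda>i. x i + s * y i) =
    quadratic I m x x + 2 * s * quadratic I m x y + s * s * quadratic I m y y"
  unfolding quadratic_linear assms by (simp add: algebra_simps)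

text \<open>Along the line \<open>x\<close> + s \<open>y\<close> the form is affine in s because
  \<open>y\<close> is isotropic, and an affine function that is never positive is constant.\<close>

lemma quadratic_isotropic_zero:
  assumes comm: "quadratic I m x y = quadratic I m y x" and y: "quadratic I m y y = 0"
    and neg: "\<And>s. quadratic I m (\<lambda>i. x i + s * y i) (\<lambda>i. x i + s * y i) \<le> 0"
  shows "quadratic I m x y = 0"
proof -
  have "0 \<le> - quadratic I m x x + s * (- 2 * quadratic I m x y)" for s
    using neg[of s] unfolding quadratic_shift[OF comm] y by simp
  then show ?thesis using linear_term_zero by fastforce
qed

lemma no_positive_plane_subset:
  assumes "no_positive_plane I m" "J \<subseteq> I" "finite I"
  shows "no_positive_plane J m"
  unfolding no_positive_plane_def
proof safe
  fix x y
  assume pos: "\<forall>a b. (a, b) \<noteq> (0, 0) \<longrightarrow>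
    0 < quadratic J m (\<lambda>i. a * x i + b * y i) (\<lambda>i. a * x i + b * y i)"
  let ?x = "\<lambda>i. if i \<in> J then x i else 0" and ?y = "\<lambda>i. if i \<in> J then y i else 0"
  have "quadratic I m (\<lambda>i. a * ?x i + b * ?y i) (\<lambda>i. a * ?x i + b * ?y i) =
      quadratic J m (\<lambda>i. a * x i + b * y i) (\<lambda>i. a * x i + b * y i)" for a b
  proof -
    let ?v = "\<lambda>i. a * ?x i + b * ?y i"
    have "quadratic I m ?v ?v = (\<Sum>i\<in>J. \<Sum>j\<in>I. m i j * ?v i * ?v j)"
      unfolding quadratic_def using assms(2,3) by (intro sum.mono_neutral_right) auto
    also have "\<dots> = (\<Sum>i\<in>J. \<Sum>j\<in>J. m i j * ?v i * ?v j)"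
      using assms(2,3) by (intro sum.cong refl sum.mono_neutral_right) auto
    finally show ?thesis by (simp add: quadratic_def)
  qed
  note restrict = this
  have "\<exists>x y. \<forall>a b. (a, b) \<noteq> (0, 0) \<longrightarrow>
    0 < quadratic I m (\<lambda>i. a * x i + b * y i) (\<lambda>i. a * x i + b * y i)"
  proof (intro exI allI impI)
    fix a b :: real assume "(a, b) \<noteq> (0, 0)"
    then have "0 < quadratic J m (\<lambda>i. a * x i + b * y i) (\<lambda>i. a * x i + b * y i)"
      using pos by simp
    then show "0 < quadratic I m (\<lambda>i. a * ?x i + b * ?y i) (\<lambda>i. a * ?x i + b * ?y i)"
      unfolding restrict .
  qed
  then show False using assms(1) unfolding no_positive_plane_def by (rule notE[rotated])
qed

lemma no_positive_plane_reindex: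
  assumes "no_positive_plane I (\<lambda>i j. m (f i) (f j))" "inj_on f I"
  shows "no_positive_plane (f ` I) m"
  using assms(1) unfolding no_positive_plane_def quadratic_def
  by (auto simp: sum.reindex[OF assms(2)])

text \<open>Expand the square: the two pure terms contain a full row applied to
  \<open>\<psi>\<close> and vanish. For positive \<open>\<psi>\<close> this is the ground state
  transform of a Schroedinger operator into a Dirichlet form.\<close>

lemma quadratic_of_weighted_kernel:
  assumes sym: "\<And>i j. i \<in> I \<Longrightarrow> j \<in> I \<Longrightarrow> m i j = m j i"
    and ker: "\<And>i. i \<in> I \<Longrightarrow> (\<Sum>j\<in>I. m i j * \<psi> j) = 0"
  shows "2 * quadratic I m (\<lambda>i. a i * \<psi> i) (\<lambda>i. a i * \<psi> i) =
    - (\<Sum>i\<in>I. \<Sum>j\<in>I. m i j * (\<psi> i * \<psi> j) * (a i - a j)\<^sup>2)"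
proof -
  have 1: "(\<Sum>i\<in>I. \<Sum>j\<in>I. m i j * (\<psi> i * \<psi> j) * (a i)\<^sup>2) = 0"
  proof -
    have "(\<Sum>i\<in>I. \<Sum>j\<in>I. m i j * (\<psi> i * \<psi> j) * (a i)\<^sup>2) = (\<Sum>i\<in>I. \<psi> i * (a i)\<^sup>2 * (\<Sum>j\<in>I. m i j * \<psi> j))"
      by (simp add: sum_distrib_left algebra_simps)
    then show ?thesis by (simp add: ker)
  qed
  have 2: "(\<Sum>i\<in>I. \<Sum>j\<in>I. m i j * (\<psi> i * \<psi> j) * (a j)\<^sup>2) = 0"
  proof -
    have "(\<Sum>i\<in>I. \<Sum>j\<in>I. m i j * (\<psi> i * \<psi> j) * (a j)\<^sup>2) = (\<Sum>j\<in>I. \<Sum>i\<in>I. m i j * (\<psi> i * \<psi> j) * (a j)\<^sup>2)"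
      by (rule sum.swap)
    also have "\<dots> = (\<Sum>j\<in>I. \<Sum>i\<in>I. m j i * (\<psi> j * \<psi> i) * (a j)\<^sup>2)"
      by (intro sum.cong refl) (simp add: sym algebra_simps)
    finally show ?thesis using 1 by simp
  qed
  have "(\<Sum>i\<in>I. \<Sum>j\<in>I. m i j * (\<psi> i * \<psi> j) * (a i - a j)\<^sup>2) =
      (\<Sum>i\<in>I. \<Sum>j\<in>I. m i j * (\<psi> i * \<psi> j) * (a i)\<^sup>2) + (\<Sum>i\<in>I. \<Sum>j\<in>I. m i j * (\<psi> i * \<psi> j) * (a j)\<^sup>2)
      - 2 * quadratic I m (\<lambda>i. a i * \<psi> i) (\<lambda>i. a i * \<psi> i)"
    by (simp add: quadratic_def power2_eq_square algebra_simps sum.distrib sum_subtractf sum_distrib_left)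
  then show ?thesis using 1 2 by simp
qed

text \<open>If some \<open>h\<close> has a positive value, the hyperplane is its orthogonal
  complement for the form. Otherwise the form is negative semidefinite and the sum of the
  coordinates serves, for which the third clause is clear. In the first case that clause is a
  Perron-Frobenius argument: a kernel vector without positive entries is zero, by irreducibility, or
  strictly negative, and then the weighted kernel identity makes the form negative semidefinite,
  against the choice of \<open>h\<close>.\<close>

lemma no_positive_plane_functional:
  assumes fin: "finite I" and sym: "\<And>i j. i \<in> I \<Longrightarrow> j \<in> I \<Longrightarrow> m i j = m j i"
    and npp: "no_positive_plane I m"
  obtains l where
    "\<And>y. (\<Sum>i\<in>I. l i * y i) = 0 \<Longrightarrow> quadratic I m y y \<le> 0"
    "\<And>y i. (\<Sum>i\<in>I. l i * y i) = 0 \<Longrightarrow> quadratic I m y y = 0 \<Longrightarrow> i \<in> I \<Longrightarrow> (\<Sum>j\<in>I. m i j * y j) = 0"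
    "\<And>y i. (\<And>i j. i \<in> I \<Longrightarrow> j \<in> I \<Longrightarrow> i \<noteq> j \<Longrightarrow> 0 \<le> m i j) \<Longrightarrow>
      (\<And>A. A \<subseteq> I \<Longrightarrow> A \<noteq> {} \<Longrightarrow> (\<And>i j. i \<in> A \<Longrightarrow> j \<in> I \<Longrightarrow> i \<noteq> j \<Longrightarrow> 0 < m i j \<Longrightarrow> j \<in> A) \<Longrightarrow> A = I) \<Longrightarrow>
      (\<Sum>i\<in>I. l i * y i) = 0 \<Longrightarrow> (\<And>i. i \<in> I \<Longrightarrow> (\<Sum>j\<in>I. m i j * y j) = 0) \<Longrightarrow>
      (\<And>i. i \<in> I \<Longrightarrow> y i \<le> 0) \<Longrightarrow> i \<in> I \<Longrightarrow> y i = 0"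
proof (cases "\<exists>h. 0 < quadratic I m h h")
  case True
  then obtain h where h: "0 < quadratic I m h h" by blast
  let ?Q = "quadratic I m"
  define l where "l = (\<lambda>i. \<Sum>j\<in>I. m i j * h j)"
  have comm: "?Q x y = ?Q y x" for x y by (rule quadratic_commute) (simp add: sym)
  have l: "(\<Sum>i\<in>I. l i * y i) = ?Q y h" for y
    by (simp add: l_def quadratic_eq_sum_row mult.commute)
  have neg: "?Q y y \<le> 0" if y: "?Q y h = 0" for y
  proof (rule ccontr)
    assume "\<not> ?Q y y \<le> 0"
    then have pos: "0 < ?Q y y" by simp
    have "0 < ?Q (\<lambda>i. a * h i + b * y i) (\<lambda>i. a * h i + b * y i)" if "(a, b) \<noteq> (0, 0)" for a b
    proof -
      have "?Q (\<lambda>i. a * h i + b * y i) (\<lambda>i. a * h i + b * y i) = a * a * ?Q h h + b * b * ?Q y y"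
        using y comm[of h y] by (simp add: quadratic_linear)
      moreover have "0 < a * a * ?Q h h + b * b * ?Q y y"
      proof (cases "a = 0")
        case True
        then have "0 < b * b" using that by (auto simp: zero_less_mult_iff linorder_neq_iff)
        then show ?thesis using True pos by simp
      next
        case False
        then have "0 < a * a" by (auto simp: zero_less_mult_iff linorder_neq_iff)
        then show ?thesis using h pos by (intro add_pos_nonneg) auto
      qed
      ultimately show ?thesis by simp
    qed
    then show False using npp unfolding no_positive_plane_def by blast
  qed
  have ker: "(\<Sum>j\<in>I. m i j * y j) = 0" if y: "?Q y h = 0" "?Q y y = 0" and i: "i \<in> I" for y i
  proof -
    let ?z = "\<lambda>j. if j = i then 1 else 0 :: real"
    define c where "c = ?Q ?z h / ?Q h h"
    \<comment> \<open>The projection of the \<open>i\<close>-th unit vector to the hyperplane along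
      \<open>h\<close>. Its pairing with \<open>y\<close> is that of the unit vector, since
      \<open>h\<close> pairs to 0 with \<open>y\<close>.\<close>
    let ?w = "\<lambda>j. ?z j + (- c) * h j"
    have w: "?Q ?w h = 0" unfolding quadratic_linear c_def using h by simp
    have "?Q ?w y = 0"
    proof (rule quadratic_isotropic_zero[OF comm y(2)])
      fix s
      have "?Q (\<lambda>j. ?w j + s * y j) h = 0"
        unfolding quadratic_add_left[of I m ?w "\<lambda>j. s * y j"] quadratic_scale_left w y(1) by simp
      then show "?Q (\<lambda>j. ?w j + s * y j) (\<lambda>j. ?w j + s * y j) \<le> 0" by (rule neg)
    qed
    then have "?Q ?z y = 0" unfolding quadratic_linear comm[of h y] y(1) by simp
    moreover have "?Q ?z y = (\<Sum>j\<in>I. m i j * y j)"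
      using fin i by (simp add: quadratic_eq_sum_row if_distrib[of "\<lambda>t. t * _"] sum.delta cong: if_cong)
    ultimately show ?thesis by simp
  qed
  have max: "y i = 0"
    if off: "\<And>i j. i \<in> I \<Longrightarrow> j \<in> I \<Longrightarrow> i \<noteq> j \<Longrightarrow> 0 \<le> m i j"
      and conn: "\<And>A. A \<subseteq> I \<Longrightarrow> A \<noteq> {} \<Longrightarrow> (\<And>i j. i \<in> A \<Longrightarrow> j \<in> I \<Longrightarrow> i \<noteq> j \<Longrightarrow> 0 < m i j \<Longrightarrow> j \<in> A) \<Longrightarrow> A = I"
      and row: "\<And>i. i \<in> I \<Longrightarrow> (\<Sum>j\<in>I. m i j * y j) = 0"
      and le: "\<And>i. i \<in> I \<Longrightarrow> y i \<le> 0" and i: "i \<in> I" for y i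
  proof (cases "\<exists>k\<in>I. y k = 0")
    case True
    have "{k\<in>I. y k = 0} = I"
    proof (rule conn)
      fix k j assume k: "k \<in> {k\<in>I. y k = 0}" and j: "j \<in> I" "k \<noteq> j" "0 < m k j"
      have "(\<Sum>j\<in>I. - (m k j * y j)) = 0" using row[of k] k by (simp add: sum_negf)
      moreover have "0 \<le> - (m k j * y j)" if "j \<in> I" for j
        using off[of k j] le[OF that] k that by (cases "k = j") (auto simp: mult_nonneg_nonpos)
      ultimately have "- (m k j * y j) = 0" using j(1) fin by (subst (asm) sum_nonneg_eq_0_iff) auto
      then show "j \<in> {k\<in>I. y k = 0}" using j by simp
    qed (use True in auto)
    then show ?thesis using i by blast
  next
    case False
    then have lt: "y k < 0" if "k \<in> I" for k using le[OF that] that by force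
    have "y k \<noteq> 0" if "k \<in> I" for k using lt[OF that] by simp
    \<comment> \<open>As no entry of \<open>y\<close> is zero, \<open>h\<close> is an entrywise
      multiple of \<open>y\<close>.\<close>
    then have "?Q h h = ?Q (\<lambda>i. (h i / y i) * y i) (\<lambda>i. (h i / y i) * y i)"
      by (intro quadratic_cong) simp_all
    moreover have "2 * \<dots> = - (\<Sum>i\<in>I. \<Sum>j\<in>I. m i j * (y i * y j) * (h i / y i - h j / y j)\<^sup>2)"
      by (rule quadratic_of_weighted_kernel) (use sym row in auto)
    moreover have "0 \<le> (\<Sum>i\<in>I. \<Sum>j\<in>I. m i j * (y i * y j) * (h i / y i - h j / y j)\<^sup>2)"
    proof (intro sum_nonneg)
      fix k j assume kj: "k \<in> I" "j \<in> I"
      show "0 \<le> m k j * (y k * y j) * (h k / y k - h j / y j)\<^sup>2"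
      proof (cases "k = j")
        case False
        have "0 \<le> y k * y j" using lt[OF kj(1)] lt[OF kj(2)] by (intro mult_nonpos_nonpos) auto
        then show ?thesis using off[OF kj False]
          by (intro mult_nonneg_nonneg[of "m k j * (y k * y j)"] mult_nonneg_nonneg[of "m k j"]) auto
      qed simp
    qed
    ultimately show ?thesis using h by linarith
  qed
  show ?thesis
  proof (rule that[of l], goal_cases)
    case (1 y)
    then show ?case unfolding l by (rule neg)
  next
    case (2 y i)
    show ?case by (rule ker) (use 2 in \<open>simp_all add: l\<close>)
  next
    case (3 y i)
    show ?case by (rule max[OF 3(1,2,4,5,6)])
  qed
next
  case False
  then have neg: "quadratic I m y y \<le> 0" for y by (meson not_less)
  let ?Q = "quadratic I m"
  have comm: "?Q x y = ?Q y x" for x y by (rule quadratic_commute) (simp add: sym)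
  have ker: "(\<Sum>j\<in>I. m i j * y j) = 0" if y: "?Q y y = 0" and i: "i \<in> I" for y i
  proof -
    let ?z = "\<lambda>j. if j = i then 1 else 0 :: real"
    have "?Q ?z y = 0" by (rule quadratic_isotropic_zero[OF comm y neg])
    moreover have "?Q ?z y = (\<Sum>j\<in>I. m i j * y j)"
      using fin i by (simp add: quadratic_eq_sum_row if_distrib[of "\<lambda>t. t * _"] sum.delta cong: if_cong)
    ultimately show ?thesis by simp
  qed
  have max: "y i = 0" if "(\<Sum>i\<in>I. 1 * y i) = 0" "\<And>i. i \<in> I \<Longrightarrow> y i \<le> 0" "i \<in> I" for y :: "'a \<Rightarrow> real" and i
  proof -
    have "(\<Sum>i\<in>I. - y i) = 0" using that(1) by (simp add: sum_negf)
    then have "- y i = 0" using fin that(2,3) by (subst (asm) sum_nonneg_eq_0_iff) auto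
    then show ?thesis by simp
  qed
  show ?thesis
  proof (rule that[of "\<lambda>_. 1"], goal_cases)
    case (1 y)
    show ?case by (rule neg)
  next
    case (2 y i)
    show ?case by (rule ker[OF 2(2,3)])
  next
    case (3 y i)
    show ?case by (rule max[OF 3(3,5,6)])
  qed
qed

section \<open>Realizations of two-dimensional complexes\<close>

text \<open>The face with index 1 omits vertex 1, so it is vertex 0.\<close>

definition edge_start :: "'a delta_data \<Rightarrow> 'a \<Rightarrow> 'a" where "edge_start K e = face K 1 1 e"
definition edge_end :: "'a delta_data \<Rightarrow> 'a \<Rightarrow> 'a" where "edge_end K e = face K 1 0 e"
definition side :: "'a delta_data \<Rightarrow> nat \<Rightarrow> 'a \<Rightarrow> 'a" where "side K i f = face K 2 i f"
abbreviation vertices :: "'a delta_data \<Rightarrow> 'a set" where "vertices K \<equiv> simplices K 0"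
abbreviation edges :: "'a delta_data \<Rightarrow> 'a set" where "edges K \<equiv> simplices K 1"
abbreviation facets :: "'a delta_data \<Rightarrow> 'a set" where "facets K \<equiv> simplices K 2"

locale regular_2_complex =
  fixes K :: "'a delta_data"
  assumes delta: "delta_complex K" and regular: "regular_complex K"
    and dim2: "dimension_at_most 2 K"
begin

abbreviation "st \<equiv> edge_start K"
abbreviation "en \<equiv> edge_end K"
abbreviation "sd \<equiv> side K"

lemma st_in: "e \<in> edges K \<Longrightarrow> st e \<in> vertices K"
  using delta unfolding delta_complex_def edge_start_def by fastforce

lemma en_in: "e \<in> edges K \<Longrightarrow> en e \<in> vertices K"
  using delta unfolding delta_complex_def edge_end_def by fastforce

lemma side_in:
  assumes "f \<in> facets K" "i \<le> 2"
  shows "sd i f \<in> edges K"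
proof -
  have "\<forall>\<sigma>\<in>simplices K (Suc 1). \<forall>i\<le>Suc 1. face K (Suc 1) i \<sigma> \<in> simplices K 1"
    using delta unfolding delta_complex_def by blast
  then show ?thesis using assms by (simp add: side_def numeral_2_eq_2)
qed

text \<open>Vertices 0, 1, 2 of \<open>f\<close> are named \<open>st (sd 1 f)\<close>,
  \<open>st (sd 0 f)\<close> and \<open>en (sd 0 f)\<close> throughout; the equations reduce the
  remaining three names to these.\<close>

lemma corner:
  assumes f: "f \<in> facets K"
  shows "en (sd 1 f) = en (sd 0 f)" "en (sd 2 f) = st (sd 0 f)" "st (sd 2 f) = st (sd 1 f)"
proof -
  have *: "face K (Suc 0) i (face K (Suc (Suc 0)) j f) = face K (Suc 0) (j - 1) (face K (Suc (Suc 0)) i f)"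
    if "j \<le> Suc (Suc 0)" "i < j" for i j
    using delta f that unfolding delta_complex_def numeral_2_eq_2 by blast
  show "en (sd 1 f) = en (sd 0 f)" "en (sd 2 f) = st (sd 0 f)" "st (sd 2 f) = st (sd 1 f)"
    using *[of 1 0] *[of 2 0] *[of 2 1]
    by (simp_all add: edge_start_def edge_end_def side_def numeral_2_eq_2)
qed

lemma st_neq_en:
  assumes "e \<in> edges K"
  shows "st e \<noteq> en e"
proof
  assume "st e = en e"
  moreover have "inj_on (\<lambda>i. face K 1 i e) {..1}"
    using regular assms unfolding regular_complex_def by blast
  ultimately have "(1::nat) = 0" unfolding edge_start_def edge_end_def by (auto dest: inj_onD[of _ _ 1 0])
  then show False by simp
qed

lemma side_inj:
  assumes "f \<in> facets K" "i \<le> 2" "j \<le> 2" "sd i f = sd j f"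
  shows "i = j"
proof -
  have "inj_on (\<lambda>i. face K 2 i f) {..2}"
    using regular assms unfolding regular_complex_def by (metis one_le_numeral)
  then show ?thesis using assms unfolding side_def by (auto dest: inj_onD)
qed

lemma vertices_distinct:
  assumes f: "f \<in> facets K"
  shows "st (sd 1 f) \<noteq> st (sd 0 f)" "st (sd 0 f) \<noteq> en (sd 0 f)" "st (sd 1 f) \<noteq> en (sd 0 f)"
  using st_neq_en[OF side_in[OF f, of 0]] st_neq_en[OF side_in[OF f, of 1]] st_neq_en[OF side_in[OF f, of 2]]
    corner[OF f] by auto

lemma edges_at_eq: "edges_at K v = {e \<in> edges K. st e = v \<or> en e = v}"
  unfolding edges_at_def edge_start_def edge_end_def by (auto simp: le_Suc_eq)

lemma facets_at_eq: "facets_at K e = {f \<in> facets K. sd 0 f = e \<or> sd 1 f = e \<or> sd 2 f = e}"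
  unfolding facets_at_def side_def by (auto simp: numeral_2_eq_2 le_Suc_eq)

section \<open>Points of the realization and functions on it\<close>

definition cls :: "'a simplex_point \<Rightarrow> 'a simplex_point set" where
  "cls p = (gluing K \<union> converse (gluing K))\<^sup>* `` {p}"

lemma realization_eq: "realization K = quotient_topology (simplex_sum K) cls"
  by (simp add: realization_def cls_def[abs_def])

lemma cls_glue:
  assumes "(p, p') \<in> gluing K"
  shows "cls p = cls p'"
proof -
  let ?r = "gluing K \<union> converse (gluing K)"
  have "sym (?r\<^sup>*)" by (intro sym_rtrancl) (auto simp: sym_def)
  moreover have "(p, p') \<in> ?r\<^sup>*" using assms by blast
  ultimately show ?thesis unfolding cls_def by (auto dest: symD intro: rtrancl_trans)
qed

lemma topspace_realization:
  "topspace (realization K) = {cls ((n, \<sigma>), t) | n \<sigma> t. \<sigma> \<in> simplices K n \<and> t \<in> standard_simplex n}"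
proof -
  have "topspace (simplex_sum K) = {((n, \<sigma>), t) | n \<sigma> t. \<sigma> \<in> simplices K n \<and> t \<in> standard_simplex n}"
    unfolding simplex_sum_def by (auto simp: topspace_sum_topology topspace_standard_simplex)
  then show ?thesis unfolding realization_eq topspace_quotient_topology by (simp only:) blast
qed

text \<open>Points in barycentric coordinates, listed from vertex 0 on; thus
  \<open>pt1 e 1 0\<close> is the start of \<open>e\<close>.\<close>

definition pt0 :: "'a \<Rightarrow> 'a simplex_point set" where
  "pt0 v = cls ((0, v), (\<lambda>i. if i = 0 then 1 else 0))"
definition pt1 :: "'a \<Rightarrow> real \<Rightarrow> real \<Rightarrow> 'a simplex_point set" where
  "pt1 e a b = cls ((1, e), (\<lambda>i. if i = 0 then a else if i = 1 then b else 0))"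
definition pt2 :: "'a \<Rightarrow> real \<Rightarrow> real \<Rightarrow> real \<Rightarrow> 'a simplex_point set" where
  "pt2 f a b c = cls ((2, f), (\<lambda>i. if i = 0 then a else if i = 1 then b else if i = 2 then c else 0))"

lemma standard_simplex_1:
  "t \<in> standard_simplex 1 \<longleftrightarrow>
    (\<exists>a b. 0 \<le> a \<and> 0 \<le> b \<and> a + b = 1 \<and> t = (\<lambda>i. if i = 0 then a else if i = 1 then b else 0))"
proof
  assume t: "t \<in> standard_simplex 1"
  have "t = (\<lambda>i. if i = 0 then t 0 else if i = 1 then t 1 else 0)"
    using t by (auto simp: standard_simplex_def fun_eq_iff)
  then show "\<exists>a b. 0 \<le> a \<and> 0 \<le> b \<and> a + b = 1 \<and> t = (\<lambda>i. if i = 0 then a else if i = 1 then b else 0)"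
    using t by (intro exI[of _ "t 0"] exI[of _ "t 1"]) (auto simp: standard_simplex_def)
qed (auto simp: standard_simplex_def)

lemma standard_simplex_2:
  "t \<in> standard_simplex 2 \<longleftrightarrow>
    (\<exists>a b c. 0 \<le> a \<and> 0 \<le> b \<and> 0 \<le> c \<and> a + b + c = 1 \<and>
      t = (\<lambda>i. if i = 0 then a else if i = 1 then b else if i = 2 then c else 0))"
proof
  assume t: "t \<in> standard_simplex 2"
  have "t = (\<lambda>i. if i = 0 then t 0 else if i = 1 then t 1 else if i = 2 then t 2 else 0)"
    using t by (auto simp: standard_simplex_def fun_eq_iff)
  then show "\<exists>a b c. 0 \<le> a \<and> 0 \<le> b \<and> 0 \<le> c \<and> a + b + c = 1 \<and>
      t = (\<lambda>i. if i = 0 then a else if i = 1 then b else if i = 2 then c else 0)"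
    using t by (intro exI[of _ "t 0"] exI[of _ "t 1"] exI[of _ "t 2"])
      (auto simp: standard_simplex_def numeral_2_eq_2)
qed (auto simp: standard_simplex_def numeral_2_eq_2)

lemma standard_simplex_1I:
  "0 \<le> a \<Longrightarrow> 0 \<le> b \<Longrightarrow> a + b = 1 \<Longrightarrow> (\<lambda>i. if i = 0 then a else if i = 1 then b else 0) \<in> standard_simplex 1"
  unfolding standard_simplex_1 by (intro exI[of _ a] exI[of _ b] conjI refl)

lemma standard_simplex_2I:
  "0 \<le> a \<Longrightarrow> 0 \<le> b \<Longrightarrow> 0 \<le> c \<Longrightarrow> a + b + c = 1 \<Longrightarrow>
    (\<lambda>i. if i = 0 then a else if i = 1 then b else if i = 2 then c else 0) \<in> standard_simplex 2"
  unfolding standard_simplex_2 by (intro exI[of _ a] exI[of _ b] exI[of _ c] conjI refl)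

lemma point_cases [consumes 1, case_names vertex edge facet]:
  assumes "p \<in> topspace (realization K)"
  obtains v where "v \<in> vertices K" "p = pt0 v"
  | e a b where "e \<in> edges K" "0 \<le> a" "0 \<le> b" "a + b = 1" "p = pt1 e a b"
  | f a b c where "f \<in> facets K" "0 \<le> a" "0 \<le> b" "0 \<le> c" "a + b + c = 1" "p = pt2 f a b c"
proof -
  obtain n \<sigma> t where n: "\<sigma> \<in> simplices K n" "t \<in> standard_simplex n" "p = cls ((n, \<sigma>), t)"
    using assms unfolding topspace_realization by blast
  have "n \<le> 2" using dim2 n(1) unfolding dimension_at_most_def by (metis empty_iff not_le)
  then consider "n = 0" | "n = 1" | "n = 2" by linarith
  then show ?thesis
  proof cases
    case 1
    have "t = (\<lambda>j. if j = 0 then 1 else 0)" using n(2) unfolding 1 standard_simplex_0 by blast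
    then show ?thesis using that(1) n 1 by (simp add: pt0_def)
  next
    case 2
    then show ?thesis using that(2) n(1,3) n(2)[unfolded 2 standard_simplex_1] by (auto simp: pt1_def)
  next
    case 3
    then show ?thesis using that(3) n(1,3) n(2)[unfolded 3 standard_simplex_2] by (auto simp: pt2_def)
  qed
qed

lemma pt0_in: "v \<in> vertices K \<Longrightarrow> pt0 v \<in> topspace (realization K)"
  unfolding topspace_realization pt0_def using standard_simplex_0 by blast

lemma pt1_in: "e \<in> edges K \<Longrightarrow> 0 \<le> a \<Longrightarrow> 0 \<le> b \<Longrightarrow> a + b = 1 \<Longrightarrow> pt1 e a b \<in> topspace (realization K)"
  unfolding topspace_realization pt1_def using standard_simplex_1I[of a b] by blast

lemma pt1_vertex:
  assumes "e \<in> edges K"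
  shows "pt1 e 0 1 = pt0 (en e)" "pt1 e 1 0 = pt0 (st e)"
proof -
  have s: "(\<lambda>i. if i = 0 then 1 else 0) \<in> standard_simplex 0" by (simp add: standard_simplex_0)
  have "(((0, face K (Suc 0) i e), (\<lambda>i. if i = 0 then 1 else 0)), ((Suc 0, e), simplical_face i (\<lambda>i. if i = 0 then 1 else 0))) \<in> gluing K"
    if "i \<le> 1" for i
    unfolding gluing_def using assms that s by (auto intro!: exI[of _ "0::nat"] exI[of _ i])
  note g = cls_glue[OF this]
  have "simplical_face 0 (\<lambda>i. if i = 0 then 1 else 0) = (\<lambda>i. if i = 0 then 0 else if i = 1 then 1 else 0::real)"
    "simplical_face 1 (\<lambda>i. if i = 0 then 1 else 0) = (\<lambda>i. if i = 0 then 1 else if i = 1 then 0 else 0::real)"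
    by (auto simp: simplical_face_def fun_eq_iff)
  then show "pt1 e 0 1 = pt0 (en e)" "pt1 e 1 0 = pt0 (st e)"
    using g[of 0] g[of 1] by (simp_all add: pt0_def pt1_def edge_start_def edge_end_def)
qed

lemma pt2_side:
  assumes "f \<in> facets K" "0 \<le> a" "0 \<le> b" "a + b = 1"
  shows "pt2 f 0 a b = pt1 (sd 0 f) a b" "pt2 f a 0 b = pt1 (sd 1 f) a b" "pt2 f a b 0 = pt1 (sd 2 f) a b"
proof -
  let ?t = "\<lambda>i::nat. if i = 0 then a else if i = 1 then b else 0"
  have s: "?t \<in> standard_simplex (Suc 0)" using assms standard_simplex_1[of ?t] by auto
  have "(((Suc 0, face K (Suc (Suc 0)) i f), ?t), ((Suc (Suc 0), f), simplical_face i ?t)) \<in> gluing K"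
    if "i \<le> 2" for i
    unfolding gluing_def using assms that s
    by (intro CollectI exI[of _ "Suc 0"] exI[of _ i] exI[of _ f] exI[of _ ?t]) (auto simp: numeral_2_eq_2)
  note g = cls_glue[OF this]
  have "simplical_face 0 ?t = (\<lambda>i. if i = 0 then 0 else if i = 1 then a else if i = 2 then b else 0)"
    "simplical_face 1 ?t = (\<lambda>i. if i = 0 then a else if i = 1 then 0 else if i = 2 then b else 0)"
    "simplical_face 2 ?t = (\<lambda>i. if i = 0 then a else if i = 1 then b else if i = 2 then 0 else 0)"
    by (auto simp: simplical_face_def fun_eq_iff)
  then show "pt2 f 0 a b = pt1 (sd 0 f) a b" "pt2 f a 0 b = pt1 (sd 1 f) a b" "pt2 f a b 0 = pt1 (sd 2 f) a b"
    using g[of 0] g[of 1] g[of 2] by (simp_all add: pt1_def pt2_def side_def numeral_2_eq_2)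
qed

lemma continuous_map_simplex:
  assumes "\<sigma> \<in> simplices K n" "continuous_on D t" "\<And>x. x \<in> D \<Longrightarrow> t x \<in> standard_simplex n"
  shows "continuous_map (top_of_set D) (realization K) (\<lambda>x. cls ((n, \<sigma>), t x))"
proof -
  have 1: "continuous_map (top_of_set D) (subtopology (powertop_real UNIV) (standard_simplex n)) t"
    unfolding euclidean_product_topology continuous_map_in_subtopology using assms(2,3) by auto
  have 2: "continuous_map (subtopology (powertop_real UNIV) (standard_simplex n)) (simplex_sum K) (\<lambda>t. ((n, \<sigma>), t))"
    unfolding simplex_sum_def
    using continuous_map_component_injection[of "(n, \<sigma>)" "SIGMA n:UNIV. simplices K n"
      "\<lambda>(n, \<sigma>). subtopology (powertop_real UNIV) (standard_simplex n)"] assms(1) by simp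
  have 3: "continuous_map (simplex_sum K) (realization K) cls"
    unfolding realization_eq by (rule quotient_imp_continuous_map[OF quotient_map_quotient_topology])
  show ?thesis
    using continuous_map_compose[OF continuous_map_compose[OF 1 2] 3] by (simp add: o_def)
qed

lemma continuous_map_pt1:
  fixes a b :: "'b::topological_space \<Rightarrow> real"
  assumes "e \<in> edges K" "continuous_on D a" "continuous_on D b"
    "\<And>x. x \<in> D \<Longrightarrow> 0 \<le> a x" "\<And>x. x \<in> D \<Longrightarrow> 0 \<le> b x" "\<And>x. x \<in> D \<Longrightarrow> a x + b x = 1"
  shows "continuous_map (top_of_set D) (realization K) (\<lambda>x. pt1 e (a x) (b x))"
  unfolding pt1_def
proof (rule continuous_map_simplex)
  show "continuous_on D (\<lambda>x (i::nat). if i = 0 then a x else if i = 1 then b x else 0)"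
  proof (rule continuous_on_coordinatewise_then_product)
    fix i :: nat
    consider "i = 0" | "i = 1" | "2 \<le> i" by linarith
    then show "continuous_on D (\<lambda>x. if i = 0 then a x else if i = 1 then b x else 0)"
      by cases (use assms in auto)
  qed
  show "(\<lambda>i::nat. if i = 0 then a x else if i = 1 then b x else 0) \<in> standard_simplex 1" if "x \<in> D" for x
    using that assms by (intro standard_simplex_1I) auto
qed (use assms in auto)

lemma continuous_map_pt2:
  fixes a b c :: "'b::topological_space \<Rightarrow> real"
  assumes "f \<in> facets K" "continuous_on D a" "continuous_on D b" "continuous_on D c"
    "\<And>x. x \<in> D \<Longrightarrow> 0 \<le> a x" "\<And>x. x \<in> D \<Longrightarrow> 0 \<le> b x" "\<And>x. x \<in> D \<Longrightarrow> 0 \<le> c x"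
    "\<And>x. x \<in> D \<Longrightarrow> a x + b x + c x = 1"
  shows "continuous_map (top_of_set D) (realization K) (\<lambda>x. pt2 f (a x) (b x) (c x))"
  unfolding pt2_def
proof (rule continuous_map_simplex)
  show "continuous_on D (\<lambda>x (i::nat). if i = 0 then a x else if i = 1 then b x else if i = 2 then c x else 0)"
  proof (rule continuous_on_coordinatewise_then_product)
    fix i :: nat
    consider "i = 0" | "i = 1" | "i = 2" | "3 \<le> i" by linarith
    then show "continuous_on D (\<lambda>x. if i = 0 then a x else if i = 1 then b x else if i = 2 then c x else 0)"
      by cases (use assms in auto)
  qed
  show "(\<lambda>i::nat. if i = 0 then a x else if i = 1 then b x else if i = 2 then c x else 0) \<in> standard_simplex 2" if "x \<in> D" for x
    using that assms by (intro standard_simplex_2I) auto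
qed (use assms in auto)

text \<open>A continuous function on the realization is a family of functions on the simplices that
  agree along faces. Such functions tell points apart, so that the equivalence relation generated by
  the gluing need not be described explicitly.\<close>

lemma realization_function:
  fixes p0 :: "'a \<Rightarrow> real"
  assumes cont1: "\<And>e. continuous_on UNIV (\<lambda>t::nat \<Rightarrow> real. p1 e (t 0) (t 1))"
    and cont2: "\<And>f. continuous_on UNIV (\<lambda>t::nat \<Rightarrow> real. p2 f (t 0) (t 1) (t 2))"
    and e: "\<And>e. e \<in> edges K \<Longrightarrow> p1 e 0 1 = p0 (en e) \<and> p1 e 1 0 = p0 (st e)"
    and f: "\<And>f a b. f \<in> facets K \<Longrightarrow>
      p2 f 0 a b = p1 (sd 0 f) a b \<and> p2 f a 0 b = p1 (sd 1 f) a b \<and> p2 f a b 0 = p1 (sd 2 f) a b"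
  shows "\<exists>H. continuous_map (realization K) euclideanreal H \<and> (\<forall>v. H (pt0 v) = p0 v) \<and>
    (\<forall>e a b. H (pt1 e a b) = p1 e a b) \<and> (\<forall>f a b c. H (pt2 f a b c) = p2 f a b c)"
proof -
  define h :: "'a simplex_point \<Rightarrow> real" where
    "h = (\<lambda>((n, \<sigma>), t). if n = 0 then p0 \<sigma> else if n = 1 then p1 \<sigma> (t 0) (t 1) else p2 \<sigma> (t 0) (t 1) (t 2))"
  have glue: "h p = h p'" if pp: "(p, p') \<in> gluing K" for p p'
  proof -
    obtain n i \<sigma> t where *: "p = ((n, face K (Suc n) i \<sigma>), t)" "p' = ((Suc n, \<sigma>), simplical_face i t)"
      "\<sigma> \<in> simplices K (Suc n)" "i \<le> Suc n" "t \<in> standard_simplex n"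
      using pp unfolding gluing_def by auto
    have "Suc n \<le> 2" using dim2 *(3) unfolding dimension_at_most_def by (metis empty_iff not_le)
    then consider "n = 0" | "n = 1" by linarith
    then show ?thesis
    proof cases
      case 1
      then have t: "t = (\<lambda>j. if j = 0 then 1 else 0)" using *(5) standard_simplex_0 by auto
      have "i = 0 \<or> i = 1" using *(4) 1 by auto
      then show ?thesis
        using e[of \<sigma>] *(3) unfolding * 1 t
        by (auto simp: h_def simplical_face_def edge_start_def edge_end_def)
    next
      case 2
      have "i = 0 \<or> i = 1 \<or> i = 2" using *(4) 2 by auto
      moreover have "\<sigma> \<in> facets K" using *(3) 2 by (simp add: numeral_2_eq_2)
      ultimately show ?thesis
        using f[of \<sigma> "t 0" "t 1"] unfolding * 2
        by (auto simp: h_def simplical_face_def side_def numeral_2_eq_2)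
    qed
  qed
  have const: "h p' = h p" if "p' \<in> cls p" for p p'
  proof -
    have "(p, p') \<in> (gluing K \<union> converse (gluing K))\<^sup>*" using that by (simp add: cls_def)
    then show ?thesis by (induction rule: rtrancl_induct) (use glue in auto)
  qed
  \<comment> \<open>\<open>SOME\<close> picks a representative of the class; by \<open>const\<close>
    the choice does not matter.\<close>
  define H where "H = (\<lambda>C. h (SOME p. p \<in> C))"
  have H: "H (cls p) = h p" for p
  proof -
    have "p \<in> cls p" by (simp add: cls_def)
    then have "(SOME p'. p' \<in> cls p) \<in> cls p" by (rule someI)
    then show ?thesis unfolding H_def by (rule const)
  qed
  have cont_h: "continuous_on A (\<lambda>t. h ((n, \<sigma>), t))" for A n \<sigma>
  proof -
    have "continuous_on UNIV (\<lambda>t. h ((n, \<sigma>), t))"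
      using cont1[of \<sigma>] cont2[of \<sigma>] by (cases "n = 0"; cases "n = 1") (simp_all add: h_def)
    then show ?thesis by (rule continuous_on_subset) auto
  qed
  have "continuous_map (simplex_sum K) euclideanreal h"
    unfolding continuous_map_def
  proof (intro conjI allI impI)
    fix U :: "real set" assume U: "openin euclideanreal U"
    show "openin (simplex_sum K) {x \<in> topspace (simplex_sum K). h x \<in> U}"
      unfolding simplex_sum_def openin_sum_topology
    proof (intro conjI ballI)
      fix i :: "nat \<times> 'a" assume i: "i \<in> (SIGMA n:UNIV. simplices K n)"
      obtain n \<sigma> where n: "i = (n, \<sigma>)" "\<sigma> \<in> simplices K n" using i by auto
      have "openin (top_of_set (standard_simplex n)) {t \<in> standard_simplex n. h ((n, \<sigma>), t) \<in> U}"
        using continuous_openin_preimage_gen[OF cont_h[of "standard_simplex n" n \<sigma>], of U] U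
        by (simp add: vimage_def Int_def)
      then show "openin ((\<lambda>(n, \<sigma>). subtopology (powertop_real UNIV) (standard_simplex n)) i)
          {x. (i, x) \<in> {x \<in> topspace (sum_topology (\<lambda>(n, \<sigma>). subtopology (powertop_real UNIV) (standard_simplex n)) (SIGMA n:UNIV. simplices K n)). h x \<in> U}}"
        using n by (simp add: euclidean_product_topology)
    qed auto
  qed simp
  then have "continuous_map (simplex_sum K) euclideanreal (H \<circ> cls)"
    by (rule continuous_map_eq) (simp add: H)
  then have "continuous_map (realization K) euclideanreal H"
    unfolding realization_eq by (rule continuous_compose_quotient_map[OF quotient_map_quotient_topology])
  then show ?thesis
    by (intro exI[of _ H]) (simp add: pt0_def pt1_def pt2_def H h_def)
qed

end

section \<open>Charts\<close>

lemma homeomorphic_maps_Euclidean_2_complex: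
  "homeomorphic_maps (Euclidean_space 2) (euclidean :: complex topology)
     (\<lambda>x. Complex (x 0) (x 1)) (\<lambda>z (i::nat). if i = 0 then Re z else if i = 1 then Im z else 0)"
  unfolding homeomorphic_maps_def
proof (intro conjI ballI)
  have "continuous_on UNIV (\<lambda>x::nat \<Rightarrow> real. Complex (x 0) (x 1))"
    unfolding Complex_eq by (intro continuous_intros) auto
  then show "continuous_map (Euclidean_space 2) euclidean (\<lambda>x. Complex (x 0) (x 1))"
    unfolding Euclidean_space_def euclidean_product_topology
    by (intro continuous_map_from_subtopology) simp
  have "continuous_on UNIV (\<lambda>z (i::nat). if i = 0 then Re z else if i = 1 then Im z else (0::real))"
  proof (rule continuous_on_coordinatewise_then_product)
    fix i :: nat
    consider "i = 0" | "i = 1" | "2 \<le> i" by linarith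
    then show "continuous_on UNIV (\<lambda>z. if i = 0 then Re z else if i = 1 then Im z else (0::real))"
      by cases (auto intro!: continuous_intros)
  qed
  then show "continuous_map (euclidean :: complex topology) (Euclidean_space 2)
     (\<lambda>z (i::nat). if i = 0 then Re z else if i = 1 then Im z else 0)"
    unfolding Euclidean_space_def euclidean_product_topology continuous_map_in_subtopology by auto
next
  fix x :: "nat \<Rightarrow> real" assume "x \<in> topspace (Euclidean_space 2)"
  then have "x i = 0" if "2 \<le> i" for i using that by (simp add: topspace_Euclidean_space)
  then show "(\<lambda>i::nat. if i = 0 then Re (Complex (x 0) (x 1)) else if i = 1 then Im (Complex (x 0) (x 1)) else 0) = x"
    by (auto simp: fun_eq_iff)
qed simp

text \<open>The target is \<open>complex\<close> instead of the function space
  \<open>Euclidean_space 2\<close>, so that invariance of domain and facts about balls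
  apply.\<close>

lemma connected_2_manifold_chart:
  assumes X: "connected_2_manifold X" and x: "x \<in> topspace X"
  obtains U W f g where "openin X U" "x \<in> U" "open (W :: complex set)"
    "homeomorphic_maps (subtopology X U) (top_of_set W) f g"
proof -
  obtain U V where U: "openin X U" "x \<in> U" and V: "openin (Euclidean_space 2) V"
    and h: "subtopology X U homeomorphic_space subtopology (Euclidean_space 2) V"
    using X x unfolding connected_2_manifold_def by metis
  let ?c = "\<lambda>x. Complex (x 0) (x 1)" and ?d = "\<lambda>z (i::nat). if i = 0 then Re z else if i = 1 then Im z else (0::real)"
  note cd = homeomorphic_maps_Euclidean_2_complex
  obtain f g where fg: "homeomorphic_maps (subtopology X U) (subtopology (Euclidean_space 2) V) f g"
    using h unfolding homeomorphic_space_def by blast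
  have VE: "V \<subseteq> topspace (Euclidean_space 2)" using V by (rule openin_subset)
  let ?W = "?c ` V"
  have "homeomorphic_map (Euclidean_space 2) euclidean ?c"
    using cd unfolding homeomorphic_maps_map by (rule conjunct1)
  from homeomorphic_imp_open_map[OF this, unfolded open_map_def, rule_format, OF V]
  have "openin euclidean ?W" .
  then have "open ?W" by simp
  have "homeomorphic_maps (subtopology (Euclidean_space 2) V) (top_of_set ?W) ?c ?d"
    by (rule homeomorphic_maps_subtopologies[OF cd]) (simp only: Int_absorb1[OF VE] topspace_euclidean Int_UNIV_left)
  then have "homeomorphic_maps (subtopology X U) (top_of_set ?W) (?c \<circ> f) (g \<circ> ?d)"
    by (rule homeomorphic_maps_compose[OF conjI[OF fg]])
  with U \<open>open ?W\<close> show ?thesis by (rule that)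
qed

locale chart =
  fixes X :: "'b topology" and U and W :: "complex set" and f g
  assumes U: "openin X U" and W: "open W"
    and fg: "homeomorphic_maps (subtopology X U) (top_of_set W) f g"
begin

lemma U_sub: "U \<subseteq> topspace X" using U by (rule openin_subset)

lemma f_in: "u \<in> U \<Longrightarrow> f u \<in> W"
  using fg U_sub unfolding homeomorphic_maps_def continuous_map_def by (auto simp: Pi_iff)

lemma g_in: "w \<in> W \<Longrightarrow> g w \<in> U"
  using fg U_sub unfolding homeomorphic_maps_def continuous_map_def by (auto simp: Pi_iff)

lemma gf: "u \<in> U \<Longrightarrow> g (f u) = u"
  using fg U_sub unfolding homeomorphic_maps_def by auto

lemma fg_id: "w \<in> W \<Longrightarrow> f (g w) = w"
  using fg unfolding homeomorphic_maps_def by auto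

lemma continuous_on_comp_g:
  assumes "continuous_map X euclideanreal \<phi>"
  shows "continuous_on W (\<lambda>w. \<phi> (g w))"
proof -
  have "continuous_map (top_of_set W) X g"
    using fg unfolding homeomorphic_maps_def continuous_map_in_subtopology by blast
  then have "continuous_map (top_of_set W) euclideanreal (\<phi> \<circ> g)"
    using assms by (rule continuous_map_compose)
  then show ?thesis by (simp add: o_def)
qed

lemma open_positive:
  assumes \<phi>: "continuous_map X euclideanreal \<phi>" and S: "S \<subseteq> W" "open S"
  shows "open {w \<in> S. 0 < \<phi> (g w)}"
proof -
  have "continuous_on S (\<lambda>w. \<phi> (g w))"
    using continuous_on_comp_g[OF \<phi>] S(1) by (rule continuous_on_subset)
  then have "open (S \<inter> (\<lambda>w. \<phi> (g w)) -` {0<..})"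
    using S(2) by (rule continuous_open_preimage) simp
  moreover have "S \<inter> (\<lambda>w. \<phi> (g w)) -` {0<..} = {w \<in> S. 0 < \<phi> (g w)}" by auto
  ultimately show ?thesis by simp
qed

lemma open_preimage: "open O' \<Longrightarrow> openin X {u \<in> U. f u \<in> O'}"
proof -
  assume O: "open O'"
  have "continuous_map (subtopology X U) (top_of_set W) f" using fg by (simp add: homeomorphic_maps_def)
  moreover have "openin (top_of_set W) (W \<inter> O')" using O by (simp add: openin_open_Int)
  ultimately have "openin (subtopology X U) {u \<in> topspace (subtopology X U). f u \<in> W \<inter> O'}"
    by (rule openin_continuous_map_preimage)
  moreover have "{u \<in> topspace (subtopology X U). f u \<in> W \<inter> O'} = {u \<in> U. f u \<in> O'}"
    using U_sub f_in by auto
  ultimately show ?thesis using U openin_trans_full by metis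
qed

text \<open>By continuity at 0 small times suffice; the point is that a strictly positive one is
  obtained.\<close>

lemma curve_meets:
  assumes \<gamma>: "continuous_map (top_of_set {0..1}) X \<gamma>" and "\<gamma> (0::real) \<in> U" "f (\<gamma> 0) \<in> O'" "open O'"
  obtains s where "0 < s" "s < 1" "\<gamma> s \<in> U" "f (\<gamma> s) \<in> O'"
proof -
  have "openin (top_of_set {0..1}) {s \<in> topspace (top_of_set {0..1}). \<gamma> s \<in> {u \<in> U. f u \<in> O'}}"
    by (rule openin_continuous_map_preimage[OF \<gamma> open_preimage]) (rule assms)
  moreover have "{s \<in> topspace (top_of_set {0..1}). \<gamma> s \<in> {u \<in> U. f u \<in> O'}} = {s \<in> {0..1}. \<gamma> s \<in> U \<and> f (\<gamma> s) \<in> O'}"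
    by auto
  ultimately have "openin (top_of_set {0..1}) {s \<in> {0..1}. \<gamma> s \<in> U \<and> f (\<gamma> s) \<in> O'}" by (simp only:)
  then obtain T where T: "open T" "{s \<in> {0..1}. \<gamma> s \<in> U \<and> f (\<gamma> s) \<in> O'} = {0..1} \<inter> T"
    unfolding openin_open by (elim exE conjE)
  have "0 \<in> {s \<in> {0..1}. \<gamma> s \<in> U \<and> f (\<gamma> s) \<in> O'}" using assms by simp
  then have "0 \<in> T" unfolding T(2) by simp
  then obtain e where e: "0 < e" "ball 0 e \<subseteq> T" using T(1) open_contains_ball by blast
  define s where "s = min (e/2) (1/2)"
  have s: "0 < s" "s < 1" "s \<in> ball 0 e" using e(1) by (auto simp: s_def)
  then have "s \<in> {0..1} \<inter> T" using e(2) by auto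
  then have "\<gamma> s \<in> U \<and> f (\<gamma> s) \<in> O'" unfolding T(2)[symmetric] by simp
  with s(1,2) show ?thesis by (intro that) auto
qed

text \<open>Invariance of domain, for an injective map of an open planar set into the surface, seen
  through the chart.\<close>

lemma open_image:
  assumes D: "open (D :: complex set)" and \<gamma>: "continuous_map (top_of_set D) X \<gamma>" and inj: "inj_on \<gamma> D"
  shows "open (f ` (\<gamma> ` D \<inter> U))"
proof -
  let ?D = "{d \<in> D. \<gamma> d \<in> U}"
  have "openin (top_of_set D) {d \<in> topspace (top_of_set D). \<gamma> d \<in> U}"
    by (rule openin_continuous_map_preimage[OF \<gamma> U])
  then have oD: "open ?D" using D by (simp add: openin_open_eq)
  have "continuous_map (top_of_set ?D) (subtopology X U) \<gamma>"
    unfolding continuous_map_in_subtopology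
    using \<gamma> U_sub by (auto intro: continuous_map_from_subtopology_mono)
  moreover have "continuous_map (subtopology X U) euclidean f"
    using fg unfolding homeomorphic_maps_def continuous_map_in_subtopology by blast
  ultimately have "continuous_map (top_of_set ?D) euclidean (f \<circ> \<gamma>)" by (rule continuous_map_compose)
  then have "continuous_on ?D (f \<circ> \<gamma>)" by simp
  moreover have "inj_on (f \<circ> \<gamma>) ?D"
  proof (rule inj_onI)
    fix a b assume "a \<in> ?D" "b \<in> ?D" "(f \<circ> \<gamma>) a = (f \<circ> \<gamma>) b"
    then have "\<gamma> a = \<gamma> b" using gf by (metis (no_types, lifting) comp_apply mem_Collect_eq)
    then show "a = b" using inj \<open>a \<in> ?D\<close> \<open>b \<in> ?D\<close> by (auto dest: inj_onD)
  qed
  ultimately have "open ((f \<circ> \<gamma>) ` ?D)" using oD by (intro invariance_of_domain)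
  moreover have "(f \<circ> \<gamma>) ` ?D = f ` (\<gamma> ` D \<inter> U)" by auto
  ultimately show ?thesis by simp
qed

end

section \<open>Weight functions and the edge graph\<close>

context regular_2_complex
begin

lemma vertex_weight:
  "\<exists>H. continuous_map (realization K) euclideanreal H \<and>
    (\<forall>v. H (pt0 v) = (if v \<in> A then 1 else 0)) \<and>
    (\<forall>e a b. H (pt1 e a b) = (if st e \<in> A then a else 0) + (if en e \<in> A then b else 0)) \<and>
    (\<forall>f a b c. H (pt2 f a b c) =
      (if st (sd 1 f) \<in> A then a else 0) + (if st (sd 0 f) \<in> A then b else 0) + (if en (sd 0 f) \<in> A then c else 0))"
proof (rule realization_function)
  fix e
  show "continuous_on UNIV (\<lambda>t::nat \<Rightarrow> real. (if st e \<in> A then t 0 else 0) + (if en e \<in> A then t 1 else 0))"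
    by (cases "st e \<in> A"; cases "en e \<in> A") (auto intro!: continuous_intros)
  show "continuous_on UNIV (\<lambda>t::nat \<Rightarrow> real. (if st (sd 1 e) \<in> A then t 0 else 0) +
      (if st (sd 0 e) \<in> A then t 1 else 0) + (if en (sd 0 e) \<in> A then t 2 else 0))"
    by (cases "st (sd 1 e) \<in> A"; cases "st (sd 0 e) \<in> A"; cases "en (sd 0 e) \<in> A") (auto intro!: continuous_intros)
qed (auto simp: corner corner[simplified])

text \<open>On the realization this is positive exactly on the open stars of the edges in
  \<open>C\<close>.\<close>

lemma edge_weight:
  "\<exists>H. continuous_map (realization K) euclideanreal H \<and>
    (\<forall>v. H (pt0 v) = 0) \<and>
    (\<forall>e a b. H (pt1 e a b) = (if e \<in> C then a * b else 0)) \<and>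
    (\<forall>f a b c. H (pt2 f a b c) =
      (if sd 0 f \<in> C then b * c else 0) + (if sd 1 f \<in> C then a * c else 0) + (if sd 2 f \<in> C then a * b else 0))"
proof (rule realization_function)
  fix e
  show "continuous_on UNIV (\<lambda>t::nat \<Rightarrow> real. if e \<in> C then t 0 * t 1 else 0)"
    by (cases "e \<in> C") (auto intro!: continuous_intros)
  show "continuous_on UNIV (\<lambda>t::nat \<Rightarrow> real. (if sd 0 e \<in> C then t 1 * t 2 else 0) +
      (if sd 1 e \<in> C then t 0 * t 2 else 0) + (if sd 2 e \<in> C then t 0 * t 1 else 0))"
    by (cases "sd 0 e \<in> C"; cases "sd 1 e \<in> C"; cases "sd 2 e \<in> C") (auto intro!: continuous_intros)
qed auto

lemma facet_weight:
  "\<exists>H. continuous_map (realization K) euclideanreal H \<and>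
    (\<forall>v. H (pt0 v) = 0) \<and> (\<forall>e a b. H (pt1 e a b) = 0) \<and>
    (\<forall>f a b c. H (pt2 f a b c) = (if f = t then a * b * c else 0))"
proof (rule realization_function)
  fix f
  show "continuous_on UNIV (\<lambda>x::nat \<Rightarrow> real. if f = t then x 0 * x 1 * x 2 else 0)"
    by (cases "f = t") (auto intro!: continuous_intros)
qed auto

text \<open>Since no edge leaves \<open>A\<close>, its vertex weight takes only the values 0 and 1;
  on a connected space it would also take 1/2 if both occurred.\<close>

lemma graph_connected:
  assumes conn: "connected_space (realization K)" and A: "A \<subseteq> vertices K" "A \<noteq> {}"
    and closed: "\<And>e. e \<in> edges K \<Longrightarrow> st e \<in> A \<longleftrightarrow> en e \<in> A"
  shows "A = vertices K"
proof (rule ccontr)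
  assume "A \<noteq> vertices K"
  then obtain v u where v: "v \<in> A" and u: "u \<in> vertices K" "u \<notin> A" using A by blast
  obtain H where H: "continuous_map (realization K) euclideanreal H"
    "\<And>v. H (pt0 v) = (if v \<in> A then 1 else 0)"
    "\<And>e a b. H (pt1 e a b) = (if st e \<in> A then a else 0) + (if en e \<in> A then b else 0)"
    "\<And>f a b c. H (pt2 f a b c) =
      (if st (sd 1 f) \<in> A then a else 0) + (if st (sd 0 f) \<in> A then b else 0) + (if en (sd 0 f) \<in> A then c else 0)"
    using vertex_weight[of A] by (elim exE conjE) blast
  have 01: "H p = 0 \<or> H p = 1" if "p \<in> topspace (realization K)" for p
    using that
  proof (cases rule: point_cases)
    case (vertex v)
    then show ?thesis by (simp add: H)
  next
    case (edge e a b)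
    then show ?thesis using closed[OF edge(1)] by (auto simp: H)
  next
    case (facet f a b c)
    have "st (sd 0 f) \<in> A \<longleftrightarrow> en (sd 0 f) \<in> A" "st (sd 1 f) \<in> A \<longleftrightarrow> en (sd 0 f) \<in> A"
      using closed[OF side_in[OF facet(1), of 0]] closed[OF side_in[OF facet(1), of 1]] corner[OF facet(1)] by auto
    then show ?thesis using facet by (auto simp: H)
  qed
  have "connectedin euclideanreal (H ` topspace (realization K))"
    using connectedin_continuous_map_image[OF H(1)] conn by (simp add: connectedin_topspace)
  then have "is_interval (H ` topspace (realization K))"
    by (simp add: is_interval_connected_1)
  moreover have "1 \<in> H ` topspace (realization K)"
    using v A(1) pt0_in by (intro image_eqI[of _ _ "pt0 v"]) (auto simp: H)
  moreover have "0 \<in> H ` topspace (realization K)"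
    using u pt0_in by (intro image_eqI[of _ _ "pt0 u"]) (auto simp: H)
  ultimately have "1/2 \<in> H ` topspace (realization K)"
    by (intro mem_is_interval_1_I[of _ 0 1 "1/2"]) auto
  then show False using 01 by fastforce
qed

end

section \<open>Connectedness of the links of a surface\<close>

context regular_2_complex
begin

text \<open>By regularity only one vertex of a simplex can be \<open>v\<close>, so coordinate 1
  there forces the others to vanish.\<close>

lemma pt0_only:
  assumes H: "\<And>v'. H (pt0 v') = (if v' \<in> {v} then 1 else (0::real))"
    "\<And>e a b. H (pt1 e a b) = (if st e \<in> {v} then a else 0) + (if en e \<in> {v} then b else 0)"
    "\<And>f a b c. H (pt2 f a b c) =
      (if st (sd 1 f) \<in> {v} then a else 0) + (if st (sd 0 f) \<in> {v} then b else 0) + (if en (sd 0 f) \<in> {v} then c else 0)"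
    and p: "p \<in> topspace (realization K)" "H p = 1"
  shows "p = pt0 v"
  using p(1)
proof (cases rule: point_cases)
  case (vertex v')
  then show ?thesis using p(2) H(1) by (auto split: if_splits)
next
  case (edge e a b)
  have "st e \<noteq> en e" using edge by (intro st_neq_en)
  then have "(st e = v \<and> a = 1 \<and> b = 0) \<or> (en e = v \<and> a = 0 \<and> b = 1)"
    using p(2) edge by (auto simp: H(2) split: if_splits)
  then show ?thesis using pt1_vertex[OF edge(1)] edge(5) by auto
next
  case (facet f a b c)
  note d = vertices_distinct[OF facet(1)]
  have "(st (sd 1 f) = v \<and> a = 1 \<and> b = 0 \<and> c = 0) \<or> (st (sd 0 f) = v \<and> a = 0 \<and> b = 1 \<and> c = 0) \<or>
    (en (sd 0 f) = v \<and> a = 0 \<and> b = 0 \<and> c = 1)"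
    using p(2) facet d by (auto simp: H(3) split: if_splits)
  then show ?thesis
  proof (elim disjE conjE)
    assume *: "st (sd 1 f) = v" "a = 1" "b = 0" "c = 0"
    have "p = pt1 (sd 1 f) 1 0" using facet * pt2_side(2)[OF facet(1), of 1 0] by simp
    then show ?thesis using pt1_vertex(2)[OF side_in[OF facet(1), of 1]] * by simp
  next
    assume *: "st (sd 0 f) = v" "a = 0" "b = 1" "c = 0"
    have "p = pt1 (sd 0 f) 1 0" using facet * pt2_side(1)[OF facet(1), of 1 0] by simp
    then show ?thesis using pt1_vertex(2)[OF side_in[OF facet(1), of 0]] * by simp
  next
    assume *: "en (sd 0 f) = v" "a = 0" "b = 0" "c = 1"
    have "p = pt1 (sd 0 f) 0 1" using facet * pt2_side(1)[OF facet(1), of 0 1] by simp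
    then show ?thesis using pt1_vertex(1)[OF side_in[OF facet(1), of 0]] * by simp
  qed
qed

definition linked_at :: "'a \<Rightarrow> 'a set \<Rightarrow> bool" where
  "linked_at v C \<longleftrightarrow> (\<forall>f\<in>facets K. \<forall>i\<le>2. \<forall>j\<le>2. sd i f \<in> C \<and> sd j f \<in> edges_at K v \<longrightarrow> sd j f \<in> C)"

text \<open>If the link of \<open>v\<close> fell apart into \<open>C\<close> and the rest, the open
  star of \<open>v\<close> without \<open>v\<close> would be the disjoint union of the two open sets
  where one edge weight is positive. In a chart it contains a punctured disc, which is connected and
  meets both.\<close>

lemma link_connected:
  assumes man: "connected_2_manifold (realization K)" and v: "v \<in> vertices K"
    and C: "C \<subseteq> edges_at K v" "C \<noteq> {}" and linked: "linked_at v C"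
  shows "C = edges_at K v"
proof (rule ccontr)
  assume ne: "C \<noteq> edges_at K v"
  define C' where "C' = edges_at K v - C"
  have C': "C' \<noteq> {}" using ne C by (auto simp: C'_def)
  let ?X = "realization K"
  obtain B where B: "continuous_map ?X euclideanreal B"
    "\<And>v'. B (pt0 v') = (if v' \<in> {v} then 1 else 0)"
    "\<And>e a b. B (pt1 e a b) = (if st e \<in> {v} then a else 0) + (if en e \<in> {v} then b else 0)"
    "\<And>f a b c. B (pt2 f a b c) =
      (if st (sd 1 f) \<in> {v} then a else 0) + (if st (sd 0 f) \<in> {v} then b else 0) + (if en (sd 0 f) \<in> {v} then c else 0)"
    using vertex_weight[of "{v}"] by (elim exE conjE) blast
  obtain G where G: "continuous_map ?X euclideanreal G" "\<And>v. G (pt0 v) = 0"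
    "\<And>e a b. G (pt1 e a b) = (if e \<in> C then a * b else 0)"
    "\<And>f a b c. G (pt2 f a b c) =
      (if sd 0 f \<in> C then b * c else 0) + (if sd 1 f \<in> C then a * c else 0) + (if sd 2 f \<in> C then a * b else 0)"
    using edge_weight[of C] by (elim exE conjE) blast
  obtain G' where G': "continuous_map ?X euclideanreal G'" "\<And>v. G' (pt0 v) = 0"
    "\<And>e a b. G' (pt1 e a b) = (if e \<in> C' then a * b else 0)"
    "\<And>f a b c. G' (pt2 f a b c) =
      (if sd 0 f \<in> C' then b * c else 0) + (if sd 1 f \<in> C' then a * c else 0) + (if sd 2 f \<in> C' then a * b else 0)"
    using edge_weight[of C'] by (elim exE conjE) blast
  \<comment> \<open>Such a point lies on an edge at \<open>v\<close> or in a facet with two sides at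
    \<open>v\<close>; by \<open>linked\<close> these two are both in \<open>C\<close> or both
    outside.\<close>
  have dichotomy: "(0 < G p) \<noteq> (0 < G' p)" if p: "p \<in> topspace ?X" "0 < B p" "p \<noteq> pt0 v" for p
    using p(1)
  proof (cases rule: point_cases)
    case (vertex v')
    then show ?thesis using p by (auto simp: B split: if_splits)
  next
    case (edge e a b)
    have se: "st e \<noteq> en e" using edge by (intro st_neq_en)
    have "st e = v \<or> en e = v" using p(2) edge by (auto simp: B split: if_splits)
    then have "(e \<in> C) \<noteq> (e \<in> C')" using edge(1) by (auto simp: C'_def edges_at_eq)
    moreover have "a \<noteq> 0" "b \<noteq> 0"
      using p edge se pt1_vertex[OF edge(1)] by (auto simp: B split: if_splits)
    ultimately show ?thesis using edge by (auto simp: G G' C'_def zero_less_mult_iff)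
  next
    case (facet f a b c)
    note d = vertices_distinct[OF facet(1)]
    note cor = corner[OF facet(1)]
    have s: "sd 0 f \<in> edges K" "sd 1 f \<in> edges K" "sd 2 f \<in> edges K"
      using side_in[OF facet(1)] by auto
    have at: "sd 0 f \<in> edges_at K v \<longleftrightarrow> st (sd 0 f) = v \<or> en (sd 0 f) = v"
      "sd 1 f \<in> edges_at K v \<longleftrightarrow> st (sd 1 f) = v \<or> en (sd 0 f) = v"
      "sd 2 f \<in> edges_at K v \<longleftrightarrow> st (sd 1 f) = v \<or> st (sd 0 f) = v"
      using s cor by (auto simp: edges_at_eq)
    have link: "sd j f \<in> C" if "sd i f \<in> C" "sd j f \<in> edges_at K v" "i \<le> 2" "j \<le> 2" for i j
      using linked facet(1) that unfolding linked_at_def by blast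
    \<comment> \<open>Coordinate 1 at \<open>v\<close> would put \<open>p\<close> at
      \<open>v\<close>, so the opposite side of the facet carries some weight.\<close>
    have notv: "a \<noteq> 1 \<or> st (sd 1 f) \<noteq> v" "b \<noteq> 1 \<or> st (sd 0 f) \<noteq> v" "c \<noteq> 1 \<or> en (sd 0 f) \<noteq> v"
    proof -
      have "B p = 1 \<Longrightarrow> False" using pt0_only[OF B(2,3,4) p(1)] p(3) by blast
      then show "a \<noteq> 1 \<or> st (sd 1 f) \<noteq> v" "b \<noteq> 1 \<or> st (sd 0 f) \<noteq> v" "c \<noteq> 1 \<or> en (sd 0 f) \<noteq> v"
        using facet d by (auto simp: B)
    qed
    consider (0) "st (sd 1 f) = v" "0 < a" | (1) "st (sd 0 f) = v" "0 < b" | (2) "en (sd 0 f) = v" "0 < c"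
      using p(2) facet d by (auto simp: B split: if_splits)
    then show ?thesis
    proof cases
      case 0
      have at0: "sd 0 f \<notin> edges_at K v" "sd 1 f \<in> edges_at K v" "sd 2 f \<in> edges_at K v" using at 0 d by auto
      then have C01: "sd 0 f \<notin> C" "sd 0 f \<notin> C'" "sd 1 f \<in> C \<longleftrightarrow> sd 2 f \<in> C"
          "sd 1 f \<in> C' \<longleftrightarrow> sd 1 f \<notin> C" "sd 2 f \<in> C' \<longleftrightarrow> sd 2 f \<notin> C"
        using C(1) link[of 1 2] link[of 2 1] by (auto simp: C'_def)
      have "0 < b + c" using notv(1) facet 0 by auto
      then have "0 < a * c + a * b" using 0(2) by (simp flip: distrib_left add: add.commute)
      then show ?thesis using C01 facet(6) by (auto simp: G G')
    next
      case 1
      have at0: "sd 1 f \<notin> edges_at K v" "sd 0 f \<in> edges_at K v" "sd 2 f \<in> edges_at K v" using at 1 d by auto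
      then have C01: "sd 1 f \<notin> C" "sd 1 f \<notin> C'" "sd 0 f \<in> C \<longleftrightarrow> sd 2 f \<in> C"
          "sd 0 f \<in> C' \<longleftrightarrow> sd 0 f \<notin> C" "sd 2 f \<in> C' \<longleftrightarrow> sd 2 f \<notin> C"
        using C(1) link[of 0 2] link[of 2 0] by (auto simp: C'_def)
      have "0 < c + a" using notv(2) facet 1 by auto
      then have "0 < b * c + a * b" using 1(2) by (simp flip: distrib_left add: mult.commute[of a b])
      then show ?thesis using C01 facet(6) by (auto simp: G G')
    next
      case 2
      have at0: "sd 2 f \<notin> edges_at K v" "sd 0 f \<in> edges_at K v" "sd 1 f \<in> edges_at K v" using at 2 d by auto
      then have C01: "sd 2 f \<notin> C" "sd 2 f \<notin> C'" "sd 0 f \<in> C \<longleftrightarrow> sd 1 f \<in> C"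
          "sd 0 f \<in> C' \<longleftrightarrow> sd 0 f \<notin> C" "sd 1 f \<in> C' \<longleftrightarrow> sd 1 f \<notin> C"
        using C(1) link[of 0 1] link[of 1 0] by (auto simp: C'_def)
      have "0 < b + a" using notv(3) facet 2 by auto
      then have "0 < b * c + a * c" using 2(2) by (simp flip: distrib_right)
      then show ?thesis using C01 facet(6) by (auto simp: G G')
    qed
  qed
  have xin: "pt0 v \<in> topspace ?X" using v by (rule pt0_in)
  obtain U W f g where ch: "openin ?X U" "pt0 v \<in> U" "open (W :: complex set)"
    "homeomorphic_maps (subtopology ?X U) (top_of_set W) f g"
    using connected_2_manifold_chart[OF man xin] by metis
  interpret ch: chart ?X U W f g by unfold_locales (fact ch)+
  let ?q = "f (pt0 v)"
  have "open {w \<in> W. 0 < B (g w)}"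
    by (rule ch.open_positive[OF B(1) subset_refl ch(3)])
  moreover have "?q \<in> {w \<in> W. 0 < B (g w)}" using ch.f_in ch.gf ch(2) by (simp add: B)
  ultimately obtain r where r: "0 < r" "ball ?q r \<subseteq> {w \<in> W. 0 < B (g w)}" using open_contains_ball by blast
  define N where "N = ball ?q r - {?q}"
  have NW: "N \<subseteq> W" using r by (auto simp: N_def)
  have oN: "open N" by (simp add: N_def open_delete)
  have dN: "(0 < G (g w)) \<noteq> (0 < G' (g w))" if "w \<in> N" for w
  proof (rule dichotomy)
    show "g w \<in> topspace ?X" using ch.g_in ch.U_sub NW that by blast
    show "0 < B (g w)" using r that by (auto simp: N_def)
    show "g w \<noteq> pt0 v"
    proof
      assume "g w = pt0 v"
      then have "w = ?q" using ch.fg_id NW that by (metis subsetD)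
      then show False using that by (simp add: N_def)
    qed
  qed
  have "connected N" unfolding N_def by (rule connected_punctured_ball) simp
  moreover have "open {w \<in> N. 0 < G (g w)}"
    by (rule ch.open_positive[OF G(1) NW oN])
  moreover have "open {w \<in> N. 0 < G' (g w)}"
    by (rule ch.open_positive[OF G'(1) NW oN])
  moreover have "N \<subseteq> {w \<in> N. 0 < G (g w)} \<union> {w \<in> N. 0 < G' (g w)}" using dN by auto
  moreover have "{w \<in> N. 0 < G (g w)} \<inter> {w \<in> N. 0 < G' (g w)} \<inter> N = {}" using dN by auto
  ultimately have empty: "{w \<in> N. 0 < G (g w)} \<inter> N = {} \<or> {w \<in> N. 0 < G' (g w)} \<inter> N = {}"
    by (meson connectedD)
  \<comment> \<open>Moving out of \<open>v\<close> along \<open>e\<close> enters the punctured disc;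
    \<open>s\<close> is the coordinate at the far end. Applied to an edge of \<open>C\<close> and to
    one of \<open>C'\<close>, this makes both open sets nonempty.\<close>
  have near: "\<exists>w\<in>N. \<exists>s. 0 < s \<and> s < 1 \<and> g w = (if st e = v then pt1 e (1 - s) s else pt1 e s (1 - s))"
    if e: "e \<in> edges_at K v" for e
  proof -
    have eE: "e \<in> edges K" and ev: "st e = v \<or> en e = v" using e by (auto simp: edges_at_eq)
    have ne: "st e \<noteq> en e" using eE by (rule st_neq_en)
    define \<gamma> where "\<gamma> = (\<lambda>s. if st e = v then pt1 e (1 - s) s else pt1 e s (1 - s))"
    have c: "continuous_map (top_of_set {0..1}) ?X \<gamma>"
    proof (cases "st e = v")
      case True
      have "continuous_map (top_of_set {0..1}) ?X (\<lambda>s. pt1 e (1 - s) s)"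
        by (rule continuous_map_pt1[OF eE]) (auto intro!: continuous_intros)
      then show ?thesis using True by (simp add: \<gamma>_def)
    next
      case False
      have "continuous_map (top_of_set {0..1}) ?X (\<lambda>s. pt1 e s (1 - s))"
        by (rule continuous_map_pt1[OF eE]) (auto intro!: continuous_intros)
      then show ?thesis using False by (simp add: \<gamma>_def)
    qed
    have g0: "\<gamma> 0 = pt0 v" using ev pt1_vertex[OF eE] by (auto simp: \<gamma>_def)
    obtain s where s: "0 < s" "s < 1" "\<gamma> s \<in> U" "f (\<gamma> s) \<in> ball ?q r"
      by (rule ch.curve_meets[OF c, of "ball ?q r"]) (use g0 ch(2) r(1) in auto)
    have "B (\<gamma> s) = 1 - s" using ev ne by (auto simp: \<gamma>_def B)
    then have "\<gamma> s \<noteq> pt0 v" using s(1) by (auto simp: B)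
    then have "f (\<gamma> s) \<noteq> ?q" using ch.gf[OF s(3)] ch.gf[OF ch(2)] by metis
    then have "f (\<gamma> s) \<in> N" using s(4) by (simp add: N_def)
    moreover have "g (f (\<gamma> s)) = \<gamma> s" using s(3) by (rule ch.gf)
    ultimately show ?thesis using s(1,2) unfolding \<gamma>_def by blast
  qed
  obtain e where e: "e \<in> C" using C(2) by blast
  obtain w s where w: "w \<in> N" "0 < s" "s < 1" "g w = (if st e = v then pt1 e (1 - s) s else pt1 e s (1 - s))"
    using near[of e] e C(1) by blast
  have "0 < G (g w)" unfolding w(4) using e w(2,3) by (simp add: G)
  obtain e' where e': "e' \<in> C'" using C' by blast
  obtain w' s' where w': "w' \<in> N" "0 < s'" "s' < 1" "g w' = (if st e' = v then pt1 e' (1 - s') s' else pt1 e' s' (1 - s'))"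
    using near[of e'] e' by (auto simp: C'_def)
  have "0 < G' (g w')" unfolding w'(4) using e' w'(2,3) by (simp add: G')
  then show False using empty \<open>0 < G (g w)\<close> w(1) w'(1) by blast
qed

end

section \<open>The degree of an edge in a surface\<close>

context regular_2_complex
begin

text \<open>Coordinates adapted to side \<open>i\<close>: \<open>a\<close> and \<open>b\<close>
  belong to its start and end, the remainder to the opposite vertex. All facets around an edge thus
  share the coordinates of that edge.\<close>

definition wing :: "'a \<Rightarrow> nat \<Rightarrow> real \<Rightarrow> real \<Rightarrow> 'a simplex_point set" where
  "wing f i a b = (if i = 0 then pt2 f (1 - a - b) a b else if i = 1 then pt2 f a (1 - a - b) b else pt2 f a b (1 - a - b))"

lemma wing_edge:
  assumes "f \<in> facets K" "i \<le> 2" "0 \<le> a" "0 \<le> b" "a + b = 1"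
  shows "wing f i a b = pt1 (sd i f) a b"
proof -
  have "1 - a - b = 0" using assms by simp
  moreover have "i = 0 \<or> i = 1 \<or> i = 2" using assms by auto
  ultimately show ?thesis using pt2_side[OF assms(1,3,4,5)] by (auto simp: wing_def)
qed

lemma continuous_map_wing:
  fixes a b :: "'b::topological_space \<Rightarrow> real"
  assumes "f \<in> facets K" "continuous_on D a" "continuous_on D b"
    "\<And>x. x \<in> D \<Longrightarrow> 0 \<le> a x" "\<And>x. x \<in> D \<Longrightarrow> 0 \<le> b x" "\<And>x. x \<in> D \<Longrightarrow> a x + b x \<le> 1"
  shows "continuous_map (top_of_set D) (realization K) (\<lambda>x. wing f i (a x) (b x))"
proof -
  have c: "continuous_on D (\<lambda>x. 1 - a x - b x)" using assms by (intro continuous_intros)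
  have p: "0 \<le> 1 - a x - b x" if "x \<in> D" for x using assms(6)[OF that] by simp
  consider "i = 0" | "i = 1" | "i \<noteq> 0" "i \<noteq> 1" by blast
  then show ?thesis
  proof cases
    case 1
    then show ?thesis unfolding wing_def using continuous_map_pt2[OF assms(1) c assms(2,3) p assms(4,5)] by simp
  next
    case 2
    then show ?thesis unfolding wing_def using continuous_map_pt2[OF assms(1) assms(2) c assms(3) assms(4) p assms(5)] by simp
  next
    case 3
    then show ?thesis unfolding wing_def using continuous_map_pt2[OF assms(1) assms(2,3) c assms(4,5) p] by simp
  qed
qed

lemma edge_coordinates:
  assumes e: "e \<in> edges K"
  shows "\<exists>B B'. continuous_map (realization K) euclideanreal B \<and> continuous_map (realization K) euclideanreal B' \<and>
    (\<forall>a b. B (pt1 e a b) = a \<and> B' (pt1 e a b) = b) \<and>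
    (\<forall>f i a b. f \<in> facets K \<longrightarrow> i \<le> 2 \<longrightarrow> sd i f = e \<longrightarrow> B (wing f i a b) = a \<and> B' (wing f i a b) = b)"
proof -
  obtain B where B: "continuous_map (realization K) euclideanreal B"
    "\<And>v'. B (pt0 v') = (if v' \<in> {st e} then 1 else 0)"
    "\<And>e' a b. B (pt1 e' a b) = (if st e' \<in> {st e} then a else 0) + (if en e' \<in> {st e} then b else 0)"
    "\<And>f a b c. B (pt2 f a b c) =
      (if st (sd 1 f) \<in> {st e} then a else 0) + (if st (sd 0 f) \<in> {st e} then b else 0) + (if en (sd 0 f) \<in> {st e} then c else 0)"
    using vertex_weight[of "{st e}"] by (elim exE conjE) blast
  obtain B' where B': "continuous_map (realization K) euclideanreal B'"
    "\<And>v'. B' (pt0 v') = (if v' \<in> {en e} then 1 else 0)"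
    "\<And>e' a b. B' (pt1 e' a b) = (if st e' \<in> {en e} then a else 0) + (if en e' \<in> {en e} then b else 0)"
    "\<And>f a b c. B' (pt2 f a b c) =
      (if st (sd 1 f) \<in> {en e} then a else 0) + (if st (sd 0 f) \<in> {en e} then b else 0) + (if en (sd 0 f) \<in> {en e} then c else 0)"
    using vertex_weight[of "{en e}"] by (elim exE conjE) blast
  have ne: "st e \<noteq> en e" using e by (rule st_neq_en)
  have w: "B (wing f i a b) = a \<and> B' (wing f i a b) = b" if f: "f \<in> facets K" "i \<le> 2" "sd i f = e" for f i a b
  proof -
    note d = vertices_distinct[OF f(1)] and cor = corner[OF f(1)]
    consider "i = 0" | "i = 1" | "i = 2" using f(2) by linarith
    then show ?thesis
    proof cases
      case 1
      then have "st e = st (sd 0 f)" "en e = en (sd 0 f)" using f by auto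
      then show ?thesis using d 1 by (simp add: wing_def B B' d[symmetric])
    next
      case 2
      then have "st e = st (sd 1 f)" "en e = en (sd 0 f)" using f cor by auto
      then show ?thesis using d 2 by (simp add: wing_def B B' d[symmetric])
    next
      case 3
      then have "st e = st (sd 1 f)" "en e = st (sd 0 f)" using f cor by auto
      then show ?thesis using d 3 by (simp add: wing_def B B' d[symmetric])
    qed
  qed
  have "B (pt1 e a b) = a \<and> B' (pt1 e a b) = b" for a b
    using ne by (simp add: B B')
  then show ?thesis
    using B(1) B'(1) w by (intro exI[of _ B] exI[of _ B']) simp
qed

lemma edge_star:
  assumes G: "\<And>v. G (pt0 v) = (0::real)"
    "\<And>e' a b. G (pt1 e' a b) = (if e' \<in> {e} then a * b else 0)"
    "\<And>f a b c. G (pt2 f a b c) =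
      (if sd 0 f \<in> {e} then b * c else 0) + (if sd 1 f \<in> {e} then a * c else 0) + (if sd 2 f \<in> {e} then a * b else 0)"
    and p: "p \<in> topspace (realization K)" "0 < G p"
  shows "(\<exists>a b. 0 \<le> a \<and> 0 \<le> b \<and> a + b = 1 \<and> p = pt1 e a b) \<or>
    (\<exists>f i a b. f \<in> facets K \<and> i \<le> 2 \<and> sd i f = e \<and> 0 \<le> a \<and> 0 \<le> b \<and> a + b \<le> 1 \<and> p = wing f i a b)"
  using p(1)
proof (cases rule: point_cases)
  case (vertex v)
  then show ?thesis using p(2) G(1) by simp
next
  case (edge e' a b)
  then have "e' = e" using p(2) by (auto simp: G(2) split: if_splits)
  then show ?thesis using edge by blast
next
  case (facet f a b c)
  then consider "sd 0 f = e" | "sd 1 f = e" | "sd 2 f = e"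
    using p(2) by (auto simp: G(3) split: if_splits)
  then show ?thesis
  proof cases
    case 1
    have "a = 1 - b - c" using facet(5) by simp
    then have "pt2 f a b c = pt2 f (1 - b - c) b c" by (rule arg_cong)
    then have "p = wing f 0 b c" using facet(6) by (simp add: wing_def)
    then have "f \<in> facets K \<and> (0::nat) \<le> 2 \<and> sd 0 f = e \<and> 0 \<le> b \<and> 0 \<le> c \<and> b + c \<le> 1 \<and> p = wing f 0 b c"
      using facet(1-5) 1 by simp
    then show ?thesis by blast
  next
    case 2
    have "b = 1 - a - c" using facet(5) by simp
    then have "pt2 f a b c = pt2 f a (1 - a - c) c" by (rule arg_cong)
    then have "p = wing f 1 a c" using facet(6) by (simp add: wing_def)
    then have "f \<in> facets K \<and> (1::nat) \<le> 2 \<and> sd 1 f = e \<and> 0 \<le> a \<and> 0 \<le> c \<and> a + c \<le> 1 \<and> p = wing f 1 a c"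
      using facet(1-5) 2 by simp
    then show ?thesis by blast
  next
    case 3
    have "c = 1 - a - b" using facet(5) by simp
    then have "pt2 f a b c = pt2 f a b (1 - a - b)" by (rule arg_cong)
    then have "p = wing f 2 a b" using facet(6) by (simp add: wing_def)
    then have "f \<in> facets K \<and> (2::nat) \<le> 2 \<and> sd 2 f = e \<and> 0 \<le> a \<and> 0 \<le> b \<and> a + b \<le> 1 \<and> p = wing f 2 a b"
      using facet(1-5) 3 by simp
    then show ?thesis by blast
  qed
qed

lemma side_index: "f \<in> facets_at K e \<Longrightarrow> \<exists>i\<le>2. sd i f = e"
  by (auto simp: facets_at_def side_def)

text \<open>With at most one facet at \<open>e\<close>, points near the midpoint are determined by
  their coordinates at the two ends of \<open>e\<close>. These embed a neighbourhood into a closed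
  half plane with the midpoint on its boundary line, against invariance of domain.\<close>

lemma edge_degree_not_le_1:
  assumes man: "connected_2_manifold (realization K)" and e: "e \<in> edges K" and sub: "facets_at K e \<subseteq> {t}"
  shows False
proof -
  let ?X = "realization K"
  obtain B B' where B: "continuous_map ?X euclideanreal B" "continuous_map ?X euclideanreal B'"
    "\<And>a b. B (pt1 e a b) = a" "\<And>a b. B' (pt1 e a b) = b"
    "\<And>f i a b. f \<in> facets K \<Longrightarrow> i \<le> 2 \<Longrightarrow> sd i f = e \<Longrightarrow> B (wing f i a b) = a"
    "\<And>f i a b. f \<in> facets K \<Longrightarrow> i \<le> 2 \<Longrightarrow> sd i f = e \<Longrightarrow> B' (wing f i a b) = b"
    using edge_coordinates[OF e] by (elim exE conjE) simp
  obtain G where G: "continuous_map ?X euclideanreal G" "\<And>v. G (pt0 v) = 0"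
    "\<And>e' a b. G (pt1 e' a b) = (if e' \<in> {e} then a * b else 0)"
    "\<And>f a b c. G (pt2 f a b c) =
      (if sd 0 f \<in> {e} then b * c else 0) + (if sd 1 f \<in> {e} then a * c else 0) + (if sd 2 f \<in> {e} then a * b else 0)"
    using edge_weight[of "{e}"] by (elim exE conjE) blast
  \<comment> \<open>Recovers a point of the star from its coordinates at the ends of
    \<open>e\<close>. Without facets the star is just the open edge.\<close>
  define R where "R = (\<lambda>a b. if facets_at K e = {} then pt1 e a b else wing t (SOME i. i \<le> 2 \<and> sd i t = e) a b)"
  have star: "p = R (B p) (B' p) \<and> B p + B' p \<le> 1" if p: "p \<in> topspace ?X" "0 < G p" for p
    using edge_star[OF G(2-4) p]
  proof (elim disjE exE conjE)
    fix a b assume ab: "0 \<le> a" "0 \<le> b" "a + b = 1" "p = pt1 e a b"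
    show ?thesis
    proof (cases "facets_at K e = {}")
      case True
      then show ?thesis using ab B by (simp add: R_def)
    next
      case False
      then have t: "t \<in> facets_at K e" using sub by auto
      then have tF: "t \<in> facets K" by (simp add: facets_at_eq)
      define i where "i = (SOME i. i \<le> 2 \<and> sd i t = e)"
      have i: "i \<le> 2 \<and> sd i t = e" unfolding i_def by (rule someI_ex) (use side_index[OF t] in blast)
      have "wing t i a b = pt1 e a b" using wing_edge[OF tF _ ab(1,2,3), of i] i by simp
      then show ?thesis using ab B False by (simp add: R_def i_def)
    qed
  next
    fix f i a b assume f: "f \<in> facets K" "i \<le> 2" "sd i f = e" and ab: "0 \<le> a" "0 \<le> b" "a + b \<le> 1" "p = wing f i a b"
    have "f \<in> facets_at K e" using f by (auto simp: facets_at_def side_def)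
    then have ft: "f = t" and ne: "facets_at K e \<noteq> {}" using sub by auto
    have "(SOME i. i \<le> 2 \<and> sd i t = e) = i"
    proof (rule some_equality)
      show "i \<le> 2 \<and> sd i t = e" using f ft by simp
    qed (use f ft side_inj[of t] in auto)
    then show ?thesis using ab f ft ne B by (simp add: R_def)
  qed
  define x where "x = pt1 e (1/2) (1/2)"
  have xin: "x \<in> topspace ?X" unfolding x_def using e by (rule pt1_in) auto
  have Gx: "0 < G x" by (simp add: x_def G)
  obtain U W f g where ch: "openin ?X U" "x \<in> U" "open (W :: complex set)"
    "homeomorphic_maps (subtopology ?X U) (top_of_set W) f g"
    using connected_2_manifold_chart[OF man xin] by metis
  interpret ch: chart ?X U W f g by unfold_locales (fact ch)+
  define W' where "W' = {w \<in> W. 0 < G (g w)}"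
  have oW': "open W'"
    unfolding W'_def by (rule ch.open_positive[OF G(1) subset_refl ch(3)])
  \<comment> \<open>The imaginary part is the coordinate at the vertex opposite
    \<open>e\<close>.\<close>
  define \<phi> where "\<phi> = (\<lambda>w. Complex (B (g w)) (1 - B (g w) - B' (g w)))"
  have "continuous_on W' (\<lambda>w. B (g w))" "continuous_on W' (\<lambda>w. B' (g w))"
    using ch.continuous_on_comp_g[OF B(1)] ch.continuous_on_comp_g[OF B(2)]
    by (auto intro: continuous_on_subset simp: W'_def)
  then have "continuous_on W' \<phi>" unfolding \<phi>_def Complex_eq by (intro continuous_intros)
  moreover have gin: "g w \<in> topspace ?X" "0 < G (g w)" if "w \<in> W'" for w
    using that ch.g_in ch.U_sub by (auto simp: W'_def)
  have "inj_on \<phi> W'"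
  proof (rule inj_onI)
    fix w w' assume w: "w \<in> W'" "w' \<in> W'" "\<phi> w = \<phi> w'"
    have "g w = R (B (g w)) (B' (g w))" "g w' = R (B (g w')) (B' (g w'))"
      using star gin w by blast+
    moreover have "B (g w) = B (g w')" "B' (g w) = B' (g w')" using w(3) by (auto simp: \<phi>_def)
    ultimately have "g w = g w'" by simp
    then show "w = w'" using ch.fg_id w unfolding W'_def by (metis (no_types, lifting) mem_Collect_eq)
  qed
  ultimately have "open (\<phi> ` W')" using oW' by (intro invariance_of_domain)
  moreover have "f x \<in> W'" using ch.f_in[OF ch(2)] ch.gf[OF ch(2)] Gx by (simp add: W'_def)
  moreover have phix: "\<phi> (f x) = Complex (1/2) 0" using ch.gf[OF ch(2)] by (simp add: \<phi>_def x_def B)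
  ultimately obtain r where r: "0 < r" "ball (Complex (1/2) 0) r \<subseteq> \<phi> ` W'"
    by (metis imageI open_contains_ball)
  have "Complex (1/2) (- (r/2)) \<in> ball (Complex (1/2) 0) r"
    using r(1) by (simp add: dist_norm complex_diff cmod_def)
  then obtain w where w: "w \<in> W'" "\<phi> w = Complex (1/2) (- (r/2))" using r(2) by (metis imageE subsetD)
  have "B (g w) + B' (g w) \<le> 1" using star gin[OF w(1)] by blast
  then show False using w(2) r(1) by (simp add: \<phi>_def)
qed

text \<open>Two facets along \<open>e\<close> form a disc, whose image is a neighbourhood of the
  midpoint by invariance of domain. A curve from the midpoint into a third facet would have to meet
  that disc again at some positive time.\<close>

lemma edge_degree_not_ge_3:
  assumes man: "connected_2_manifold (realization K)" and e: "e \<in> edges K"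
    and t: "t1 \<in> facets_at K e" "t2 \<in> facets_at K e" "t3 \<in> facets_at K e" "t1 \<noteq> t2" "t1 \<noteq> t3" "t2 \<noteq> t3"
  shows False
proof -
  let ?X = "realization K"
  obtain B B' where B: "continuous_map ?X euclideanreal B" "continuous_map ?X euclideanreal B'"
    "\<And>a b. B (pt1 e a b) = a" "\<And>a b. B' (pt1 e a b) = b"
    "\<And>f i a b. f \<in> facets K \<Longrightarrow> i \<le> 2 \<Longrightarrow> sd i f = e \<Longrightarrow> B (wing f i a b) = a"
    "\<And>f i a b. f \<in> facets K \<Longrightarrow> i \<le> 2 \<Longrightarrow> sd i f = e \<Longrightarrow> B' (wing f i a b) = b"
    using edge_coordinates[OF e] by (elim exE conjE) simp
  obtain T1 where T1: "\<And>f a b c. T1 (pt2 f a b c) = (if f = t1 then a * b * c else (0::real))"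
    using facet_weight[of t1] by blast
  obtain T3 where T3: "\<And>f a b c. T3 (pt2 f a b c) = (if f = t3 then a * b * c else (0::real))"
    using facet_weight[of t3] by blast
  have T1w: "T1 (wing f i a b) = (if f = t1 then a * b * (1 - a - b) else 0)" for f i a b
    by (simp add: wing_def T1)
  have T3w: "T3 (wing f i a b) = (if f = t3 then a * b * (1 - a - b) else 0)" for f i a b
    by (simp add: wing_def T3)
  obtain i1 where i1: "i1 \<le> 2" "sd i1 t1 = e" using side_index[OF t(1)] by blast
  obtain i2 where i2: "i2 \<le> 2" "sd i2 t2 = e" using side_index[OF t(2)] by blast
  obtain i3 where i3: "i3 \<le> 2" "sd i3 t3 = e" using side_index[OF t(3)] by blast
  have tF: "t1 \<in> facets K" "t2 \<in> facets K" "t3 \<in> facets K" using t by (auto simp: facets_at_eq)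
  \<comment> \<open>The radius 1/4 keeps \<open>A\<close> and \<open>A'\<close> positive: both
    exceed 3/8 - 1/4.\<close>
  define D where "D = ball (0::complex) (1/4)"
  define A where "A = (\<lambda>z. (1 - \<bar>Im z\<bar>) / 2 + Re z)"
  define A' where "A' = (\<lambda>z. (1 - \<bar>Im z\<bar>) / 2 - Re z)"
  have D: "\<bar>Re z\<bar> < 1/4" "\<bar>Im z\<bar> < 1/4" if "z \<in> D" for z
    using that abs_Re_le_cmod[of z] abs_Im_le_cmod[of z] by (auto simp: D_def)
  have Apos: "0 < A z" "0 < A' z" "A z + A' z = 1 - \<bar>Im z\<bar>" if "z \<in> D" for z
    using D[OF that] by (auto simp: A_def A'_def field_simps)
  \<comment> \<open>The sign of Im z selects the facet, its absolute value is the coordinate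
    opposite \<open>e\<close>, and Re z moves along \<open>e\<close>. \<open>T1\<close> separates
    the two halves; \<open>T3\<close> vanishes on the disc but not on the curve in
    \<open>t3\<close>.\<close>
  define \<Gamma> where "\<Gamma> = (\<lambda>z. if 0 \<le> Im z then wing t1 i1 (A z) (A' z) else wing t2 i2 (A z) (A' z))"
  have contA: "continuous_on S A" "continuous_on S A'" for S
    unfolding A_def A'_def by (intro continuous_intros; simp)+
  have cont: "continuous_map (top_of_set D) ?X \<Gamma>"
    unfolding \<Gamma>_def
  proof (rule continuous_map_cases_le)
    show "continuous_map (top_of_set D) euclideanreal (\<lambda>x. 0)" by simp
    show "continuous_map (top_of_set D) euclideanreal Im" by (simp add: continuous_on_Im)
    have *: "subtopology (top_of_set D) S = top_of_set (D \<inter> S)" for S :: "complex set" by (simp add: subtopology_subtopology)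
    show "continuous_map (subtopology (top_of_set D) {x \<in> topspace (top_of_set D). 0 \<le> Im x}) ?X (\<lambda>x. wing t1 i1 (A x) (A' x))"
      unfolding * by (rule continuous_map_wing[OF tF(1) contA]) (use Apos in \<open>force simp: less_imp_le\<close>)+
    show "continuous_map (subtopology (top_of_set D) {x \<in> topspace (top_of_set D). Im x \<le> 0}) ?X (\<lambda>x. wing t2 i2 (A x) (A' x))"
      unfolding * by (rule continuous_map_wing[OF tF(2) contA]) (use Apos in \<open>force simp: less_imp_le\<close>)+
    fix z assume z: "z \<in> topspace (top_of_set D)" "0 = Im z"
    then have zD: "z \<in> D" by simp
    have s: "A z + A' z = 1" "0 \<le> A z" "0 \<le> A' z" using Apos[OF zD] z(2) by auto
    show "wing t1 i1 (A z) (A' z) = wing t2 i2 (A z) (A' z)"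
      using wing_edge[OF tF(1) i1(1) s(2,3,1)] wing_edge[OF tF(2) i2(1) s(2,3,1)] i1 i2 by simp
  qed
  have BG: "B (\<Gamma> z) = A z" "B' (\<Gamma> z) = A' z" for z
    using B(5,6) tF i1 i2 by (auto simp: \<Gamma>_def)
  have TG: "0 < T1 (\<Gamma> z) \<longleftrightarrow> 0 < Im z" "T3 (\<Gamma> z) = 0" if "z \<in> D" for z
    using Apos[OF that] t(4-6) by (auto simp: \<Gamma>_def T1w T3w zero_less_mult_iff)
  have inj: "inj_on \<Gamma> D"
  proof (rule inj_onI)
    fix z w assume zw: "z \<in> D" "w \<in> D" "\<Gamma> z = \<Gamma> w"
    have "A z = A w" "A' z = A' w" using BG zw(3) by metis+
    then have "Re z = Re w" "\<bar>Im z\<bar> = \<bar>Im w\<bar>" by (auto simp: A_def A'_def field_simps)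
    moreover have "0 < Im z \<longleftrightarrow> 0 < Im w" using TG(1)[OF zw(1)] TG(1)[OF zw(2)] zw(3) by simp
    ultimately show "z = w" by (intro complex_eqI) (auto simp: abs_if split: if_splits)
  qed
  define x where "x = pt1 e (1/2) (1/2)"
  have xin: "x \<in> topspace ?X" unfolding x_def using e by (rule pt1_in) auto
  have G0: "\<Gamma> 0 = x" using wing_edge[OF tF(1) i1(1), of "1/2" "1/2"] i1 by (simp add: \<Gamma>_def x_def A_def A'_def)
  have D0: "0 \<in> D" by (simp add: D_def)
  obtain U W f g where ch: "openin ?X U" "x \<in> U" "open (W :: complex set)"
    "homeomorphic_maps (subtopology ?X U) (top_of_set W) f g"
    using connected_2_manifold_chart[OF man xin] by metis
  interpret ch: chart ?X U W f g by unfold_locales (fact ch)+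
  have "open (f ` (\<Gamma> ` D \<inter> U))" by (rule ch.open_image[OF _ cont inj]) (simp add: D_def)
  moreover have "f x \<in> f ` (\<Gamma> ` D \<inter> U)" using G0 D0 ch(2) by blast
  moreover define \<gamma> where "\<gamma> = (\<lambda>s::real. wing t3 i3 ((1 - s) / 2) ((1 - s) / 2))"
  moreover have "continuous_map (top_of_set {0..1}) ?X \<gamma>"
    unfolding \<gamma>_def by (rule continuous_map_wing[OF tF(3)]) (auto intro!: continuous_intros)
  moreover have "\<gamma> 0 = x" using wing_edge[OF tF(3) i3(1), of "1/2" "1/2"] i3 by (simp add: \<gamma>_def x_def)
  ultimately obtain s where s: "0 < s" "s < 1" "\<gamma> s \<in> U" "f (\<gamma> s) \<in> f ` (\<Gamma> ` D \<inter> U)"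
    using ch.curve_meets[of \<gamma> "f ` (\<Gamma> ` D \<inter> U)"] ch(2) by metis
  then obtain z where z: "z \<in> D" "\<Gamma> z \<in> U" "f (\<gamma> s) = f (\<Gamma> z)" by blast
  then have "\<gamma> s = \<Gamma> z" using ch.gf[OF s(3)] ch.gf[OF z(2)] by metis
  then have "T3 (\<gamma> s) = 0" using TG(2)[OF z(1)] by simp
  moreover have "0 < T3 (\<gamma> s)" using s(1,2) by (simp add: \<gamma>_def T3w)
  ultimately show False by simp
qed

lemma edge_degree:
  assumes man: "connected_2_manifold (realization K)" and e: "e \<in> edges K" and fin: "finite (facets K)"
  shows "card (facets_at K e) = 2"
proof (rule ccontr)
  assume "card (facets_at K e) \<noteq> 2"
  moreover have finS: "finite (facets_at K e)" using fin by (simp add: facets_at_eq)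
  ultimately consider "card (facets_at K e) \<le> 1" | "3 \<le> card (facets_at K e)" by linarith
  then show False
  proof cases
    case 1
    then obtain t where "facets_at K e \<subseteq> {t}" using finS by (metis card_le_Suc0_iff_eq insertI1 One_nat_def subsetI subset_singletonD singleton_iff)
    then show ?thesis by (rule edge_degree_not_le_1[OF man e])
  next
    case 2
    then obtain A where "A \<subseteq> facets_at K e" "card A = 3" by (metis obtain_subset_with_card_n)
    then obtain t1 t2 t3 where "A = {t1, t2, t3}" "t1 \<noteq> t2" "t1 \<noteq> t3" "t2 \<noteq> t3"
      by (auto simp: numeral_3_eq_3 card_Suc_eq)
    then show ?thesis using edge_degree_not_ge_3[OF man e, of t1 t2 t3] \<open>A \<subseteq> _\<close> by auto
  qed
qed

end

section \<open>Cochains on links\<close>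

context regular_2_complex
begin

abbreviation sides :: "'a \<Rightarrow> 'a set" where "sides f \<equiv> {sd 0 f, sd 1 f, sd 2 f}"

text \<open>A 1-cochain \<open>c\<close> gives the value of each edge in the direction from \<open>st\<close> to \<open>en\<close>;
  \<open>oriented c (v, e)\<close> is its value in the direction leaving \<open>v\<close>.  The flags \<open>(v, e)\<close> are the vertices
  of the link of \<open>v\<close>, and \<open>piece\<close> gives the connected components of the links.\<close>

definition closed_at :: "('a \<Rightarrow> real) \<Rightarrow> 'a \<Rightarrow> bool" where
  "closed_at c f \<longleftrightarrow> c (sd 0 f) - c (sd 1 f) + c (sd 2 f) = 0"

definition flags :: "('a \<times> 'a) set" where
  "flags = {(v, e). e \<in> edges K \<and> (st e = v \<or> en e = v)}"

definition other :: "'a \<Rightarrow> 'a \<Rightarrow> 'a" where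
  "other v e = (if st e = v then en e else st e)"

definition opp :: "'a \<times> 'a \<Rightarrow> 'a \<times> 'a" where "opp a = (other (fst a) (snd a), snd a)"

definition oriented :: "('a \<Rightarrow> real) \<Rightarrow> 'a \<times> 'a \<Rightarrow> real" where
  "oriented c a = (if st (snd a) = fst a then c (snd a) else - c (snd a))"

definition adj :: "(('a \<times> 'a) \<times> ('a \<times> 'a)) set" where
  "adj = {((v, e), (v, e')) | v e e'. (v, e) \<in> flags \<and> (v, e') \<in> flags \<and> (\<exists>f\<in>facets K. e \<in> sides f \<and> e' \<in> sides f)}"

definition piece :: "'a \<times> 'a \<Rightarrow> ('a \<times> 'a) set" where "piece a = adj\<^sup>* `` {a}"

lemma flags_iff: "(v, e) \<in> flags \<longleftrightarrow> e \<in> edges_at K v"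
  by (auto simp: flags_def edges_at_eq)

lemma facets_at_sides: "facets_at K e = {f \<in> facets K. e \<in> sides f}"
  by (auto simp: facets_at_eq)

lemma sides_in: "f \<in> facets K \<Longrightarrow> e \<in> sides f \<Longrightarrow> e \<in> edges K"
  using side_in[of f 0] side_in[of f 1] side_in[of f 2] by auto

lemma sides_distinct:
  assumes "f \<in> facets K"
  shows "sd 0 f \<noteq> sd 1 f" "sd 0 f \<noteq> sd 2 f" "sd 1 f \<noteq> sd 2 f"
  using side_inj[OF assms, of 0 1] side_inj[OF assms, of 0 2] side_inj[OF assms, of 1 2] by auto

lemma corners:
  assumes f: "f \<in> facets K"
  shows "sides f \<inter> edges_at K (st (sd 1 f)) = {sd 1 f, sd 2 f}"
    "sides f \<inter> edges_at K (st (sd 0 f)) = {sd 0 f, sd 2 f}"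
    "sides f \<inter> edges_at K (en (sd 0 f)) = {sd 0 f, sd 1 f}"
proof -
  note c = corner[OF f] and d = vertices_distinct[OF f]
  have s: "sd 0 f \<in> edges K" "sd 1 f \<in> edges K" "sd 2 f \<in> edges K" using side_in[OF f] by auto
  have at: "sd 0 f \<in> edges_at K v \<longleftrightarrow> st (sd 0 f) = v \<or> en (sd 0 f) = v"
    "sd 1 f \<in> edges_at K v \<longleftrightarrow> st (sd 1 f) = v \<or> en (sd 0 f) = v"
    "sd 2 f \<in> edges_at K v \<longleftrightarrow> st (sd 1 f) = v \<or> st (sd 0 f) = v" for v
    using s c by (auto simp: edges_at_eq)
  show "sides f \<inter> edges_at K (st (sd 1 f)) = {sd 1 f, sd 2 f}"
    "sides f \<inter> edges_at K (st (sd 0 f)) = {sd 0 f, sd 2 f}"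
    "sides f \<inter> edges_at K (en (sd 0 f)) = {sd 0 f, sd 1 f}"
    using at d d[symmetric] by fast+
qed

text \<open>With r the third vertex, closedness says that the value from the start of
  \<open>e\<close> to r is \<open>c e\<close> plus the value from its end to r. Stated for an
  arbitrary side, this confines the three sign patterns to one place.\<close>

lemma opposite_corner:
  assumes f: "f \<in> facets K" and e: "e \<in> sides f"
  shows "\<exists>e' e''. sides f \<inter> edges_at K (st e) - {e} = {e'} \<and> sides f \<inter> edges_at K (en e) - {e} = {e''} \<and>
    (\<forall>c. closed_at c f \<longrightarrow> oriented c (st e, e') - oriented c (en e, e'') = c e)"
proof -
  note c = corner[OF f] and d = vertices_distinct[OF f] and s = sides_distinct[OF f] and k = corners[OF f]
  consider "e = sd 0 f" | "e = sd 1 f" | "e = sd 2 f" using e by auto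
  then show ?thesis
  proof cases
    case 1
    have "sides f \<inter> edges_at K (st e) - {e} = {sd 2 f}" "sides f \<inter> edges_at K (en e) - {e} = {sd 1 f}"
      unfolding 1 k using s by auto
    moreover have "oriented z (st e, sd 2 f) - oriented z (en e, sd 1 f) = z e" if "closed_at z f" for z
      using that d d[symmetric] unfolding 1 by (simp add: oriented_def closed_at_def c)
    ultimately show ?thesis by blast
  next
    case 2
    have "sides f \<inter> edges_at K (st e) - {e} = {sd 2 f}" "sides f \<inter> edges_at K (en e) - {e} = {sd 0 f}"
      unfolding 2 c k using s by auto
    moreover have "oriented z (st e, sd 2 f) - oriented z (en e, sd 0 f) = z e" if "closed_at z f" for z
      using that d d[symmetric] unfolding 2 c by (simp add: oriented_def closed_at_def c)
    ultimately show ?thesis by blast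
  next
    case 3
    have "sides f \<inter> edges_at K (st e) - {e} = {sd 1 f}" "sides f \<inter> edges_at K (en e) - {e} = {sd 0 f}"
      unfolding 3 c k using s by auto
    moreover have "oriented z (st e, sd 1 f) - oriented z (en e, sd 0 f) = z e" if "closed_at z f" for z
      using that d d[symmetric] unfolding 3 c by (simp add: oriented_def closed_at_def c)
    ultimately show ?thesis by blast
  qed
qed

lemma third_side:
  assumes "f \<in> facets K" "e \<in> sides f" "(v, e) \<in> flags"
  obtains e' where "sides f \<inter> edges_at K v - {e} = {e'}"
  using opposite_corner[OF assms(1,2)] assms(3) by (auto simp: flags_def)

lemma opp_in: "a \<in> flags \<Longrightarrow> opp a \<in> flags"
  by (auto simp: flags_def opp_def other_def)

lemma opp_opp: "a \<in> flags \<Longrightarrow> opp (opp a) = a"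
  using st_neq_en by (fastforce simp: flags_def opp_def other_def)

lemma oriented_eq_0_iff: "oriented c a = 0 \<longleftrightarrow> c (snd a) = 0"
  by (simp add: oriented_def)

lemma other_endpoint_eq:
  assumes "(v, e) \<in> flags"
  shows "other_endpoint K v e = other v e"
  using assms st_neq_en[of e] by (auto simp: other_endpoint_def other_def flags_def edge_start_def edge_end_def)

lemma sym_adj: "sym adj"
  unfolding adj_def sym_def by blast

lemma adj_flags: "(a, b) \<in> adj \<Longrightarrow> a \<in> flags \<and> b \<in> flags"
  unfolding adj_def by blast

lemma piece_self: "a \<in> piece a"
  by (simp add: piece_def)

lemma piece_flags: "a \<in> flags \<Longrightarrow> piece a \<subseteq> flags"
proof
  fix b assume "a \<in> flags" "b \<in> piece a"
  then have "(a, b) \<in> adj\<^sup>*" by (simp add: piece_def)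
  then show "b \<in> flags" using \<open>a \<in> flags\<close> by (induction rule: rtrancl_induct) (auto dest: adj_flags)
qed

lemma piece_eq: "b \<in> piece a \<Longrightarrow> piece b = piece a"
proof -
  assume "b \<in> piece a"
  then have ab: "(a, b) \<in> adj\<^sup>*" by (simp add: piece_def)
  then have "(b, a) \<in> adj\<^sup>*" using sym_rtrancl[OF sym_adj] by (auto dest: symD)
  with ab show ?thesis unfolding piece_def by (auto intro: rtrancl_trans)
qed

lemma adj_piece: "(b, b') \<in> adj \<Longrightarrow> b \<in> piece a \<Longrightarrow> b' \<in> piece a"
  unfolding piece_def by (auto intro: rtrancl_into_rtrancl)

lemma adj_piece_eq: "(a, b) \<in> adj \<Longrightarrow> piece a = piece b"
  using piece_eq[of b a] adj_piece[OF _ piece_self] by blast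

lemma piece_fst: "b \<in> piece a \<Longrightarrow> fst b = fst a"
proof -
  assume "b \<in> piece a"
  then have "(a, b) \<in> adj\<^sup>*" by (simp add: piece_def)
  then show ?thesis by (induction rule: rtrancl_induct) (auto simp: adj_def)
qed

end

section \<open>Intersection matrices on flags\<close>

locale weighted_complex = regular_2_complex K for K :: "'a delta_data" +
  fixes \<alpha> :: "'a \<Rightarrow> 'a \<Rightarrow> int"
  assumes finite_vertices: "finite (vertices K)" and finite_edges: "finite (edges K)" and finite_facets: "finite (facets K)"
    and alpha: "\<And>e. e \<in> edges K \<Longrightarrow> \<alpha> (st e) e + \<alpha> (en e) e = int (card (facets_at K e))"
    and npp: "\<And>v. v \<in> vertices K \<Longrightarrow>
      no_positive_plane (edges_at K v) (\<lambda>e e'. real_of_int (local_intersection K \<alpha> v e e'))"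
begin

text \<open>The local intersection matrices of all vertices, assembled as diagonal blocks.\<close>

definition M :: "'a \<times> 'a \<Rightarrow> 'a \<times> 'a \<Rightarrow> real" where
  "M a b = (if fst a = fst b then real_of_int (local_intersection K \<alpha> (fst a) (snd a) (snd b)) else 0)"

definition row :: "('a \<times> 'a \<Rightarrow> real) \<Rightarrow> 'a \<times> 'a \<Rightarrow> real" where
  "row y a = (\<Sum>b\<in>flags. M a b * y b)"

lemma finite_flags: "finite flags"
proof -
  have "flags \<subseteq> vertices K \<times> edges K" using st_in en_in by (auto simp: flags_def)
  then show ?thesis using finite_vertices finite_edges finite_subset by blast
qed

lemma finite_edges_at: "finite (edges_at K v)"
  using finite_edges by (simp add: edges_at_eq)

lemma finite_facets_at: "finite (facets_at K e)"
  using finite_facets by (simp add: facets_at_eq)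

lemma M_sym: "M a b = M b a"
  by (simp add: M_def local_intersection_def Int_commute)

lemma M_nonneg: "a \<noteq> b \<Longrightarrow> 0 \<le> M a b"
  by (cases a; cases b) (simp add: M_def local_intersection_def)

lemma M_pos: "(a, b) \<in> adj \<Longrightarrow> a \<noteq> b \<Longrightarrow> 0 < M a b"
proof -
  assume "(a, b) \<in> adj" "a \<noteq> b"
  then obtain v e e' f where *: "a = (v, e)" "b = (v, e')" "f \<in> facets K" "e \<in> sides f" "e' \<in> sides f" "e \<noteq> e'"
    unfolding adj_def by blast
  then have "f \<in> facets_at K e \<inter> facets_at K e'" by (simp add: facets_at_sides)
  then have "0 < card (facets_at K e \<inter> facets_at K e')" using finite_facets_at card_gt_0_iff by blast
  then show ?thesis using * by (simp add: M_def local_intersection_def)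
qed

lemma M_nonzero:
  assumes "a \<in> flags" "b \<in> flags" "M a b \<noteq> 0"
  shows "a = b \<or> (a, b) \<in> adj"
proof (rule disjCI)
  assume na: "(a, b) \<notin> adj"
  obtain v e e' where ab: "a = (v, e)" "b = (v, e')" using assms(3) by (cases a; cases b) (auto simp: M_def split: if_splits)
  have "e = e'"
  proof (rule ccontr)
    assume ne: "e \<noteq> e'"
    then have "facets_at K e \<inter> facets_at K e' \<noteq> {}" using assms(3) ab by (auto simp: M_def local_intersection_def)
    then have "(a, b) \<in> adj" using assms(1,2) ab unfolding adj_def facets_at_sides by blast
    then show False using na by simp
  qed
  then show "a = b" using ab by simp
qed

lemma row_piece:
  assumes "a \<in> flags"
  shows "row y a = (\<Sum>b\<in>piece a. M a b * y b)"
  unfolding row_def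
proof (rule sum.mono_neutral_right[OF finite_flags piece_flags[OF assms]], rule ballI)
  fix b assume b: "b \<in> flags - piece a"
  then have "\<not> (a = b \<or> (a, b) \<in> adj)" using piece_self[of a] adj_piece[OF _ piece_self] by blast
  then have "M a b = 0" using M_nonzero[OF assms] b by blast
  then show "M a b * y b = 0" by simp
qed

text \<open>Off the diagonal the entries count common facets, so the sum over edges can be
  reorganised by the facets at \<open>e\<close>. Each inner sum has a single term, the other edge of
  the facet at \<open>v\<close>.\<close>

lemma row_eq:
  assumes a: "(v, e) \<in> flags"
  shows "row y (v, e) = - real_of_int (\<alpha> (other v e) e) * y (v, e) +
    (\<Sum>f\<in>facets_at K e. \<Sum>e'\<in>sides f \<inter> edges_at K v - {e}. y (v, e'))"
proof -
  let ?E = "edges_at K v"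
  have e: "e \<in> ?E" using a by (simp add: flags_iff)
  have "row y (v, e) = (\<Sum>b\<in>Pair v ` ?E. M (v, e) b * y b)"
    unfolding row_def by (rule sum.mono_neutral_right[OF finite_flags]) (auto simp: flags_iff M_def)
  also have "\<dots> = (\<Sum>e'\<in>?E. real_of_int (local_intersection K \<alpha> v e e') * y (v, e'))"
    by (subst sum.reindex) (auto simp: inj_on_def M_def)
  also have "\<dots> = real_of_int (local_intersection K \<alpha> v e e) * y (v, e) +
      (\<Sum>e'\<in>?E - {e}. real_of_int (local_intersection K \<alpha> v e e') * y (v, e'))"
    by (rule sum.remove[OF finite_edges_at e])
  also have "local_intersection K \<alpha> v e e = - \<alpha> (other v e) e"
    by (simp add: local_intersection_def other_endpoint_eq[OF a])
  also have "(\<Sum>e'\<in>?E - {e}. real_of_int (local_intersection K \<alpha> v e e') * y (v, e')) =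
      (\<Sum>e'\<in>?E - {e}. real (card (facets_at K e \<inter> facets_at K e')) * y (v, e'))"
    by (rule sum.cong[OF refl]) (auto simp: local_intersection_def)
  also have "(\<Sum>e'\<in>?E - {e}. real (card (facets_at K e \<inter> facets_at K e')) * y (v, e')) =
      (\<Sum>e'\<in>?E - {e}. \<Sum>f\<in>{f \<in> facets_at K e. e' \<in> sides f}. y (v, e'))"
  proof (rule sum.cong[OF refl])
    fix e' assume "e' \<in> ?E - {e}"
    have "facets_at K e \<inter> facets_at K e' = {f \<in> facets_at K e. e' \<in> sides f}"
      unfolding facets_at_sides by blast
    then show "real (card (facets_at K e \<inter> facets_at K e')) * y (v, e') = (\<Sum>f\<in>{f \<in> facets_at K e. e' \<in> sides f}. y (v, e'))"
      by (simp only: sum_constant)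
  qed
  also have "\<dots> = (\<Sum>f\<in>facets_at K e. \<Sum>e'\<in>{e' \<in> ?E - {e}. e' \<in> sides f}. y (v, e'))"
    by (rule sum.swap_restrict) (use finite_edges_at finite_facets_at in auto)
  also have "\<dots> = (\<Sum>f\<in>facets_at K e. \<Sum>e'\<in>sides f \<inter> ?E - {e}. y (v, e'))"
    by (intro sum.cong) auto
  finally show ?thesis by simp
qed

text \<open>To the difference of the two sides every facet at \<open>e\<close> contributes
  \<open>c e\<close>, in total deg(e) times \<open>c e\<close>, and the diagonal entries contribute
  minus the sum of the two structure constants times \<open>c e\<close>. The condition on structure
  constants makes this 0.\<close>

lemma row_symmetric:
  assumes e: "e \<in> edges K" and c: "\<And>f. f \<in> facets_at K e \<Longrightarrow> closed_at c f"
  shows "row (oriented c) (st e, e) = row (oriented c) (en e, e)"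
proof -
  have fl: "(st e, e) \<in> flags" "(en e, e) \<in> flags" using e by (auto simp: flags_def)
  have ne: "st e \<noteq> en e" using e by (rule st_neq_en)
  have o: "other (st e) e = en e" "other (en e) e = st e" using ne by (auto simp: other_def)
  have x: "oriented c (st e, e) = c e" "oriented c (en e, e) = - c e" using ne by (auto simp: oriented_def)
  let ?a = "\<lambda>f. \<Sum>e'\<in>sides f \<inter> edges_at K (st e) - {e}. oriented c (st e, e')"
  let ?b = "\<lambda>f. \<Sum>e'\<in>sides f \<inter> edges_at K (en e) - {e}. oriented c (en e, e')"
  have "?a f - ?b f = c e" if fe: "f \<in> facets_at K e" for f
  proof -
    have f: "f \<in> facets K" "e \<in> sides f" using fe by (auto simp: facets_at_sides)
    obtain e' e'' where *: "sides f \<inter> edges_at K (st e) - {e} = {e'}" "sides f \<inter> edges_at K (en e) - {e} = {e''}"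
      "oriented c (st e, e') - oriented c (en e, e'') = c e"
      using opposite_corner[OF f] c[OF fe] by blast
    show ?thesis unfolding * using *(3) by simp
  qed
  then have "(\<Sum>f\<in>facets_at K e. ?a f - ?b f) = real (card (facets_at K e)) * c e" by simp
  then have 1: "(\<Sum>f\<in>facets_at K e. ?a f) - (\<Sum>f\<in>facets_at K e. ?b f) = real (card (facets_at K e)) * c e"
    by (simp only: sum_subtractf)
  have 2: "real (card (facets_at K e)) = real_of_int (\<alpha> (st e) e) + real_of_int (\<alpha> (en e) e)"
    using alpha[OF e] by (metis of_int_add of_int_of_nat_eq)
  show ?thesis unfolding row_eq[OF fl(1)] row_eq[OF fl(2)] o x using 1 unfolding 2 by (simp add: algebra_simps)
qed

lemma sum_flags: "(\<Sum>a\<in>flags. g a) = (\<Sum>e\<in>edges K. g (st e, e) + g (en e, e))"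
proof -
  have "(\<Sum>a\<in>flags. g a) = (\<Sum>a\<in>(SIGMA v:vertices K. {e \<in> edges K. st e = v \<or> en e = v}). g a)"
    by (rule sum.cong) (use st_in en_in in \<open>auto simp: flags_def\<close>)
  also have "\<dots> = (\<Sum>v\<in>vertices K. \<Sum>e\<in>{e \<in> edges K. st e = v \<or> en e = v}. g (v, e))"
    by (subst sum.Sigma) (use finite_vertices finite_edges in auto)
  also have "\<dots> = (\<Sum>e\<in>edges K. \<Sum>v\<in>{v \<in> vertices K. st e = v \<or> en e = v}. g (v, e))"
    by (rule sum.swap_restrict[OF finite_vertices finite_edges])
  also have "\<dots> = (\<Sum>e\<in>edges K. g (st e, e) + g (en e, e))"
  proof (rule sum.cong[OF refl])
    fix e assume e: "e \<in> edges K"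
    have "{v \<in> vertices K. st e = v \<or> en e = v} = {st e, en e}" using st_in[OF e] en_in[OF e] by auto
    then show "(\<Sum>v\<in>{v \<in> vertices K. st e = v \<or> en e = v}. g (v, e)) = g (st e, e) + g (en e, e)"
      using st_neq_en[OF e] by simp
  qed
  finally show ?thesis .
qed

text \<open>At the two ends of an edge the rows agree while the outward values are opposite.\<close>

lemma total_zero:
  assumes c: "\<And>f. f \<in> facets K \<Longrightarrow> closed_at c f"
  shows "(\<Sum>a\<in>flags. oriented c a * row (oriented c) a) = 0"
proof -
  have "oriented c (st e, e) * row (oriented c) (st e, e) + oriented c (en e, e) * row (oriented c) (en e, e) = 0"
    if e: "e \<in> edges K" for e
  proof -
    have "row (oriented c) (st e, e) = row (oriented c) (en e, e)"
      using e by (rule row_symmetric) (use c in \<open>simp add: facets_at_sides\<close>)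
    moreover have "oriented c (en e, e) = - oriented c (st e, e)"
      using st_neq_en[OF e] by (simp add: oriented_def)
    ultimately show ?thesis by simp
  qed
  then show ?thesis unfolding sum_flags by simp
qed

section \<open>Components of links and their forms\<close>

definition pieces :: "('a \<times> 'a) set set" where "pieces = piece ` flags"

lemma sum_pieces: "(\<Sum>a\<in>flags. g a) = (\<Sum>p\<in>pieces. \<Sum>a\<in>p. g a)"
proof -
  have U: "\<Union> pieces = flags" using piece_flags piece_self by (auto simp: pieces_def)
  have "sum g (\<Union> pieces) = (sum \<circ> sum) g pieces"
  proof (rule sum.Union_disjoint)
    show "\<forall>A\<in>pieces. finite A" unfolding pieces_def using finite_subset[OF piece_flags finite_flags] by blast
    show "\<forall>A\<in>pieces. \<forall>B\<in>pieces. A \<noteq> B \<longrightarrow> A \<inter> B = {}" using piece_eq unfolding pieces_def by blast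
  qed
  then show ?thesis by (simp add: U)
qed

lemma piece_no_positive_plane:
  assumes "a \<in> flags"
  shows "no_positive_plane (piece a) M"
proof -
  let ?v = "fst a"
  have v: "?v \<in> vertices K" using assms st_in en_in by (auto simp: flags_def)
  have "no_positive_plane (edges_at K ?v) (\<lambda>e e'. M (?v, e) (?v, e'))"
    using npp[OF v] by (simp add: M_def)
  then have "no_positive_plane (Pair ?v ` edges_at K ?v) M"
    by (rule no_positive_plane_reindex) (simp add: inj_on_def)
  moreover have "piece a \<subseteq> Pair ?v ` edges_at K ?v"
  proof
    fix b assume b: "b \<in> piece a"
    then have "b \<in> flags" "fst b = ?v" using piece_flags[OF assms] piece_fst by auto
    then show "b \<in> Pair ?v ` edges_at K ?v" by (cases b) (auto simp: flags_iff)
  qed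
  ultimately show ?thesis by (rule no_positive_plane_subset) (simp add: finite_edges_at)
qed

text \<open>Irreducibility of \<open>M\<close> on a piece, in the form that the maximum principle
  requires.\<close>

lemma piece_connected:
  assumes a: "a \<in> flags" and A: "A \<subseteq> piece a" "A \<noteq> {}"
    and closed: "\<And>i j. i \<in> A \<Longrightarrow> j \<in> piece a \<Longrightarrow> i \<noteq> j \<Longrightarrow> 0 < M i j \<Longrightarrow> j \<in> A"
  shows "A = piece a"
proof -
  obtain b where b: "b \<in> A" using A by blast
  then have pb: "piece b = piece a" using A piece_eq by blast
  have "x \<in> A" if "x \<in> piece b" for x
  proof -
    have "(b, x) \<in> adj\<^sup>*" using that by (simp add: piece_def)
    then show ?thesis
    proof (induction rule: rtrancl_induct)
      case base
      show ?case by (rule b)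
    next
      case (step y z)
      show ?case
      proof (cases "y = z")
        case False
        have "z \<in> piece a" using adj_piece[OF step(2)] step(3) A by blast
        then show ?thesis using closed[OF step(3) _ False M_pos[OF step(2) False]] by blast
      qed (use step in simp)
    qed
  qed
  then show ?thesis using A pb by blast
qed

text \<open>The last clause is a maximum principle: nonzero kernel vectors on the hyperplane do not have constant sign.\<close>

definition controls :: "('a \<times> 'a) set \<Rightarrow> ('a \<times> 'a \<Rightarrow> real) \<Rightarrow> bool" where
  "controls p l \<longleftrightarrow>
    (\<forall>y. (\<Sum>a\<in>p. l a * y a) = 0 \<longrightarrow> quadratic p M y y \<le> 0 \<and>
      (quadratic p M y y = 0 \<longrightarrow> (\<forall>a\<in>p. (\<Sum>b\<in>p. M a b * y b) = 0)) \<and>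
      ((\<forall>a\<in>p. (\<Sum>b\<in>p. M a b * y b) = 0) \<longrightarrow> (\<forall>a\<in>p. y a \<le> 0) \<longrightarrow> (\<forall>a\<in>p. y a = 0)))"

lemma controls_exists:
  assumes "p \<in> pieces"
  shows "\<exists>l. controls p l"
proof -
  obtain a where a: "a \<in> flags" "p = piece a" using assms by (auto simp: pieces_def)
  have fin: "finite p" using a finite_flags piece_flags finite_subset by blast
  show ?thesis
  proof (rule no_positive_plane_functional[OF fin M_sym piece_no_positive_plane[OF a(1), folded a(2)]])
    fix l
    assume l:
      "\<And>y. (\<Sum>i\<in>p. l i * y i) = 0 \<Longrightarrow> quadratic p M y y \<le> 0"
      "\<And>y i. (\<Sum>i\<in>p. l i * y i) = 0 \<Longrightarrow> quadratic p M y y = 0 \<Longrightarrow> i \<in> p \<Longrightarrow> (\<Sum>j\<in>p. M i j * y j) = 0"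
      "\<And>y i. (\<And>i j. i \<in> p \<Longrightarrow> j \<in> p \<Longrightarrow> i \<noteq> j \<Longrightarrow> 0 \<le> M i j) \<Longrightarrow>
        (\<And>A. A \<subseteq> p \<Longrightarrow> A \<noteq> {} \<Longrightarrow> (\<And>i j. i \<in> A \<Longrightarrow> j \<in> p \<Longrightarrow> i \<noteq> j \<Longrightarrow> 0 < M i j \<Longrightarrow> j \<in> A) \<Longrightarrow> A = p) \<Longrightarrow>
        (\<Sum>i\<in>p. l i * y i) = 0 \<Longrightarrow> (\<And>i. i \<in> p \<Longrightarrow> (\<Sum>j\<in>p. M i j * y j) = 0) \<Longrightarrow>
        (\<And>i. i \<in> p \<Longrightarrow> y i \<le> 0) \<Longrightarrow> i \<in> p \<Longrightarrow> y i = 0"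
    have conn: "A = p" if "A \<subseteq> p" "A \<noteq> {}" "\<And>i j. i \<in> A \<Longrightarrow> j \<in> p \<Longrightarrow> i \<noteq> j \<Longrightarrow> 0 < M i j \<Longrightarrow> j \<in> A" for A
      using piece_connected[OF a(1), of A] that unfolding a(2)[symmetric] by blast
    have 3: "y i = 0" if "(\<Sum>i\<in>p. l i * y i) = 0" "\<forall>a\<in>p. (\<Sum>b\<in>p. M a b * y b) = 0" "\<forall>a\<in>p. y a \<le> 0" "i \<in> p" for y i
      by (rule l(3)[OF _ conn]) (use that M_nonneg in auto)
    show ?thesis unfolding controls_def
      by (intro exI[of _ l] allI impI conjI ballI) (use l(1,2) 3 in blast)+
  qed
qed

end

section \<open>Cochains on a surface with fins\<close>

text \<open>The combinatorial content of a decomposition. The manifold is represented by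
  \<open>link\<close>, \<open>graph\<close> and \<open>degree\<close>; \<open>covered\<close>
  reflects that ornaments share no edge with the rest; \<open>pv\<close> and \<open>pe\<close> list
  the vertices and edges of the paths.\<close>

locale finned_surface = weighted_complex K \<alpha> for K :: "'a delta_data" and \<alpha> +
  fixes S0 S1 S2 :: "'a set" and I :: "nat set" and F0 F1 F2 :: "nat \<Rightarrow> 'a set" and pv pe :: "nat \<Rightarrow> 'a list"
  assumes S_sub: "S0 \<subseteq> vertices K" "S1 \<subseteq> edges K" "S2 \<subseteq> facets K"
    and S_edge: "\<And>e. e \<in> S1 \<Longrightarrow> st e \<in> S0 \<and> en e \<in> S0"
    and S_facet: "\<And>f. f \<in> S2 \<Longrightarrow> sides f \<subseteq> S1"
    and F_sub: "\<And>i. i \<in> I \<Longrightarrow> F1 i \<subseteq> edges K \<and> F2 i \<subseteq> facets K"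
    and F_edge: "\<And>i e. i \<in> I \<Longrightarrow> e \<in> F1 i \<Longrightarrow> st e \<in> F0 i \<and> en e \<in> F0 i"
    and F_facet: "\<And>i f. i \<in> I \<Longrightarrow> f \<in> F2 i \<Longrightarrow> sides f \<subseteq> F1 i"
    and F_disjoint: "\<And>i j. i \<in> I \<Longrightarrow> j \<in> I \<Longrightarrow> i \<noteq> j \<Longrightarrow> F1 i \<inter> F1 j = {}"
    and F_order: "\<And>i j. i \<in> I \<Longrightarrow> j \<in> I \<Longrightarrow> j < i \<Longrightarrow> F0 j \<inter> F0 i \<subseteq> {hd (pv i), last (pv i)}"
    and covered: "\<And>f e. f \<in> facets K \<Longrightarrow> e \<in> sides f \<Longrightarrow> e \<in> S1 \<union> (\<Union>i\<in>I. F1 i) \<Longrightarrow> f \<in> S2 \<union> (\<Union>i\<in>I. F2 i)"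
    and path_length: "\<And>i. i \<in> I \<Longrightarrow> length (pv i) = Suc (length (pe i))"
    and path_distinct: "\<And>i. i \<in> I \<Longrightarrow> distinct (pv i)"
    and path_sets: "\<And>i. i \<in> I \<Longrightarrow> F0 i \<inter> S0 = set (pv i)" "\<And>i. i \<in> I \<Longrightarrow> F1 i \<inter> S1 = set (pe i)"
      "\<And>i. i \<in> I \<Longrightarrow> F2 i \<inter> S2 = {}"
    and path_edge: "\<And>i j. i \<in> I \<Longrightarrow> j < length (pe i) \<Longrightarrow> {st (pe i ! j), en (pe i ! j)} = {pv i ! j, pv i ! Suc j}"
    and link: "\<And>v C. v \<in> S0 \<Longrightarrow> C \<subseteq> {e \<in> S1. (v, e) \<in> flags} \<Longrightarrow> C \<noteq> {} \<Longrightarrow>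
      (\<And>f e e'. f \<in> S2 \<Longrightarrow> e \<in> sides f \<Longrightarrow> e \<in> C \<Longrightarrow> e' \<in> sides f \<Longrightarrow> (v, e') \<in> flags \<Longrightarrow> e' \<in> C) \<Longrightarrow>
      C = {e \<in> S1. (v, e) \<in> flags}"
    and graph: "\<And>A. A \<subseteq> S0 \<Longrightarrow> A \<noteq> {} \<Longrightarrow> (\<And>e. e \<in> S1 \<Longrightarrow> st e \<in> A \<longleftrightarrow> en e \<in> A) \<Longrightarrow> A = S0"
    and degree: "\<And>e. e \<in> S1 \<Longrightarrow> card {f \<in> S2. e \<in> sides f} = 2"
    and chi: "card S0 + card S2 < card S1"
begin

text \<open>\<open>X\<close> consists of the flags that can be reached from the surface without crossing a vertex from one
  piece of its link to another; the cochain below vanishes off \<open>X\<close>.\<close>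

definition SF :: "('a \<times> 'a) set" where "SF = {a \<in> flags. snd a \<in> S1}"
definition step :: "(('a \<times> 'a) \<times> ('a \<times> 'a)) set" where "step = adj \<union> {(a, opp a) | a. a \<in> flags}"
definition X :: "('a \<times> 'a) set" where "X = step\<^sup>* `` SF"
definition fin_of :: "'a \<Rightarrow> nat" where "fin_of e = (THE i. i \<in> I \<and> e \<in> F1 i)"
definition surf :: "('a \<times> 'a) set \<Rightarrow> bool" where "surf p \<longleftrightarrow> p \<inter> SF \<noteq> {}"

lemma fin_of: "i \<in> I \<Longrightarrow> e \<in> F1 i \<Longrightarrow> fin_of e = i"
  unfolding fin_of_def using F_disjoint by (intro the_equality) blast+

lemma sym_step: "sym step"
proof (rule symI)
  fix a b assume "(a, b) \<in> step"
  then show "(b, a) \<in> step"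
    using sym_adj opp_in opp_opp unfolding step_def by (fastforce dest: symD)
qed

lemma SF_X: "SF \<subseteq> X" by (auto simp: X_def)

lemma X_step: "a \<in> X \<Longrightarrow> (a, b) \<in> step \<Longrightarrow> b \<in> X"
  unfolding X_def by (auto intro: rtrancl_into_rtrancl)

lemma X_adj: "a \<in> X \<Longrightarrow> (a, b) \<in> adj \<Longrightarrow> b \<in> X"
  using X_step by (auto simp: step_def)

lemma X_flags: "a \<in> X \<Longrightarrow> a \<in> flags"
proof -
  assume "a \<in> X"
  then obtain s where s: "s \<in> SF" "(s, a) \<in> step\<^sup>*" by (auto simp: X_def)
  show ?thesis using s(2)
  proof (induction rule: rtrancl_induct)
    case base
    then show ?case using s(1) by (simp add: SF_def)
  next
    case (step b c)
    then have "(b, c) \<in> adj \<or> c = opp b" by (auto simp: step_def)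
    then show ?case using adj_flags[of b c] opp_in[of b] step(3) by blast
  qed
qed

lemma step_opp: "a \<in> flags \<Longrightarrow> (a, opp a) \<in> step"
  unfolding step_def by blast

lemma X_opp: "a \<in> X \<Longrightarrow> opp a \<in> X"
  by (rule X_step[OF _ step_opp]) (auto dest: X_flags)

lemma X_piece: "a \<in> X \<Longrightarrow> b \<in> piece a \<Longrightarrow> b \<in> X"
proof -
  assume a: "a \<in> X" "b \<in> piece a"
  then have "(a, b) \<in> adj\<^sup>*" by (simp add: piece_def)
  then show ?thesis by (induction rule: rtrancl_induct) (use a X_adj in auto)
qed

lemma X_edge: "(v, e) \<in> X \<Longrightarrow> (v', e) \<in> flags \<Longrightarrow> (v', e) \<in> X"
proof -
  assume a: "(v, e) \<in> X" "(v', e) \<in> flags"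
  have "(v', e) = (v, e) \<or> (v', e) = opp (v, e)"
    using X_flags[OF a(1)] a(2) by (auto simp: flags_def opp_def other_def)
  then show ?thesis using a(1) X_opp[OF a(1)] by auto
qed

lemma sides_meet:
  assumes "f \<in> facets K" "e \<in> sides f" "e' \<in> sides f"
  shows "\<exists>u. (u, e) \<in> flags \<and> (u, e') \<in> flags"
  using assms corner[OF assms(1)] side_in[OF assms(1), of 0] side_in[OF assms(1), of 1] side_in[OF assms(1), of 2]
  unfolding flags_def by auto

lemma X_facet:
  assumes "f \<in> facets K" "e \<in> sides f" "(v, e) \<in> X" "e' \<in> sides f" "(v', e') \<in> flags"
  shows "(v', e') \<in> X"
proof -
  obtain u where u: "(u, e) \<in> flags" "(u, e') \<in> flags" using sides_meet assms by blast
  have "(u, e) \<in> X" using assms(3) u(1) by (rule X_edge)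
  moreover have "((u, e), (u, e')) \<in> adj" using u assms unfolding adj_def by blast
  ultimately have "(u, e') \<in> X" by (rule X_adj)
  then show ?thesis using assms(5) by (rule X_edge)
qed

lemma adj_cases:
  assumes "(a, b) \<in> adj" "snd a \<in> S1 \<union> (\<Union>i\<in>I. F1 i)"
  shows "(snd a \<in> S1 \<and> snd b \<in> S1) \<or> (\<exists>i\<in>I. snd a \<in> F1 i \<and> snd b \<in> F1 i)"
proof -
  obtain f where f: "f \<in> facets K" "snd a \<in> sides f" "snd b \<in> sides f" using assms(1) unfolding adj_def by force
  then have "f \<in> S2 \<union> (\<Union>i\<in>I. F2 i)" using covered assms(2) by blast
  then show ?thesis using f S_facet F_facet by blast
qed

lemma X_cover: "a \<in> X \<Longrightarrow> snd a \<in> S1 \<union> (\<Union>i\<in>I. F1 i)"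
proof -
  assume "a \<in> X"
  then obtain s where s: "s \<in> SF" "(s, a) \<in> step\<^sup>*" by (auto simp: X_def)
  show ?thesis using s(2)
  proof (induction rule: rtrancl_induct)
    case base
    then show ?case using s(1) by (simp add: SF_def)
  next
    case (step b c)
    show ?case
    proof (cases "(b, c) \<in> adj")
      case True
      then show ?thesis using adj_cases[OF True step(3)] by blast
    next
      case False
      then have "c = opp b" using step(2) by (auto simp: step_def)
      then show ?thesis using step(3) by (simp add: opp_def)
    qed
  qed
qed

lemma surf_SF: "a \<in> SF \<Longrightarrow> surf (piece a)"
  using piece_self[of a] by (auto simp: surf_def)

text \<open>Adjacent flags share a facet of the surface or of a fin. Away from the surface the steps
  therefore stay in a fin, and in the same one since distinct fins share no edge.\<close>

lemma non_surf_piece: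
  assumes "i \<in> I" "snd a \<in> F1 i" "\<not> surf (piece a)" "a \<in> flags" "b \<in> piece a"
  shows "snd b \<in> F1 i \<and> snd b \<notin> S1"
proof -
  have n: "snd c \<notin> S1" if "c \<in> piece a" for c
    using that assms(3) piece_flags[OF assms(4)] by (auto simp: surf_def SF_def)
  have "(a, b) \<in> adj\<^sup>*" using assms(5) by (simp add: piece_def)
  then show ?thesis
  proof (induction rule: rtrancl_induct)
    case base
    then show ?case using assms(2) n piece_self by blast
  next
    case (step c d)
    have d: "d \<in> piece a" using step(1,2) by (simp add: piece_def)
    have "(snd c \<in> S1 \<and> snd d \<in> S1) \<or> (\<exists>j\<in>I. snd c \<in> F1 j \<and> snd d \<in> F1 j)"
      using adj_cases[OF step(2)] step(3) assms(1) by blast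
    then obtain j where "j \<in> I" "snd c \<in> F1 j" "snd d \<in> F1 j" using step(3) by blast
    moreover have "j = i" using F_disjoint[OF \<open>j \<in> I\<close> assms(1)] step(3) calculation by blast
    ultimately show ?case using n[OF d] by simp
  qed
qed

text \<open>The link of \<open>v\<close> in the surface is connected, so its flags lie in one
  component of the full link. Hence the surface costs at most one equation per vertex.\<close>

lemma S_piece:
  assumes "(v, e) \<in> SF" "(v, e') \<in> SF"
  shows "piece (v, e) = piece (v, e')"
proof -
  define C where "C = {e'' \<in> S1. (v, e'') \<in> flags \<and> piece (v, e'') = piece (v, e)}"
  have v: "v \<in> S0" using assms(1) S_edge by (auto simp: SF_def flags_def)
  have "C = {e \<in> S1. (v, e) \<in> flags}"
  proof (rule link[OF v])
    show "C \<noteq> {}" using assms(1) by (auto simp: C_def SF_def)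
    fix f d d' assume f: "f \<in> S2" "d \<in> sides f" "d \<in> C" "d' \<in> sides f" "(v, d') \<in> flags"
    have "((v, d), (v, d')) \<in> adj" using f S_sub unfolding adj_def C_def by blast
    from adj_piece_eq[OF this] show "d' \<in> C" using f S_facet[OF f(1)] by (auto simp: C_def)
  qed (auto simp: C_def)
  then show ?thesis using assms(2) by (auto simp: C_def SF_def)
qed

section \<open>Potentials and cochains on fins\<close>

definition potential_at :: "('a \<Rightarrow> real) \<Rightarrow> nat \<Rightarrow> nat \<Rightarrow> real" where
  "potential_at c i n = (\<Sum>j<n. oriented c (pv i ! j, pe i ! j))"

text \<open>The integral from the first vertex of the path to \<open>u\<close>; the index is unique
  as the vertices of the path are distinct.\<close>

definition potential :: "('a \<Rightarrow> real) \<Rightarrow> nat \<Rightarrow> 'a \<Rightarrow> real" where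
  "potential c i u = potential_at c i (THE n. n < length (pv i) \<and> pv i ! n = u)"

lemma potential_nth:
  assumes "i \<in> I" "n < length (pv i)"
  shows "potential c i (pv i ! n) = potential_at c i n"
proof -
  have "(THE n'. n' < length (pv i) \<and> pv i ! n' = pv i ! n) = n"
    using assms path_distinct[OF assms(1)] by (intro the_equality) (auto simp: nth_eq_iff_index_eq)
  then show ?thesis by (simp add: potential_def)
qed

lemma potential_edge:
  assumes i: "i \<in> I" and e: "e \<in> set (pe i)"
  shows "c e = potential c i (en e) - potential c i (st e)"
proof -
  obtain j where j: "j < length (pe i)" "e = pe i ! j" using e by (auto simp: in_set_conv_nth)
  have len: "j < length (pv i)" "Suc j < length (pv i)" using j path_length[OF i] by auto
  have "e \<in> edges K" using e path_sets(2)[OF i] S_sub by blast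
  then have ne: "st e \<noteq> en e" by (rule st_neq_en)
  have d: "potential_at c i (Suc j) = potential_at c i j + oriented c (pv i ! j, e)"
    by (simp add: potential_at_def j)
  have "{st e, en e} = {pv i ! j, pv i ! Suc j}" using path_edge[OF i j(1)] j(2) by simp
  then consider "st e = pv i ! j" "en e = pv i ! Suc j" | "st e = pv i ! Suc j" "en e = pv i ! j"
    by (auto simp: doubleton_eq_iff)
  then show ?thesis
  proof cases
    case 1
    then have "oriented c (pv i ! j, e) = c e" by (simp add: oriented_def)
    then show ?thesis unfolding 1 potential_nth[OF i len(1)] potential_nth[OF i len(2)] d by simp
  next
    case 2
    then have "oriented c (pv i ! j, e) = - c e" using ne by (simp add: oriented_def)
    then show ?thesis unfolding 2 potential_nth[OF i len(1)] potential_nth[OF i len(2)] d by simp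
  qed
qed

lemma potential_zero:
  assumes "i \<in> I" "u \<in> set (pv i)" "\<And>e. e \<in> set (pe i) \<Longrightarrow> c e = 0"
  shows "potential c i u = 0"
proof -
  obtain n where n: "n < length (pv i)" "u = pv i ! n" using assms(2) by (auto simp: in_set_conv_nth)
  have "potential_at c i n = 0"
    unfolding potential_at_def
  proof (rule sum.neutral, rule ballI)
    fix j assume "j \<in> {..<n}"
    then have "j < length (pe i)" using n path_length[OF assms(1)] by simp
    then show "oriented c (pv i ! j, pe i ! j) = 0" using assms(3) by (simp add: oriented_def)
  qed
  then show ?thesis using potential_nth[OF assms(1) n(1)] n(2) by simp
qed

text \<open>A coordinate vector \<open>z\<close> assigns a value to every edge of the surface and to every piece
  containing no surface edge.  On a fin \<open>cochain z\<close> is the coboundary of a potential that takes a value on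
  every piece, so that passing from one piece of a link to another may change the value; on the pieces
  meeting the surface it is the integral of the surface values along the path.\<close>

definition surface_part :: "('a + ('a \<times> 'a) set \<Rightarrow> real) \<Rightarrow> 'a \<Rightarrow> real" where
  "surface_part z e = (if e \<in> S1 then z (Inl e) else 0)"

definition val :: "('a + ('a \<times> 'a) set \<Rightarrow> real) \<Rightarrow> nat \<Rightarrow> 'a \<times> 'a \<Rightarrow> real" where
  "val z i a = (if surf (piece a) then potential (surface_part z) i (fst a) else z (Inr (piece a)))"

definition cochain :: "('a + ('a \<times> 'a) set \<Rightarrow> real) \<Rightarrow> 'a \<Rightarrow> real" where
  "cochain z e = (if e \<in> S1 then z (Inl e) else if (st e, e) \<in> X
     then val z (fin_of e) (en e, e) - val z (fin_of e) (st e, e) else 0)"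

lemma cochain_surface: "e \<in> S1 \<Longrightarrow> cochain z e = surface_part z e"
  by (simp add: cochain_def surface_part_def)

text \<open>The formula also covers path edges: both their flags lie in pieces meeting the surface,
  where \<open>val\<close> is the integral of the surface values.\<close>

lemma cochain_fin:
  assumes "i \<in> I" "e \<in> F1 i" "(st e, e) \<in> X"
  shows "cochain z e = val z i (en e, e) - val z i (st e, e)"
proof (cases "e \<in> S1")
  case True
  then have "(st e, e) \<in> SF" "(en e, e) \<in> SF" using S_sub by (auto simp: SF_def flags_def)
  then have "val z i (en e, e) - val z i (st e, e) =
      potential (surface_part z) i (en e) - potential (surface_part z) i (st e)"
    using surf_SF by (simp add: val_def)
  also have "\<dots> = surface_part z e"
    by (rule potential_edge[symmetric, OF assms(1)]) (use True assms path_sets(2) in blast)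
  finally show ?thesis using cochain_surface[OF True] by simp
next
  case False
  then show ?thesis using assms fin_of by (simp add: cochain_def)
qed

lemma oriented_cochain_fin:
  assumes "i \<in> I" "snd a \<in> F1 i" "a \<in> X"
  shows "oriented (cochain z) a = val z i (opp a) - val z i a"
proof -
  obtain v e where a: "a = (v, e)" by (cases a)
  have fl: "(v, e) \<in> flags" using X_flags assms(3) a by blast
  then have "(st e, e) \<in> X" using X_edge[of v e "st e"] assms(3) a by (auto simp: flags_def)
  from cochain_fin[OF assms(1) _ this] have c: "cochain z e = val z i (en e, e) - val z i (st e, e)"
    using assms(2) a by simp
  have "st e \<noteq> en e" using fl by (intro st_neq_en) (auto simp: flags_def)
  then show ?thesis using c fl unfolding a by (auto simp: oriented_def opp_def other_def flags_def)
qed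

lemma val_adj: "(a, b) \<in> adj \<Longrightarrow> val z i a = val z i b"
  using adj_piece_eq[of a b] by (auto simp: val_def adj_def)

text \<open>The two flags at a corner of a facet are adjacent and carry a common potential, so on a
  fin facet the cochain is a coboundary. On a facet without flags in \<open>X\<close> the cochain is
  zero.\<close>

lemma closed_cochain:
  assumes f: "f \<in> facets K" and c: "\<And>f. f \<in> S2 \<Longrightarrow> closed_at (cochain z) f"
  shows "closed_at (cochain z) f"
proof (cases "\<exists>e\<in>sides f. (st e, e) \<in> X")
  case False
  have "cochain z e = 0" if "e \<in> sides f" for e
  proof -
    have "e \<in> edges K" using f that by (rule sides_in)
    then have "(st e, e) \<in> flags" by (simp add: flags_def)
    then have "e \<notin> S1" using False that SF_X by (auto simp: SF_def)
    then show ?thesis using False that by (auto simp: cochain_def)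
  qed
  then show ?thesis by (simp add: closed_at_def)
next
  case True
  then obtain e where e: "e \<in> sides f" "(st e, e) \<in> X" by blast
  have "e \<in> S1 \<union> (\<Union>i\<in>I. F1 i)" using X_cover[OF e(2)] by simp
  then have "f \<in> S2 \<union> (\<Union>i\<in>I. F2 i)" using covered f e(1) by blast
  then show ?thesis
  proof
    assume "f \<in> S2"
    then show ?thesis by (rule c)
  next
    assume "f \<in> (\<Union>i\<in>I. F2 i)"
    then obtain i where i: "i \<in> I" "f \<in> F2 i" by blast
    have sF: "sides f \<subseteq> F1 i" using F_facet[OF i] .
    have inX: "(v, e') \<in> X" if "e' \<in> sides f" "(v, e') \<in> flags" for v e'
      using X_facet[OF f e that] .
    have val: "cochain z e' = val z i (en e', e') - val z i (st e', e')" if "e' \<in> sides f" for e'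
    proof (rule cochain_fin[OF i(1)])
      show "e' \<in> F1 i" using that sF by blast
      have "e' \<in> edges K" using f that by (rule sides_in)
      then show "(st e', e') \<in> X" using that by (intro inX) (auto simp: flags_def)
    qed
    have glue: "val z i (v, e') = val z i (v, e'')"
      if "e' \<in> sides f" "e'' \<in> sides f" "(v, e') \<in> flags" "(v, e'') \<in> flags" for v e' e''
      by (rule val_adj) (use that f in \<open>unfold adj_def, blast\<close>)
    note co = corner[OF f]
    have E: "sd 0 f \<in> edges K" "sd 1 f \<in> edges K" "sd 2 f \<in> edges K" using side_in[OF f] by auto
    have "val z i (en (sd 0 f), sd 0 f) = val z i (en (sd 0 f), sd 1 f)"
      by (rule glue) (use E co in \<open>auto simp: flags_def\<close>)
    moreover have "val z i (st (sd 0 f), sd 0 f) = val z i (st (sd 0 f), sd 2 f)"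
      by (rule glue) (use E co in \<open>auto simp: flags_def\<close>)
    moreover have "val z i (st (sd 1 f), sd 1 f) = val z i (st (sd 1 f), sd 2 f)"
      by (rule glue) (use E co in \<open>auto simp: flags_def\<close>)
    ultimately show ?thesis
      unfolding closed_at_def using val[of "sd 0 f"] val[of "sd 1 f"] val[of "sd 2 f"] co by simp
  qed
qed

lemma linear_oriented:
  assumes "\<And>e. linear_functional (\<lambda>z. c z e)"
  shows "linear_functional (\<lambda>z. oriented (c z) a)"
  unfolding oriented_def by (intro linear_functional_if linear_functional_minus assms)

lemma linear_surface_part: "linear_functional (\<lambda>z. surface_part z e)"
  unfolding surface_part_def by (intro linear_functional_if linear_functional_eval linear_functional_const_zero)

lemma linear_val: "linear_functional (\<lambda>z. val z i a)"
  unfolding val_def potential_def potential_at_def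
  by (intro linear_functional_if linear_functional_sum linear_oriented linear_surface_part linear_functional_eval)

lemma linear_cochain: "linear_functional (\<lambda>z. cochain z e)"
  unfolding cochain_def
  by (intro linear_functional_if linear_functional_eval linear_functional_diff linear_val linear_functional_const_zero)

section \<open>Solving the linear system\<close>

definition L :: "('a \<times> 'a) set \<Rightarrow> 'a \<times> 'a \<Rightarrow> real" where "L p = (SOME l. controls p l)"

lemma L: "p \<in> pieces \<Longrightarrow> controls p (L p)"
  unfolding L_def using controls_exists by (rule someI_ex)

text \<open>The pieces of \<open>X\<close> that miss the surface give both unknowns and equations,
  those in \<open>PS\<close> equations only.\<close>

definition PN :: "('a \<times> 'a) set set" where "PN = {p \<in> piece ` X. \<not> surf p}"
definition PS :: "('a \<times> 'a) set set" where "PS = piece ` SF"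

lemma finite_PN_PS: "finite PN" "finite PS"
proof -
  have "finite X" "finite SF" using finite_flags X_flags by (auto simp: SF_def intro: finite_subset[of _ flags])
  then show "finite PN" "finite PS" by (auto simp: PN_def PS_def)
qed

lemma finite_S: "finite S0" "finite S1" "finite S2"
  using S_sub finite_vertices finite_edges finite_facets finite_subset by blast+

lemma card_PS: "card PS \<le> card S0"
proof -
  \<comment> \<open>The vertex whose link contains the piece; by \<open>S_piece\<close> it
    determines the piece.\<close>
  define w where "w = (\<lambda>p. fst (SOME a. a \<in> SF \<and> piece a = p))"
  have w: "\<exists>e. (w p, e) \<in> SF \<and> piece (w p, e) = p" if "p \<in> PS" for p
  proof -
    have "\<exists>a. a \<in> SF \<and> piece a = p" using that by (auto simp: PS_def)
    from someI_ex[OF this] show ?thesis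
      unfolding w_def by (intro exI[of _ "snd (SOME a. a \<in> SF \<and> piece a = p)"]) simp
  qed
  show ?thesis
  proof (rule card_inj_on_le)
    show "inj_on w PS"
    proof (rule inj_onI)
      fix p q assume pq: "p \<in> PS" "q \<in> PS" "w p = w q"
      obtain e where e: "(w p, e) \<in> SF" "piece (w p, e) = p" using w[OF pq(1)] by blast
      obtain e' where e': "(w q, e') \<in> SF" "piece (w q, e') = q" using w[OF pq(2)] by blast
      have "piece (w p, e) = piece (w p, e')" by (rule S_piece[OF e(1)]) (use e'(1) in \<open>simp only: pq(3)\<close>)
      then have "p = piece (w p, e')" by (simp only: e(2))
      then show "p = q" by (simp only: pq(3) e'(2))
    qed
    show "w ` PS \<subseteq> S0"
    proof (rule image_subsetI)
      fix p assume "p \<in> PS"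
      then obtain e where "(w p, e) \<in> SF" using w by blast
      then show "w p \<in> S0" using S_edge[of e] by (auto simp: SF_def flags_def)
    qed
  qed (rule finite_S)
qed

text \<open>There are as many unknowns as equations for the pieces in \<open>PN\<close>; on the surface there is one
  unknown per edge, but only one equation per facet and at most one per vertex.\<close>

lemma harmonic_coordinates:
  obtains z where "\<exists>u\<in>Inl ` S1 \<union> Inr ` PN. z u \<noteq> 0"
    "\<And>f. f \<in> S2 \<Longrightarrow> closed_at (cochain z) f"
    "\<And>p. p \<in> PS \<union> PN \<Longrightarrow> (\<Sum>a\<in>p. L p a * oriented (cochain z) a) = 0"
proof -
  let ?U = "Inl ` S1 \<union> Inr ` PN :: ('a + ('a \<times> 'a) set) set"
  let ?Q = "Inl ` S2 \<union> Inr ` (PS \<union> PN) :: ('a + ('a \<times> 'a) set) set"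
  define E where "E = (\<lambda>q z. case q of
      Inl f \<Rightarrow> cochain z (sd 0 f) - cochain z (sd 1 f) + cochain z (sd 2 f)
    | Inr p \<Rightarrow> \<Sum>a\<in>p. L p a * oriented (cochain z) a)"
  have cU: "card ?U = card S1 + card PN"
    using finite_S finite_PN_PS by (subst card_Un_disjoint) (auto simp: card_image)
  have "card ?Q = card S2 + card (PS \<union> PN)"
    using finite_S finite_PN_PS by (subst card_Un_disjoint) (auto simp: card_image)
  also have "\<dots> \<le> card S2 + (card PS + card PN)" using card_Un_le by simp
  finally have cQ: "card ?Q < card ?U" using cU card_PS chi by simp
  have lin: "linear_functional (E q)" for q
    unfolding E_def
    by (cases q) (auto intro!: linear_functional_add linear_functional_diff linear_cochain
        linear_functional_sum linear_functional_scale linear_oriented)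
  have fin: "finite ?Q" "finite ?U" using finite_S finite_PN_PS by auto
  show ?thesis
  proof (rule homogeneous_system[OF fin cQ lin])
    fix z assume z: "\<exists>u\<in>?U. z u \<noteq> 0" "\<forall>q\<in>?Q. E q z = 0"
    show ?thesis
    proof (rule that[OF z(1)])
      show "closed_at (cochain z) f" if "f \<in> S2" for f
        using z(2) that by (force simp: E_def closed_at_def)
      show "(\<Sum>a\<in>p. L p a * oriented (cochain z) a) = 0" if "p \<in> PS \<union> PN" for p
      proof -
        have "E (Inr p) z = 0" using z(2) that by blast
        then show ?thesis by (simp add: E_def)
      qed
    qed
  qed
qed

end

section \<open>Maximum principle on fins and the harmonic cochain\<close>

context finned_surface
begin

lemma val_surf_zero:
  assumes "i \<in> I" "a \<in> flags" "snd a \<in> F1 i" "surf (piece a)" "\<And>e. e \<in> set (pe i) \<Longrightarrow> cochain z e = 0"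
  shows "val z i a = 0"
proof -
  obtain b where b: "b \<in> piece a" "b \<in> SF" using assms(4) by (auto simp: surf_def)
  have "fst b = fst a" using piece_fst[OF b(1)] .
  then have "fst a \<in> S0" using b(2) S_edge[of "snd b"] by (cases b) (auto simp: SF_def flags_def)
  moreover have "fst a \<in> F0 i" using assms(1-3) F_edge by (cases a) (auto simp: flags_def)
  ultimately have "fst a \<in> set (pv i)" using path_sets(1)[OF assms(1)] by blast
  moreover have "surface_part z e = 0" if e: "e \<in> set (pe i)" for e
  proof -
    have "e \<in> S1" using e path_sets(2)[OF assms(1)] by blast
    then show ?thesis using assms(5)[OF e] cochain_surface by simp
  qed
  ultimately have "potential (surface_part z) i (fst a) = 0" by (intro potential_zero[OF assms(1)])
  then show ?thesis using assms(4) by (simp add: val_def)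
qed

text \<open>A maximum principle: an extremal value of the potential would spread through the whole fin,
  which is connected to the surface.\<close>

lemma fin_val_le_zero:
  fixes \<sigma> :: real
  assumes \<sigma>: "\<sigma> = 1 \<or> \<sigma> = - 1" and i: "i \<in> I" and zero: "\<And>e. e \<in> set (pe i) \<Longrightarrow> cochain z e = 0"
    and lin: "\<And>p. p \<in> PS \<union> PN \<Longrightarrow> (\<Sum>a\<in>p. L p a * oriented (cochain z) a) = 0"
    and harm: "\<And>a. a \<in> flags \<Longrightarrow> row (oriented (cochain z)) a = 0"
    and a: "a \<in> X" "snd a \<in> F1 i"
  shows "\<sigma> * val z i a \<le> 0"
proof (rule ccontr)
  assume pos: "\<not> \<sigma> * val z i a \<le> 0"
  define T where "T = {a \<in> X. snd a \<in> F1 i}"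
  have finT: "finite T" using finite_flags X_flags by (auto simp: T_def intro: finite_subset[of _ flags])
  have aT: "a \<in> T" using a by (simp add: T_def)
  define m where "m = Max ((\<lambda>a. \<sigma> * val z i a) ` T)"
  have le: "\<sigma> * val z i b \<le> m" if "b \<in> T" for b unfolding m_def using finT that by (intro Max_ge) auto
  have m: "0 < m" using le[of a] a pos by (simp add: T_def)
  have "m \<in> (\<lambda>a. \<sigma> * val z i a) ` T" unfolding m_def using finT aT by (intro Max_in) auto
  then obtain b where b: "b \<in> T" "\<sigma> * val z i b = m" by auto
  \<comment> \<open>The flags at which the positive maximum is attained. None lies in a piece
    meeting the surface, because the potential is 0 there; so \<open>Y\<close> consists of whole
    pieces.\<close>
  define Y where "Y = {b \<in> T. \<sigma> * val z i b = m}"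
  have Y_nonsurf: "\<not> surf (piece b)" if "b \<in> Y" for b
    using val_surf_zero[OF i _ _ _ zero, of b] that m X_flags by (auto simp: Y_def T_def)
  have Y_piece: "c \<in> Y" if "b \<in> Y" "c \<in> piece b" for b c
  proof -
    have "c \<in> X" using that(1) by (intro X_piece[OF _ that(2)]) (simp add: Y_def T_def)
    moreover have "snd c \<in> F1 i"
      using non_surf_piece[OF i _ Y_nonsurf[OF that(1)] _ that(2)] that(1) X_flags by (auto simp: Y_def T_def)
    moreover have "val z i c = val z i b"
      using Y_nonsurf[OF that(1)] piece_eq[OF that(2)] by (simp add: val_def)
    ultimately show ?thesis using that(1) by (simp add: Y_def T_def)
  qed
  \<comment> \<open>The outward differences from a maximum are nonpositive on the whole piece. They
    form a kernel vector on the controlling hyperplane and so vanish, which passes the maximum on to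
    the opposite flags.\<close>
  have Y_opp: "opp b \<in> Y" if b: "b \<in> Y" for b
  proof -
    have bX: "b \<in> X" and bF: "snd b \<in> F1 i" using b by (auto simp: Y_def T_def)
    have p: "piece b \<in> pieces" using X_flags[OF bX] by (simp add: pieces_def)
    have pN: "piece b \<in> PN" using bX Y_nonsurf[OF b] by (simp add: PN_def)
    let ?y = "\<lambda>a. \<sigma> * oriented (cochain z) a"
    have or: "oriented (cochain z) c = val z i (opp c) - val z i c" if "c \<in> Y" for c
      using that by (intro oriented_cochain_fin[OF i]) (auto simp: Y_def T_def)
    have le0: "?y c \<le> 0" if c: "c \<in> piece b" for c
    proof -
      have cY: "c \<in> Y" using Y_piece[OF b c] .
      then have "opp c \<in> T" using X_opp by (auto simp: Y_def T_def opp_def)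
      then have "\<sigma> * val z i (opp c) \<le> \<sigma> * val z i c" using le cY by (simp add: Y_def)
      then show ?thesis unfolding or[OF cY] by (simp add: algebra_simps)
    qed
    have "(\<Sum>a\<in>piece b. L (piece b) a * ?y a) = \<sigma> * (\<Sum>a\<in>piece b. L (piece b) a * oriented (cochain z) a)"
      by (simp add: sum_distrib_left algebra_simps)
    then have s0: "(\<Sum>a\<in>piece b. L (piece b) a * ?y a) = 0" using lin[of "piece b"] pN by simp
    have r0: "\<forall>a\<in>piece b. (\<Sum>c\<in>piece b. M a c * ?y c) = 0"
    proof
      fix a assume a: "a \<in> piece b"
      have aF: "a \<in> flags" using a piece_flags[OF X_flags[OF bX]] by blast
      have "(\<Sum>c\<in>piece b. M a c * ?y c) = \<sigma> * (\<Sum>c\<in>piece b. M a c * oriented (cochain z) c)"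
        by (simp add: sum_distrib_left algebra_simps)
      also have "(\<Sum>c\<in>piece b. M a c * oriented (cochain z) c) = row (oriented (cochain z)) a"
        using row_piece[OF aF] piece_eq[OF a] by simp
      finally show "(\<Sum>c\<in>piece b. M a c * ?y c) = 0" using harm[OF aF] by simp
    qed
    have "\<forall>a\<in>piece b. ?y a = 0"
      using L[OF p, unfolded controls_def, rule_format, of ?y, OF s0] r0 le0 by blast
    then have "oriented (cochain z) b = 0" using piece_self[of b] \<sigma> by auto
    then have "val z i (opp b) = val z i b" using or[OF b] by simp
    then show ?thesis using b X_opp by (auto simp: Y_def T_def opp_def)
  qed
  have Y_step: "d \<in> Y" if "c \<in> Y" "(c, d) \<in> step" for c d
  proof -
    have "(c, d) \<in> adj \<or> d = opp c" using that(2) by (auto simp: step_def)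
    then show ?thesis using Y_piece[OF that(1)] adj_piece[OF _ piece_self] Y_opp[OF that(1)] by blast
  qed
  have bY: "b \<in> Y" using b by (simp add: Y_def)
  then have "b \<in> X" by (simp add: Y_def T_def)
  \<comment> \<open>\<open>X\<close> arises from surface flags by reversible steps, so the maximum
    would be attained at a surface flag.\<close>
  then obtain s where s: "s \<in> SF" "(s, b) \<in> step\<^sup>*" by (auto simp: X_def)
  have "(b, s) \<in> step\<^sup>*" using s(2) sym_rtrancl[OF sym_step] by (auto dest: symD)
  then have "s \<in> Y" by (induction rule: rtrancl_induct) (use bY Y_step in auto)
  then show False using Y_nonsurf surf_SF[OF s(1)] by blast
qed

lemma fin_val_zero:
  assumes i: "i \<in> I" and zero: "\<And>e. e \<in> set (pe i) \<Longrightarrow> cochain z e = 0"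
    and lin: "\<And>p. p \<in> PS \<union> PN \<Longrightarrow> (\<Sum>a\<in>p. L p a * oriented (cochain z) a) = 0"
    and harm: "\<And>a. a \<in> flags \<Longrightarrow> row (oriented (cochain z)) a = 0"
    and a: "a \<in> X" "snd a \<in> F1 i"
  shows "val z i a = 0" "cochain z (snd a) = 0"
proof -
  have v: "val z i b = 0" if b: "b \<in> X" "snd b \<in> F1 i" for b
    using fin_val_le_zero[OF _ i zero lin harm b, of 1] fin_val_le_zero[OF _ i zero lin harm b, of "- 1"] by simp
  show "val z i a = 0" using v[OF a] .
  have "oriented (cochain z) a = 0"
    unfolding oriented_cochain_fin[OF i a(2,1)] using v[OF a] v[OF X_opp[OF a(1)]] a(2) by (simp add: opp_def)
  then show "cochain z (snd a) = 0" by (simp add: oriented_eq_0_iff)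
qed

lemma harmonic_cochain:
  obtains c where "\<And>f. f \<in> facets K \<Longrightarrow> closed_at c f" "\<And>a. a \<in> flags \<Longrightarrow> row (oriented c) a = 0"
    "\<exists>e\<in>S1. c e \<noteq> 0"
    "\<And>i a. i \<in> I \<Longrightarrow> (\<And>e. e \<in> set (pe i) \<Longrightarrow> c e = 0) \<Longrightarrow> a \<in> X \<Longrightarrow> snd a \<in> F1 i \<Longrightarrow> c (snd a) = 0"
proof -
  obtain z where z: "\<exists>u\<in>Inl ` S1 \<union> Inr ` PN. z u \<noteq> 0"
    "\<And>f. f \<in> S2 \<Longrightarrow> closed_at (cochain z) f"
    "\<And>p. p \<in> PS \<union> PN \<Longrightarrow> (\<Sum>a\<in>p. L p a * oriented (cochain z) a) = 0"
    by (rule harmonic_coordinates) blast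
  let ?c = "cochain z"
  have cl: "closed_at ?c f" if "f \<in> facets K" for f using closed_cochain[OF that z(2)] .
  have off: "?c e = 0" if "(st e, e) \<notin> X" for e
  proof -
    have "e \<notin> S1"
    proof
      assume "e \<in> S1"
      then have "(st e, e) \<in> SF" using S_sub by (auto simp: SF_def flags_def)
      then show False using that SF_X by blast
    qed
    then show ?thesis using that by (simp add: cochain_def)
  qed
  have off': "oriented ?c a = 0" if "a \<in> flags" "a \<notin> X" for a
  proof -
    have "(st (snd a), snd a) \<notin> X"
    proof
      assume "(st (snd a), snd a) \<in> X"
      then have "(fst a, snd a) \<in> X" by (rule X_edge) (use that in simp)
      then show False using that by simp
    qed
    from off[OF this] show ?thesis by (simp add: oriented_eq_0_iff)
  qed
  \<comment> \<open>Pieces outside \<open>PS \<union> PN\<close> miss \<open>X\<close>, off which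
    the cochain is 0, so their equations hold for free.\<close>
  have lin: "(\<Sum>a\<in>p. L p a * oriented ?c a) = 0" if p: "p \<in> pieces" for p
  proof (cases "p \<in> PS \<union> PN")
    case False
    obtain a where a: "a \<in> flags" "p = piece a" using p by (auto simp: pieces_def)
    have "oriented ?c b = 0" if b: "b \<in> p" for b
    proof (rule off')
      show "b \<in> flags" using b a piece_flags by blast
      show "b \<notin> X"
      proof
        assume "b \<in> X"
        have pb: "piece b = p" using b a(2) piece_eq by blast
        then have "surf p" using False \<open>b \<in> X\<close> by (auto simp: PN_def)
        then obtain d where d: "d \<in> p" "d \<in> SF" by (auto simp: surf_def)
        then have "piece d = p" using a(2) piece_eq by blast
        then show False using False d(2) by (auto simp: PS_def)
      qed
    qed
    then show ?thesis by simp
  qed (rule z(3))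
  have q: "quadratic p M (oriented ?c) (oriented ?c) = (\<Sum>a\<in>p. oriented ?c a * row (oriented ?c) a)" if pp: "p \<in> pieces" for p
    unfolding quadratic_eq_sum_row
  proof (rule sum.cong[OF refl])
    fix a assume a: "a \<in> p"
    obtain b where b: "b \<in> flags" "p = piece b" using pp by (auto simp: pieces_def)
    have "a \<in> flags" "piece a = p" using a b piece_flags piece_eq by blast+
    then show "oriented ?c a * (\<Sum>j\<in>p. M a j * oriented ?c j) = oriented ?c a * row (oriented ?c) a"
      using row_piece[of a] by simp
  qed
  have "(\<Sum>p\<in>pieces. - quadratic p M (oriented ?c) (oriented ?c)) = - (\<Sum>a\<in>flags. oriented ?c a * row (oriented ?c) a)"
    unfolding sum_pieces sum_negf using q by (intro arg_cong[of _ _ uminus] sum.cong refl)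
  then have "(\<Sum>p\<in>pieces. - quadratic p M (oriented ?c) (oriented ?c)) = 0" using total_zero[OF cl] by simp
  moreover have "0 \<le> - quadratic p M (oriented ?c) (oriented ?c)" if "p \<in> pieces" for p
    using L[OF that] lin[OF that] unfolding controls_def by auto
  moreover have "finite pieces" using finite_flags by (simp add: pieces_def)
  ultimately have q0: "quadratic p M (oriented ?c) (oriented ?c) = 0" if "p \<in> pieces" for p
    using that by (subst (asm) sum_nonneg_eq_0_iff) auto
  have harm: "row (oriented ?c) a = 0" if a: "a \<in> flags" for a
  proof -
    have p: "piece a \<in> pieces" using a by (simp add: pieces_def)
    have "\<forall>b\<in>piece a. (\<Sum>d\<in>piece a. M b d * oriented ?c d) = 0"
      using L[OF p] lin[OF p] q0[OF p] unfolding controls_def by blast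
    then show ?thesis using row_piece[OF a] piece_self by simp
  qed
  \<comment> \<open>A solution that is zero on the surface has zero potential on every fin by the
    maximum principle, so its coordinates in \<open>PN\<close> vanish as well.\<close>
  have nz: "\<exists>e\<in>S1. ?c e \<noteq> 0"
  proof (rule ccontr)
    assume "\<not> ?thesis"
    then have c0: "?c e = 0" if "e \<in> S1" for e using that by blast
    have "z u = 0" if "u \<in> Inl ` S1 \<union> Inr ` PN" for u
      using that
    proof
      assume "u \<in> Inl ` S1"
      then show ?thesis using c0 by (auto simp: cochain_def)
    next
      assume "u \<in> Inr ` PN"
      then obtain a where a: "a \<in> X" "u = Inr (piece a)" "\<not> surf (piece a)" by (auto simp: PN_def)
      have "snd a \<notin> S1" using a(3) surf_SF[of a] X_flags[OF a(1)] by (auto simp: SF_def)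
      then obtain i where i: "i \<in> I" "snd a \<in> F1 i" using X_cover[OF a(1)] by blast
      have "val z i a = 0"
      proof (rule fin_val_zero(1)[OF i(1) _ z(3) harm a(1) i(2)])
        show "?c e = 0" if "e \<in> set (pe i)" for e using that path_sets(2)[OF i(1)] c0 by blast
      qed
      then show ?thesis using a by (simp add: val_def)
    qed
    then show False using z(1) by blast
  qed
  show ?thesis
  proof (rule that[OF cl harm nz])
    show "?c (snd a) = 0" if "i \<in> I" "\<And>e. e \<in> set (pe i) \<Longrightarrow> ?c e = 0" "a \<in> X" "snd a \<in> F1 i" for i a
      by (rule fin_val_zero(2)[OF that(1,2) z(3) harm that(3,4)])
  qed
qed

end

section \<open>The zero set and the sign changes of a harmonic cochain\<close>

lemma card_nonzero: "finite A \<Longrightarrow> x \<in> A \<Longrightarrow> card A \<noteq> 0"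
  by auto

context finned_surface
begin

lemma flag_path_iff:
  assumes i: "i \<in> I" and m: "m < length (pe i)" and n: "n < length (pv i)"
  shows "(pv i ! n, pe i ! m) \<in> flags \<longleftrightarrow> n = m \<or> n = Suc m"
proof -
  have "pe i ! m \<in> set (pe i)" using m by simp
  then have e: "pe i ! m \<in> edges K" using path_sets(2)[OF i] S_sub by blast
  have l: "m < length (pv i)" "Suc m < length (pv i)" using m path_length[OF i] by auto
  have "(pv i ! n, pe i ! m) \<in> flags \<longleftrightarrow> pv i ! n \<in> {st (pe i ! m), en (pe i ! m)}"
    using e by (auto simp: flags_def)
  also have "\<dots> \<longleftrightarrow> pv i ! n = pv i ! m \<or> pv i ! n = pv i ! Suc m"
    unfolding path_edge[OF i m] by simp
  also have "\<dots> \<longleftrightarrow> n = m \<or> n = Suc m"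
    using nth_eq_iff_index_eq[OF path_distinct[OF i] n l(1)] nth_eq_iff_index_eq[OF path_distinct[OF i] n l(2)] by simp
  finally show ?thesis .
qed

lemma path_vertex:
  assumes i: "i \<in> I" and e: "e \<in> set (pe i)" "(v, e) \<in> flags"
  shows "v \<in> set (pv i)"
proof -
  have "e \<in> F1 i" "e \<in> S1" using path_sets(2)[OF i] e(1) by auto
  then have "v \<in> F0 i \<inter> S0" using F_edge[OF i, of e] S_edge[of e] e(2) by (auto simp: flags_def)
  then show ?thesis using path_sets(1)[OF i] by simp
qed

lemma path_edges_at:
  assumes i: "i \<in> I" and n: "n < length (pv i)"
  shows "set (pe i) \<inter> edges_at K (pv i ! n) \<subseteq> {pe i ! m | m. m < length (pe i) \<and> (n = m \<or> n = Suc m)}"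
proof
  fix e assume e: "e \<in> set (pe i) \<inter> edges_at K (pv i ! n)"
  then obtain m where m: "m < length (pe i)" "e = pe i ! m" by (auto simp: in_set_conv_nth)
  have "(pv i ! n, e) \<in> flags" using e by (simp add: flags_iff)
  then have "n = m \<or> n = Suc m" using flag_path_iff[OF i m(1) n] m(2) by simp
  then show "e \<in> {pe i ! m | m. m < length (pe i) \<and> (n = m \<or> n = Suc m)}" using m by blast
qed

lemma card_path_edges_at:
  assumes i: "i \<in> I"
  shows "card (set (pe i) \<inter> edges_at K v) \<le> 2"
proof (cases "v \<in> set (pv i)")
  case True
  then obtain n where n: "n < length (pv i)" "v = pv i ! n" by (auto simp: in_set_conv_nth)
  have "set (pe i) \<inter> edges_at K v \<subseteq> {pe i ! n, pe i ! (n - 1)}" using path_edges_at[OF i n(1)] n(2) by auto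
  then have "card (set (pe i) \<inter> edges_at K v) \<le> card {pe i ! n, pe i ! (n - 1)}" by (intro card_mono) auto
  also have "\<dots> \<le> 2" by (simp add: card_insert_if)
  finally show ?thesis .
next
  case False
  then have "set (pe i) \<inter> edges_at K v = {}" using path_vertex[OF i] by (auto simp: flags_iff)
  then show ?thesis by simp
qed

lemma card_path_edges_at_endpoint:
  assumes i: "i \<in> I" and v: "v \<in> {hd (pv i), last (pv i)}"
  shows "card (set (pe i) \<inter> edges_at K v) \<le> 1"
proof -
  have ne: "pv i \<noteq> []" using path_length[OF i] by auto
  have "\<exists>e. set (pe i) \<inter> edges_at K v \<subseteq> {e}"
  proof (cases "v = hd (pv i)")
    case True
    then have "v = pv i ! 0" using ne by (simp add: hd_conv_nth)
    then have "set (pe i) \<inter> edges_at K v \<subseteq> {pe i ! 0}" using path_edges_at[OF i, of 0] ne by auto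
    then show ?thesis by blast
  next
    case False
    then have "v = pv i ! length (pe i)" using v ne path_length[OF i] by (simp add: last_conv_nth)
    then have "set (pe i) \<inter> edges_at K v \<subseteq> {pe i ! (length (pe i) - 1)}"
      using path_edges_at[OF i, of "length (pe i)"] path_length[OF i] by auto
    then show ?thesis by blast
  qed
  then obtain e where "set (pe i) \<inter> edges_at K v \<subseteq> {e}" by blast
  from card_mono[OF _ this] show ?thesis by simp
qed

lemma two_facets: "e \<in> S1 \<Longrightarrow> \<exists>f g. f \<noteq> g \<and> {f \<in> S2. e \<in> sides f} = {f, g}"
  using degree[of e] by (auto simp: card_2_iff)

lemma card_corner:
  assumes "f \<in> facets K" "e \<in> sides f" "(v, e) \<in> flags"
  shows "card (sides f \<inter> edges_at K v) = 2"
proof -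
  obtain e' where e': "sides f \<inter> edges_at K v - {e} = {e'}" using third_side[OF assms] .
  have "e \<in> sides f \<inter> edges_at K v" using assms by (simp add: flags_iff)
  then have "sides f \<inter> edges_at K v = {e, e'}" "e \<noteq> e'" using e' by blast+
  then show ?thesis by simp
qed

text \<open>At a vertex the connected link puts all surrounding facets into \<open>R\<close> or
  none; connectedness of the edge graph spreads this over the surface.\<close>

lemma dual_connected:
  assumes R: "R \<subseteq> S2" "R \<noteq> {}"
    and closed: "\<And>e f g. e \<in> S1 \<Longrightarrow> f \<in> R \<Longrightarrow> e \<in> sides f \<Longrightarrow> g \<in> S2 \<Longrightarrow> e \<in> sides g \<Longrightarrow> g \<in> R"
  shows "R = S2"
proof -
  define C where "C v = {e \<in> S1. (v, e) \<in> flags \<and> (\<exists>f\<in>R. e \<in> sides f)}" for v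
  have full: "C v = {e \<in> S1. (v, e) \<in> flags}" if "v \<in> S0" "C v \<noteq> {}" for v
  proof (rule link[OF that(1) _ that(2)])
    fix f e e' assume f: "f \<in> S2" "e \<in> sides f" "e \<in> C v" "e' \<in> sides f" "(v, e') \<in> flags"
    then have "f \<in> R" using closed by (auto simp: C_def)
    then show "e' \<in> C v" using f S_facet[OF f(1)] by (auto simp: C_def)
  qed (auto simp: C_def)
  define A where "A = {v \<in> S0. C v \<noteq> {}}"
  have fl: "(st e, e) \<in> flags" "(en e, e) \<in> flags" if "e \<in> S1" for e using that S_sub by (auto simp: flags_def)
  have iff: "st e \<in> A \<longleftrightarrow> en e \<in> A" if e: "e \<in> S1" for e
  proof -
    have "v \<in> A \<longleftrightarrow> (\<exists>f\<in>R. e \<in> sides f)" if "v \<in> S0" "(v, e) \<in> flags" for v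
      using full[OF that(1)] that e by (auto simp: A_def C_def)
    then show ?thesis using S_edge[OF e] fl[OF e] by blast
  qed
  obtain f where f: "f \<in> R" using R by blast
  have s0: "sd 0 f \<in> S1" using S_facet f R by blast
  have "sd 0 f \<in> C (st (sd 0 f))" using fl(1)[OF s0] s0 f by (auto simp: C_def)
  then have "st (sd 0 f) \<in> A" using S_edge[OF s0] by (auto simp: A_def)
  then have A: "A = S0" using iff by (intro graph) (auto simp: A_def)
  have "g \<in> R" if g: "g \<in> S2" for g
  proof -
    have s: "sd 0 g \<in> S1" using S_facet g by blast
    then have "st (sd 0 g) \<in> S0" "C (st (sd 0 g)) \<noteq> {}" using S_edge A by (auto simp: A_def)
    then have "sd 0 g \<in> C (st (sd 0 g))" using full s fl(1)[OF s] by blast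
    then obtain f where "f \<in> R" "sd 0 g \<in> sides f" by (auto simp: C_def)
    then show ?thesis using closed[OF s, of f g] g by blast
  qed
  then show ?thesis using R by blast
qed

end

section \<open>The zero set on the surface\<close>

locale harmonic_surface = finned_surface K \<alpha> S0 S1 S2 I F0 F1 F2 pv pe
  for K :: "'a delta_data" and \<alpha> S0 S1 S2 I F0 F1 F2 pv pe +
  fixes c :: "'a \<Rightarrow> real"
  assumes closed: "\<And>f. f \<in> facets K \<Longrightarrow> closed_at c f"
    and harm: "\<And>a. a \<in> flags \<Longrightarrow> row (oriented c) a = 0"
    and nonzero: "\<exists>e\<in>S1. c e \<noteq> 0"
    and fin_zero: "\<And>i a. i \<in> I \<Longrightarrow> (\<And>e. e \<in> set (pe i) \<Longrightarrow> c e = 0) \<Longrightarrow> a \<in> X \<Longrightarrow> snd a \<in> F1 i \<Longrightarrow> c (snd a) = 0"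
begin

lemma two_zero_sides:
  assumes "f \<in> facets K" "e \<in> sides f" "e' \<in> sides f" "e \<noteq> e'" "c e = 0" "c e' = 0" "d \<in> sides f"
  shows "c d = 0"
  using assms closed[OF assms(1)] by (auto simp: closed_at_def)

lemma zero_row:
  assumes "(v, e) \<in> flags" "c e = 0"
  shows "(\<Sum>f\<in>facets_at K e. \<Sum>e'\<in>sides f \<inter> edges_at K v - {e}. oriented c (v, e')) = 0"
  using harm[OF assms(1)] row_eq[OF assms(1), of "oriented c"] assms(2) by (simp add: oriented_eq_0_iff)

text \<open>\<open>Bd\<close> is the boundary of the region \<open>R\<close> of the surface on which \<open>c\<close> vanishes.  Such an edge lies in
  a fin on which \<open>c\<close> does not vanish, and the boundary follows the whole path of the last such fin.\<close>

definition R :: "'a set" where "R = {f \<in> S2. \<forall>e\<in>sides f. c e = 0}"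
definition Bd :: "'a set" where "Bd = {e \<in> S1. (\<exists>f\<in>R. e \<in> sides f) \<and> (\<exists>g\<in>S2 - R. e \<in> sides g)}"

lemma surface_flag: "e \<in> S1 \<Longrightarrow> (st e, e) \<in> flags" "e \<in> S1 \<Longrightarrow> (st e, e) \<in> X"
  using S_sub SF_X by (auto simp: SF_def flags_def)

text \<open>Otherwise all facets at \<open>e\<close> but the one outside \<open>R\<close> contribute
  0 to the row equation: \<open>c\<close> vanishes on the facet in \<open>R\<close> and on the fins
  at \<open>e\<close>. Then the other edge of the remaining facet at that vertex is zero too, and
  two zero sides put this facet into \<open>R\<close>.\<close>

lemma Bd_fin:
  assumes e: "e \<in> Bd"
  shows "\<exists>i\<in>I. e \<in> F1 i \<and> (\<exists>d\<in>set (pe i). c d \<noteq> 0)"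
proof (rule ccontr)
  assume no: "\<not> ?thesis"
  obtain f g where fg: "e \<in> S1" "f \<in> R" "e \<in> sides f" "g \<in> S2" "g \<notin> R" "e \<in> sides g" using e by (auto simp: Bd_def)
  have ce: "c e = 0" using fg by (auto simp: R_def)
  have gK: "g \<in> facets K" using fg S_sub by blast
  note fl = surface_flag[OF fg(1)]
  have two: "h = f \<or> h = g" if "h \<in> S2" "e \<in> sides h" for h
  proof -
    obtain x y where xy: "{h \<in> S2. e \<in> sides h} = {x, y}" using two_facets[OF fg(1)] by blast
    have "f \<in> S2" using fg(2) by (simp add: R_def)
    then have "f \<in> {x, y}" "g \<in> {x, y}" "h \<in> {x, y}" "f \<noteq> g"
      using that fg unfolding xy[symmetric] by blast+
    then show ?thesis by blast
  qed
  let ?r = "\<lambda>h. \<Sum>e'\<in>sides h \<inter> edges_at K (st e) - {e}. oriented c (st e, e')"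
  have zero: "?r h = 0" if h: "h \<in> facets_at K e" "h \<noteq> g" for h
  proof (rule sum.neutral, rule ballI)
    fix e' assume e': "e' \<in> sides h \<inter> edges_at K (st e) - {e}"
    have hK: "h \<in> facets K" "e \<in> sides h" using h(1) by (auto simp: facets_at_sides)
    have "h \<in> S2 \<union> (\<Union>i\<in>I. F2 i)" using covered[OF hK] fg(1) by blast
    then have "c e' = 0"
    proof
      assume "h \<in> S2"
      then have "h = f" using two hK(2) h(2) by blast
      then show ?thesis using fg(2) e' by (auto simp: R_def)
    next
      assume "h \<in> (\<Union>i\<in>I. F2 i)"
      then obtain i where i: "i \<in> I" "h \<in> F2 i" by blast
      have "e \<in> F1 i" "e' \<in> F1 i" using F_facet[OF i] hK(2) e' by blast+
      then have z: "c d = 0" if "d \<in> set (pe i)" for d using no i(1) that by blast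
      have "(st e, e') \<in> X"
        by (rule X_facet[OF hK(1,2) fl(2)]) (use e' in \<open>auto simp: flags_iff\<close>)
      then show ?thesis using fin_zero[OF i(1) z, of "(st e, e')"] \<open>e' \<in> F1 i\<close> by simp
    qed
    then show "oriented c (st e, e') = 0" by (simp add: oriented_eq_0_iff)
  qed
  have gin: "g \<in> facets_at K e" using gK fg by (simp add: facets_at_sides)
  have "0 = ?r g + (\<Sum>h\<in>facets_at K e - {g}. ?r h)"
    using zero_row[OF fl(1) ce] sum.remove[OF finite_facets_at gin, of ?r] by simp
  also have "(\<Sum>h\<in>facets_at K e - {g}. ?r h) = 0" by (rule sum.neutral) (use zero in blast)
  finally have r: "?r g = 0" by simp
  obtain e' where e': "sides g \<inter> edges_at K (st e) - {e} = {e'}" using third_side[OF gK fg(6) fl(1)] .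
  have "c e' = 0" using r unfolding e' by (simp add: oriented_eq_0_iff)
  then have "\<forall>d\<in>sides g. c d = 0" using two_zero_sides[OF gK fg(6), of e'] e' ce by blast
  then show False using fg by (simp add: R_def)
qed

text \<open>Parity: the number of edges at \<open>v\<close> with exactly one adjacent facet in \<open>R\<close> is even.\<close>

lemma Bd_passes_through:
  assumes a: "a \<in> S1" "(v, a) \<in> flags" and b: "b \<in> S1" "(v, b) \<in> flags" and ab: "a \<noteq> b"
    and only: "\<And>e. e \<in> Bd \<Longrightarrow> (v, e) \<in> flags \<Longrightarrow> e = a \<or> e = b"
    and f: "f \<in> R" "a \<in> sides f"
  shows "\<exists>g\<in>R. b \<in> sides g"
proof (rule ccontr)
  assume nb: "\<not> ?thesis"
  have RS: "R \<subseteq> S2" by (auto simp: R_def)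
  define E where "E = {e \<in> S1. (v, e) \<in> flags}"
  define n where "n e = card {f \<in> R. e \<in> sides f}" for e
  have fE: "finite E" and fR: "finite R" using finite_S by (auto simp: E_def R_def)
  have aE: "a \<in> E" using a by (simp add: E_def)
  have "(\<Sum>e\<in>E. n e) = (\<Sum>e\<in>E. \<Sum>f\<in>{f \<in> R. e \<in> sides f}. 1)" by (simp add: n_def)
  also have "\<dots> = (\<Sum>f\<in>R. \<Sum>e\<in>{e \<in> E. e \<in> sides f}. 1)" by (rule sum.swap_restrict[OF fE fR])
  also have "\<dots> = (\<Sum>f\<in>R. card {e \<in> E. e \<in> sides f})" by simp
  finally have count: "(\<Sum>e\<in>E. n e) = (\<Sum>f\<in>R. card {e \<in> E. e \<in> sides f})" .
  \<comment> \<open>A facet has two edges at \<open>v\<close> or none.\<close>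
  have "even (\<Sum>f\<in>R. card {e \<in> E. e \<in> sides f})"
  proof (rule dvd_sum)
    fix h assume "h \<in> R"
    then have h: "h \<in> S2" "h \<in> facets K" using S_sub by (auto simp: R_def)
    have eq: "{e \<in> E. e \<in> sides h} = sides h \<inter> edges_at K v"
      using S_facet[OF h(1)] by (auto simp: E_def flags_iff)
    show "even (card {e \<in> E. e \<in> sides h})"
    proof (cases "\<exists>e\<in>sides h. (v, e) \<in> flags")
      case True
      then obtain e where "e \<in> sides h" "(v, e) \<in> flags" by blast
      from card_corner[OF h(2) this] show ?thesis unfolding eq by simp
    next
      case False
      then have "sides h \<inter> edges_at K v = {}" unfolding flags_iff by blast
      then show ?thesis unfolding eq by simp
    qed
  qed
  then have "even (n a + (\<Sum>e\<in>E - {a}. n e))" using count sum.remove[OF fE aE, of n] by simp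
  \<comment> \<open>An edge other than \<open>a\<close> is \<open>b\<close>, with no facet in
    \<open>R\<close>, or lies outside \<open>Bd\<close>; either way it has 0 or 2 facets in
    \<open>R\<close>.\<close>
  moreover have n02: "n e = 0 \<or> {f \<in> S2. e \<in> sides f} \<subseteq> R \<and> n e = 2" if e: "e \<in> E" "e \<noteq> a" for e
  proof (cases "e \<in> Bd")
    case True
    then have "e = b" using only[OF True] e by (auto simp: E_def)
    then have "{f \<in> R. e \<in> sides f} = {}" using nb by blast
    then have "n e = 0" unfolding n_def by (simp only: card.empty)
    then show ?thesis by (rule disjI1)
  next
    case False
    show ?thesis
    proof (cases "\<exists>f\<in>R. e \<in> sides f")
      case True
      have eS: "e \<in> S1" using e(1) by (simp add: E_def)
      have sub: "{f \<in> S2. e \<in> sides f} \<subseteq> R"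
      proof (rule subsetI, rule ccontr)
        fix g assume "g \<in> {f \<in> S2. e \<in> sides f}" "g \<notin> R"
        then have "e \<in> Bd" unfolding Bd_def using True eS by blast
        then show False using False by simp
      qed
      then have "{f \<in> R. e \<in> sides f} = {f \<in> S2. e \<in> sides f}" using RS by blast
      then have "n e = 2" unfolding n_def using degree[OF eS] by (simp only:)
      then show ?thesis using sub by (intro disjI2 conjI)
    next
      case False
      then have "{f \<in> R. e \<in> sides f} = {}" by blast
      then have "n e = 0" unfolding n_def by (simp only: card.empty)
      then show ?thesis by (rule disjI1)
    qed
  qed
  have "even (\<Sum>e\<in>E - {a}. n e)" by (rule dvd_sum) (use n02 in \<open>elim DiffE, metis dvd_0_right dvd_refl singletonI\<close>)
  ultimately have ev: "even (n a)" by simp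
  have fin2: "finite {f \<in> S2. a \<in> sides f}" using finite_S by simp
  have sub: "{f \<in> R. a \<in> sides f} \<subseteq> {f \<in> S2. a \<in> sides f}" using RS by blast
  have "n a \<le> 2" using card_mono[OF fin2 sub] degree[OF a(1)] by (simp add: n_def)
  moreover have "n a \<noteq> 0"
  proof -
    have "f \<in> {f \<in> R. a \<in> sides f}" using f by blast
    then show ?thesis unfolding n_def by (rule card_nonzero[OF finite_subset[OF sub fin2]])
  qed
  ultimately have "n a = 2" using ev by presburger
  then have "{f \<in> R. a \<in> sides f} = {f \<in> S2. a \<in> sides f}"
    using card_subset_eq[OF fin2 sub] degree[OF a(1)] by (simp add: n_def)
  then have sa: "{f \<in> S2. a \<in> sides f} \<subseteq> R" by blast
  \<comment> \<open>With both surface facets at \<open>a\<close> in \<open>R\<close>, the region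
    spreads around the connected link of \<open>v\<close> and reaches \<open>b\<close>.\<close>
  define D where "D = {e \<in> E. {f \<in> S2. e \<in> sides f} \<subseteq> R}"
  have v: "v \<in> S0" using a S_edge[OF a(1)] by (auto simp: flags_def)
  have "D = {e \<in> S1. (v, e) \<in> flags}"
  proof (rule link[OF v])
    show "D \<noteq> {}" using aE sa by (auto simp: D_def)
    show "D \<subseteq> {e \<in> S1. (v, e) \<in> flags}" by (auto simp: D_def E_def)
    fix h e e' assume h: "h \<in> S2" "e \<in> sides h" "e \<in> D" "e' \<in> sides h" "(v, e') \<in> flags"
    have hR: "h \<in> R" using h by (auto simp: D_def)
    have e'E: "e' \<in> E" using S_facet[OF h(1)] h(4,5) by (auto simp: E_def)
    show "e' \<in> D"
    proof (cases "e' = a")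
      case False
      have "h \<in> {f \<in> R. e' \<in> sides f}" using hR h(4) by blast
      then have "n e' \<noteq> 0" unfolding n_def by (intro card_nonzero) (use fR in simp)
      then show ?thesis using n02[OF e'E False] e'E by (auto simp: D_def)
    qed (use aE sa in \<open>simp add: D_def\<close>)
  qed
  then have "b \<in> D" using b by blast
  moreover obtain g where "g \<in> S2" "b \<in> sides g" using two_facets[OF b(1)] by blast
  ultimately show False using nb by (auto simp: D_def)
qed

text \<open>Take the last fin containing an edge of \<open>Bd\<close>. At an inner vertex of its
  path all edges of \<open>Bd\<close> belong to this path, because earlier fins meet the fin only in
  the endpoints. So contact with \<open>R\<close> passes from path edge to path edge, up to one
  where \<open>c\<close> is nonzero.\<close>

lemma facet_nonzero:
  assumes "f \<in> S2"
  shows "\<exists>e\<in>sides f. c e \<noteq> 0"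
proof (rule ccontr)
  assume "\<not> ?thesis"
  then have f: "f \<in> R" using assms by (auto simp: R_def)
  have "Bd \<noteq> {}"
  proof
    assume no: "Bd = {}"
    have "R = S2"
    proof (rule dual_connected)
      show "g \<in> R" if "e \<in> S1" "f \<in> R" "e \<in> sides f" "g \<in> S2" "e \<in> sides g" for e f g
      proof (rule ccontr)
        assume "g \<notin> R"
        then have "e \<in> Bd" unfolding Bd_def using that by blast
        then show False using no by simp
      qed
    qed (use f in \<open>auto simp: R_def\<close>)
    moreover obtain e where e: "e \<in> S1" "c e \<noteq> 0" using nonzero by blast
    moreover obtain g where "g \<in> S2" "e \<in> sides g" using two_facets[OF e(1)] by blast
    ultimately show False by (auto simp: R_def)
  qed
  have fin: "finite (fin_of ` Bd)" using finite_S by (auto simp: Bd_def)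
  define i where "i = Max (fin_of ` Bd)"
  have le: "fin_of e \<le> i" if "e \<in> Bd" for e unfolding i_def using fin that by simp
  have "i \<in> fin_of ` Bd" unfolding i_def by (rule Max_in[OF fin]) (use \<open>Bd \<noteq> {}\<close> in simp)
  then obtain e0 where e0: "e0 \<in> Bd" "i = fin_of e0" by auto
  from Bd_fin[OF e0(1)] obtain i' d where i': "i' \<in> I" "e0 \<in> F1 i'" "d \<in> set (pe i')" "c d \<noteq> 0" by blast
  have "i' = i" using fin_of[OF i'(1,2)] e0(2) by simp
  then have i: "i \<in> I" "e0 \<in> F1 i" "d \<in> set (pe i)" using i' by auto
  define P where "P j \<longleftrightarrow> (\<exists>f\<in>R. pe i ! j \<in> sides f)" for j
  have pass: "P j \<longleftrightarrow> P (Suc j)" if j: "Suc j < length (pe i)" for j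
  proof -
    let ?v = "pv i ! Suc j" and ?a = "pe i ! j" and ?b = "pe i ! Suc j"
    have l: "j < length (pe i)" "j < length (pv i)" "Suc j < length (pv i)" using j path_length[OF i(1)] by auto
    have "?a \<in> set (pe i)" "?b \<in> set (pe i)" using l j by auto
    then have S: "?a \<in> S1" "?b \<in> S1" and F: "?b \<in> F1 i" using path_sets(2)[OF i(1)] by blast+
    have fl: "(?v, ?a) \<in> flags" "(?v, ?b) \<in> flags"
      using flag_path_iff[OF i(1) l(1) l(3)] flag_path_iff[OF i(1) j l(3)] by auto
    have ne: "?a \<noteq> ?b"
    proof
      assume "?a = ?b"
      then show False using flag_path_iff[OF i(1) l(1) l(2)] flag_path_iff[OF i(1) j l(2)] by simp
    qed
    have only: "e = ?a \<or> e = ?b" if e: "e \<in> Bd" "(?v, e) \<in> flags" for e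
    proof -
      from Bd_fin[OF e(1)] obtain k where k: "k \<in> I" "e \<in> F1 k" by blast
      have "k \<le> i" using le[OF e(1)] fin_of[OF k] by simp
      have "\<not> k < i"
      proof
        assume "k < i"
        have "?v \<in> F0 k" using F_edge[OF k] e(2) by (auto simp: flags_def)
        moreover have "?v \<in> F0 i" using F_edge[OF i(1) F] fl(2) by (auto simp: flags_def)
        ultimately have "?v \<in> {hd (pv i), last (pv i)}" using F_order[OF i(1) k(1) \<open>k < i\<close>] by blast
        moreover have "pv i \<noteq> []" using l by auto
        ultimately have "?v = pv i ! 0 \<or> ?v = pv i ! length (pe i)"
          using path_length[OF i(1)] by (simp add: hd_conv_nth last_conv_nth)
        then show False
          using nth_eq_iff_index_eq[OF path_distinct[OF i(1)] l(3), of 0]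
            nth_eq_iff_index_eq[OF path_distinct[OF i(1)] l(3), of "length (pe i)"] path_length[OF i(1)] j by auto
      qed
      then have "k = i" using \<open>k \<le> i\<close> by simp
      then have "e \<in> set (pe i)" using k e(1) path_sets(2)[OF i(1)] by (auto simp: Bd_def)
      then have "e \<in> set (pe i) \<inter> edges_at K ?v" using e(2) by (simp add: flags_iff)
      then obtain m where "e = pe i ! m" "Suc j = m \<or> Suc j = Suc m" using path_edges_at[OF i(1) l(3)] by auto
      then show ?thesis by auto
    qed
    show ?thesis
    proof
      assume "P j"
      then show "P (Suc j)" unfolding P_def using Bd_passes_through[OF S(1) fl(1) S(2) fl(2) ne only] by blast
    next
      assume "P (Suc j)"
      moreover have "e = ?b \<or> e = ?a" if "e \<in> Bd" "(?v, e) \<in> flags" for e using only[OF that] by blast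
      ultimately show "P j" unfolding P_def
        using Bd_passes_through[OF S(2) fl(2) S(1) fl(1) ne[symmetric]] by blast
    qed
  qed
  have all: "P j \<longleftrightarrow> P 0" if "j < length (pe i)" for j
    using that by (induction j) (use pass in auto)
  have "e0 \<in> set (pe i)" using e0(1) i(2) path_sets(2)[OF i(1)] by (auto simp: Bd_def)
  then obtain j where "j < length (pe i)" "pe i ! j = e0" by (auto simp: in_set_conv_nth)
  moreover have "\<exists>f\<in>R. e0 \<in> sides f" using e0(1) by (simp add: Bd_def)
  ultimately have "P 0" using all[of j] by (simp add: P_def)
  moreover obtain j' where j': "j' < length (pe i)" "pe i ! j' = d" using i(3) by (auto simp: in_set_conv_nth)
  ultimately have "\<exists>f\<in>R. d \<in> sides f" using all[of j'] by (simp add: P_def)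
  then show False using i'(4) by (auto simp: R_def)
qed

section \<open>Counting sign changes\<close>

definition hit :: "'a \<Rightarrow> 'a \<Rightarrow> bool" where
  "hit v f \<longleftrightarrow> (\<exists>e\<in>sides f \<inter> edges_at K v. \<exists>e'\<in>sides f \<inter> edges_at K v. oriented c (v, e) * oriented c (v, e') < 0)"

definition zeros_at :: "'a \<Rightarrow> 'a set" where "zeros_at v = {e \<in> S1. (v, e) \<in> flags \<and> c e = 0}"

lemma sign_changes_of_facet:
  assumes f: "f \<in> S2"
  shows "card {v \<in> S0. hit v f} + card {e \<in> sides f. c e = 0} = 1"
proof -
  have fK: "f \<in> facets K" using f S_sub by blast
  note co = corner[OF fK] and d = vertices_distinct[OF fK] and s = sides_distinct[OF fK] and k = corners[OF fK]
  let ?p = "st (sd 1 f)" and ?q = "st (sd 0 f)" and ?r = "en (sd 0 f)"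
  let ?x = "c (sd 0 f)" and ?y = "c (sd 1 f)" and ?z = "c (sd 2 f)"
  \<comment> \<open>The outward values at the corners \<open>?p\<close>, \<open>?q\<close>,
    \<open>?r\<close> are (\<open>?y\<close>, \<open>?z\<close>), (\<open>?x\<close>,
    \<open>-?z\<close>) and (\<open>-?x\<close>, \<open>-?y\<close>).\<close>
  have cl: "?y = ?x + ?z" using closed[OF fK] by (simp add: closed_at_def)
  have S: "sd 0 f \<in> S1" "sd 1 f \<in> S1" "sd 2 f \<in> S1" using S_facet[OF f] by auto
  have V: "?p \<in> S0" "?q \<in> S0" "?r \<in> S0" using S_edge[OF S(1)] S_edge[OF S(2)] by auto
  have none: "\<not> hit v f" if "v \<notin> {?p, ?q, ?r}" for v
  proof -
    have "sides f \<inter> edges_at K v = {}" using that co by (auto simp: edges_at_eq)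
    then show ?thesis unfolding hit_def by blast
  qed
  have hp: "hit ?p f \<longleftrightarrow> ?y * ?z < 0"
    unfolding hit_def k using co d by (auto simp: oriented_def mult.commute not_less mult_less_0_iff)
  have hq: "hit ?q f \<longleftrightarrow> 0 < ?x * ?z"
    unfolding hit_def k using co d by (auto simp: oriented_def mult.commute not_less mult_less_0_iff zero_less_mult_iff)
  have hr: "hit ?r f \<longleftrightarrow> ?x * ?y < 0"
    unfolding hit_def k using co d by (auto simp: oriented_def mult.commute not_less mult_less_0_iff)
  have H: "{v \<in> S0. hit v f} = (if ?y * ?z < 0 then {?p} else {}) \<union> (if 0 < ?x * ?z then {?q} else {}) \<union> (if ?x * ?y < 0 then {?r} else {})"
  proof -
    have "{v \<in> S0. hit v f} = {v \<in> {?p, ?q, ?r}. hit v f}" using none V by blast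
    then show ?thesis using hp hq hr by auto
  qed
  have Z: "{e \<in> sides f. c e = 0} = (if ?x = 0 then {sd 0 f} else {}) \<union> (if ?y = 0 then {sd 1 f} else {}) \<union> (if ?z = 0 then {sd 2 f} else {})"
    by auto
  have nz: "?x \<noteq> 0 \<or> ?z \<noteq> 0" using facet_nonzero[OF f] cl by auto
  consider "?x = 0" | "?z = 0" | "0 < ?x" "0 < ?z" | "?x < 0" "?z < 0" | "0 < ?x" "?z < 0" "?y = 0"
    | "0 < ?x" "?z < 0" "?y < 0" | "0 < ?x" "?z < 0" "?y > 0" | "?x < 0" "0 < ?z" "?y = 0"
    | "?x < 0" "0 < ?z" "?y < 0" | "?x < 0" "0 < ?z" "?y > 0" by linarith
  then show ?thesis
    unfolding H Z by cases (use nz cl d s in \<open>auto simp: mult_less_0_iff zero_less_mult_iff\<close>)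
qed

lemma card_S1_S2: "2 * card S1 = 3 * card S2"
proof -
  have "2 * card S1 = (\<Sum>e\<in>S1. card {f \<in> S2. e \<in> sides f})" using degree by simp
  also have "\<dots> = (\<Sum>e\<in>S1. \<Sum>f\<in>{f \<in> S2. e \<in> sides f}. 1)" by simp
  also have "\<dots> = (\<Sum>f\<in>S2. \<Sum>e\<in>{e \<in> S1. e \<in> sides f}. 1)" by (rule sum.swap_restrict) (use finite_S in auto)
  also have "\<dots> = (\<Sum>f\<in>S2. 3)"
  proof (rule sum.cong[OF refl])
    fix f assume f: "f \<in> S2"
    then have "f \<in> facets K" using S_sub by blast
    note s = sides_distinct[OF this]
    have "{e \<in> S1. e \<in> sides f} = sides f" using S_facet[OF f] by blast
    moreover have "card (sides f) = 3" using s by simp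
    ultimately show "(\<Sum>e\<in>{e \<in> S1. e \<in> sides f}. 1::nat) = 3" by (simp only: card_eq_sum[symmetric])
  qed
  finally show ?thesis by simp
qed

lemma many_sign_changes:
  "\<exists>v\<in>S0. 3 \<le> card {f \<in> S2. hit v f} + card (zeros_at v)"
proof (rule ccontr)
  assume "\<not> ?thesis"
  then have le: "card {f \<in> S2. hit v f} + card (zeros_at v) \<le> 2" if "v \<in> S0" for v using that by force
  let ?Z = "{e \<in> S1. c e = 0}"
  have fZ: "finite ?Z" using finite_S by simp
  have "(\<Sum>v\<in>S0. card {f \<in> S2. hit v f}) = (\<Sum>v\<in>S0. \<Sum>f\<in>{f \<in> S2. hit v f}. 1)" by simp
  also have "\<dots> = (\<Sum>f\<in>S2. \<Sum>v\<in>{v \<in> S0. hit v f}. 1)" by (rule sum.swap_restrict) (use finite_S in auto)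
  also have "\<dots> = (\<Sum>f\<in>S2. card {v \<in> S0. hit v f})" by simp
  finally have 1: "(\<Sum>v\<in>S0. card {f \<in> S2. hit v f}) = (\<Sum>f\<in>S2. card {v \<in> S0. hit v f})" .
  have "(\<Sum>v\<in>S0. card (zeros_at v)) = (\<Sum>v\<in>S0. \<Sum>e\<in>{e \<in> ?Z. (v, e) \<in> flags}. 1)"
  proof (rule sum.cong[OF refl])
    fix v
    have "zeros_at v = {e \<in> ?Z. (v, e) \<in> flags}" by (auto simp: zeros_at_def)
    then show "card (zeros_at v) = (\<Sum>e\<in>{e \<in> ?Z. (v, e) \<in> flags}. 1)" by (simp only: card_eq_sum)
  qed
  also have "\<dots> = (\<Sum>e\<in>?Z. \<Sum>v\<in>{v \<in> S0. (v, e) \<in> flags}. 1)" by (rule sum.swap_restrict) (use finite_S in auto)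
  also have "\<dots> = (\<Sum>e\<in>?Z. 2)"
  proof (rule sum.cong[OF refl])
    fix e assume "e \<in> ?Z"
    then have e: "e \<in> S1" "e \<in> edges K" using S_sub by auto
    have "{v \<in> S0. (v, e) \<in> flags} = {st e, en e}" using S_edge[OF e(1)] e(2) by (auto simp: flags_def)
    then have "card {v \<in> S0. (v, e) \<in> flags} = 2" using st_neq_en[OF e(2)] by simp
    then show "(\<Sum>v\<in>{v \<in> S0. (v, e) \<in> flags}. 1::nat) = 2" by (simp only: card_eq_sum)
  qed
  \<comment> \<open>Here the two ends of a zero edge are exchanged for its two facets.\<close>
  also have "\<dots> = (\<Sum>e\<in>?Z. card {f \<in> S2. e \<in> sides f})" by (rule sum.cong[OF refl]) (use degree in simp)
  also have "\<dots> = (\<Sum>e\<in>?Z. \<Sum>f\<in>{f \<in> S2. e \<in> sides f}. 1)" by simp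
  also have "\<dots> = (\<Sum>f\<in>S2. \<Sum>e\<in>{e \<in> ?Z. e \<in> sides f}. 1)" by (rule sum.swap_restrict[OF fZ]) (use finite_S in auto)
  also have "\<dots> = (\<Sum>f\<in>S2. card {e \<in> sides f. c e = 0})"
  proof (rule sum.cong[OF refl])
    fix f assume "f \<in> S2"
    then have "{e \<in> ?Z. e \<in> sides f} = {e \<in> sides f. c e = 0}" using S_facet by blast
    then show "(\<Sum>e\<in>{e \<in> ?Z. e \<in> sides f}. 1::nat) = card {e \<in> sides f. c e = 0}" by (simp only: card_eq_sum[symmetric])
  qed
  finally have 2: "(\<Sum>v\<in>S0. card (zeros_at v)) = (\<Sum>f\<in>S2. card {e \<in> sides f. c e = 0})" .
  have "card S2 = (\<Sum>f\<in>S2. card {v \<in> S0. hit v f} + card {e \<in> sides f. c e = 0})"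
    using sign_changes_of_facet by simp
  also have "\<dots> = (\<Sum>v\<in>S0. card {f \<in> S2. hit v f} + card (zeros_at v))"
    by (simp only: sum.distrib 1 2)
  also have "\<dots> \<le> (\<Sum>v\<in>S0. 2)" by (rule sum_mono) (rule le)
  finally have "card S2 \<le> 2 * card S0" by simp
  then show False using chi card_S1_S2 by simp
qed

end

section \<open>Sign changes at a vertex\<close>

locale harmonic_vertex = harmonic_surface K \<alpha> S0 S1 S2 I F0 F1 F2 pv pe c
  for K :: "'a delta_data" and \<alpha> S0 S1 S2 I F0 F1 F2 pv pe c +
  fixes v :: 'a
  assumes v: "v \<in> S0"
begin

abbreviation E :: "'a set" where "E \<equiv> edges_at K v"
abbreviation \<psi> :: "'a \<Rightarrow> real" where "\<psi> e \<equiv> oriented c (v, e)"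

text \<open>The link of \<open>v\<close> in the surface is a cycle, on which \<open>\<psi>\<close> changes sign at the elements of \<open>BD\<close>:
  across a facet, or at an edge on which it vanishes.  Each sign change \<open>x\<close> has two sides \<open>G x\<close>, given by a
  facet \<open>f\<close> and an edge of \<open>f\<close> at which \<open>\<psi>\<close> is nonzero, and \<open>H\<close> is the set of all sides.  \<open>Iv\<close> is the pair
  of path edges at \<open>v\<close> of the only fin, if any, whose path has two edges there.\<close>

definition same :: "('a \<times> 'a) set" where
  "same = {(e, e'). \<exists>f\<in>S2. e \<in> sides f \<inter> E \<and> e' \<in> sides f \<inter> E \<and> 0 < \<psi> e * \<psi> e'}"

definition arc :: "'a \<Rightarrow> 'a set" where "arc e = same\<^sup>* `` {e}"

definition H :: "('a \<times> 'a) set" where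
  "H = {(f, e). f \<in> S2 \<and> e \<in> sides f \<inter> E \<and> \<psi> e \<noteq> 0 \<and> (\<forall>e'\<in>sides f \<inter> E - {e}. \<psi> e * \<psi> e' \<le> 0)}"

definition BD :: "('a + 'a) set" where "BD = Inl ` {f \<in> S2. hit v f} \<union> Inr ` zeros_at v"

definition G :: "'a + 'a \<Rightarrow> ('a \<times> 'a) set" where
  "G x = (case x of Inl f \<Rightarrow> {f} \<times> (sides f \<inter> E) | Inr z \<Rightarrow> {(f, e). f \<in> S2 \<and> z \<in> sides f \<and> e \<in> sides f \<inter> E - {z}})"

definition Iv :: "'a set" where
  "Iv = (\<Union>k\<in>{k \<in> I. 2 \<le> card (set (pe k) \<inter> E)}. set (pe k) \<inter> E)"

section \<open>Arcs and sides of sign changes\<close>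

lemma corner_pair:
  assumes "f \<in> S2" "e \<in> sides f \<inter> E"
  shows "\<exists>e'. e' \<noteq> e \<and> sides f \<inter> E = {e, e'}"
proof -
  have "f \<in> facets K" using assms S_sub by blast
  then obtain e' where e': "sides f \<inter> E - {e} = {e'}"
    using third_side[of f e v] assms(2) unfolding flags_iff by blast
  have "insert e (sides f \<inter> E - {e}) = sides f \<inter> E" by (rule insert_Diff[OF assms(2)])
  then have "sides f \<inter> E = {e, e'}" by (simp only: e')
  moreover have "e' \<in> sides f \<inter> E - {e}" unfolding e' by (rule singletonI)
  then have "e' \<noteq> e" by blast
  ultimately show ?thesis by blast
qed

lemma corner_eq:
  assumes f: "f \<in> S2" "x \<in> sides f \<inter> E" "y \<in> sides f \<inter> E" and ne: "x \<noteq> y"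
  shows "sides f \<inter> E = {x, y}"
proof -
  obtain z where z: "sides f \<inter> E = {x, z}" using corner_pair[OF f(1,2)] by (elim exE conjE)
  have "y \<in> {x, z}" using f(3) unfolding z .
  then have "y = z" using ne by simp
  then show ?thesis using z by (simp only:)
qed

lemma corner_S1: "f \<in> S2 \<Longrightarrow> e \<in> sides f \<Longrightarrow> e \<in> S1"
  using S_facet by blast

text \<open>Two zero sides make the third one zero by closedness, against
  \<open>facet_nonzero\<close>.\<close>

lemma corner_nonzero:
  assumes f: "f \<in> S2" "z \<in> sides f \<inter> E" "e \<in> sides f \<inter> E" "e \<noteq> z" "c z = 0"
  shows "\<psi> e \<noteq> 0"
proof
  assume "\<psi> e = 0"
  then have "c e = 0" by (simp add: oriented_eq_0_iff)
  moreover have "f \<in> facets K" using f S_sub by blast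
  moreover have "z \<in> sides f" "e \<in> sides f" using f by blast+
  ultimately have "c d = 0" if "d \<in> sides f" for d using two_zero_sides[of f z e d] that f(4,5) by simp
  then show False using facet_nonzero[OF f(1)] by blast
qed

lemma arc_self: "e \<in> arc e" by (simp add: arc_def)

lemma same_arc: "(x, y) \<in> same \<Longrightarrow> x \<in> arc e \<Longrightarrow> y \<in> arc e"
  unfolding arc_def by (auto intro: rtrancl_into_rtrancl)

lemma sym_same: "sym same"
  unfolding same_def sym_def by (auto simp: mult.commute)

lemma arc_sym: "y \<in> arc x \<Longrightarrow> x \<in> arc y"
  using sym_rtrancl[OF sym_same] unfolding arc_def by (auto dest: symD)

lemma arc_sign:
  assumes "\<psi> e \<noteq> 0" "x \<in> arc e"
  shows "0 < \<psi> e * \<psi> x"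
proof -
  have "(e, x) \<in> same\<^sup>*" using assms(2) by (simp add: arc_def)
  then show ?thesis
  proof (induction rule: rtrancl_induct)
    case base
    show ?case unfolding zero_less_mult_iff using assms(1) by linarith
  next
    case (step y z)
    have "0 < \<psi> y * \<psi> z" using step(2) by (auto simp: same_def)
    then show ?case using step(3) unfolding zero_less_mult_iff by linarith
  qed
qed

lemma arc_S1:
  assumes "e \<in> S1 \<inter> E"
  shows "arc e \<subseteq> S1 \<inter> E"
proof
  fix x assume "x \<in> arc e"
  then have "(e, x) \<in> same\<^sup>*" by (simp add: arc_def)
  then show "x \<in> S1 \<inter> E"
  proof (induction rule: rtrancl_induct)
    case (step y z)
    then show ?case using corner_S1 by (auto simp: same_def)
  qed (rule assms)
qed

text \<open>The facets in \<open>U\<close> are the edges of a connected graph on \<open>arc e\<close>: a function on the arc that vanishes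
  at \<open>e\<close> and takes equal values across each of them is zero.\<close>

lemma card_arc:
  assumes e: "e \<in> S1 \<inter> E" and U: "U = {f \<in> S2. \<exists>x\<in>arc e. \<exists>y\<in>arc e. x \<noteq> y \<and> x \<in> sides f \<and> y \<in> sides f}"
  shows "card (arc e) \<le> Suc (card U)"
proof (rule ccontr)
  assume lt: "\<not> ?thesis"
  have sub: "arc e \<subseteq> E" using arc_S1[OF e] by blast
  have fin: "finite (arc e)" "finite U" using finite_subset[OF sub finite_edges_at] finite_S U by auto
  have "\<forall>f\<in>U. \<exists>p. fst p \<in> arc e \<and> snd p \<in> arc e \<and> fst p \<noteq> snd p \<and> sides f \<inter> E = {fst p, snd p}"
  proof
    fix f assume "f \<in> U"
    then obtain x y where xy: "f \<in> S2" "x \<in> arc e" "y \<in> arc e" "x \<noteq> y" "x \<in> sides f" "y \<in> sides f" unfolding U by blast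
    have "sides f \<inter> E = {x, y}" by (rule corner_eq[OF xy(1) _ _ xy(4)]) (use xy sub in blast)+
    then show "\<exists>p. fst p \<in> arc e \<and> snd p \<in> arc e \<and> fst p \<noteq> snd p \<and> sides f \<inter> E = {fst p, snd p}"
      using xy(2-4) by (intro exI[of _ "(x, y)"]) (simp only: fst_conv snd_conv simp_thms)
  qed
  from bchoice[OF this] obtain p where
    p: "\<And>f. f \<in> U \<Longrightarrow> fst (p f) \<in> arc e \<and> snd (p f) \<in> arc e \<and> fst (p f) \<noteq> snd (p f) \<and> sides f \<inter> E = {fst (p f), snd (p f)}"
    by blast
  \<comment> \<open>\<open>None\<close> demands the value 0 at \<open>e\<close>,
    \<open>Some f\<close> equality across \<open>f\<close>. With too few facets a nonzero solution
    would exist, but along \<open>same\<close> the value 0 spreads over the arc.\<close>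
  let ?Q = "insert None (Some ` U)"
  let ?L = "\<lambda>q z. case q of None \<Rightarrow> z e | Some f \<Rightarrow> z (fst (p f)) - z (snd (p f))"
  have finQ: "finite ?Q" using fin by simp
  have "card ?Q = Suc (card U)" using fin by (simp add: card_image)
  then have cQ: "card ?Q < card (arc e)" using lt by simp
  have lin: "linear_functional (?L q)" for q
    by (cases q) (auto intro!: linear_functional_eval linear_functional_diff)
  show False
  proof (rule homogeneous_system[OF finQ fin(1) cQ lin])
    fix z :: "'a \<Rightarrow> real" assume z: "\<exists>u\<in>arc e. z u \<noteq> 0" "\<forall>q\<in>?Q. ?L q z = 0"
    have z0: "z e = 0" using bspec[OF z(2), of None] by simp
    have eq: "z (fst (p f)) = z (snd (p f))" if "f \<in> U" for f using bspec[OF z(2), of "Some f"] that by simp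
    have "x \<in> arc e \<and> z x = 0" if "(e, x) \<in> same\<^sup>*" for x
      using that
    proof (induction rule: rtrancl_induct)
      case base
      then show ?case using z0 arc_self by simp
    next
      case (step x y)
      have y: "y \<in> arc e" using same_arc[OF step(2)] step(3) by blast
      have "z y = z x"
      proof (cases "x = y")
        case False
        obtain f where f: "f \<in> S2" "x \<in> sides f \<inter> E" "y \<in> sides f \<inter> E" using step(2) by (auto simp: same_def)
        have "f \<in> U" unfolding U using f y step(3) False by blast
        have pf: "sides f \<inter> E = {fst (p f), snd (p f)}" using p[OF \<open>f \<in> U\<close>] by (elim conjE)
        have "x \<in> {fst (p f), snd (p f)}" "y \<in> {fst (p f), snd (p f)}" using f(2,3) unfolding pf by -
        then show ?thesis using eq[OF \<open>f \<in> U\<close>] by auto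
      qed simp
      then show ?case using y step(3) by simp
    qed
    then have "z x = 0" if "x \<in> arc e" for x using that unfolding arc_def by blast
    then show False using z(1) by blast
  qed
qed

text \<open>An arc of n edges has 2n incidences with surface facets. At least n - 1 facets have both
  of their edges at \<open>v\<close> in the arc and absorb two incidences each, which leaves at most
  2 for the ends of the arc.\<close>

lemma card_half_edges_arc:
  assumes e: "e \<in> S1 \<inter> E" "\<psi> e \<noteq> 0"
  shows "card {h \<in> H. snd h \<in> arc e} \<le> 2"
proof -
  define U where "U = {f \<in> S2. \<exists>x\<in>arc e. \<exists>y\<in>arc e. x \<noteq> y \<and> x \<in> sides f \<and> y \<in> sides f}"
  note sub = arc_S1[OF e(1)]
  have fa: "finite (arc e)" using finite_subset[OF sub] finite_edges_at by simp
  have fU: "finite U" using finite_S by (simp add: U_def)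
  let ?B = "{h \<in> H. snd h \<in> arc e}" and ?W = "SIGMA f:U. sides f \<inter> E"
  let ?T = "prod.swap ` (SIGMA x:arc e. {f \<in> S2. x \<in> sides f})"
  have finT: "finite ?T" using fa finite_S by (intro finite_imageI finite_SigmaI) auto
  have cT: "card ?T = 2 * card (arc e)"
  proof -
    have "card ?T = card (SIGMA x:arc e. {f \<in> S2. x \<in> sides f})" by (rule card_image) simp
    also have "\<dots> = (\<Sum>x\<in>arc e. card {f \<in> S2. x \<in> sides f})" using fa finite_S by (intro card_SigmaI) auto
    also have "\<dots> = (\<Sum>x\<in>arc e. 2)"
      by (rule sum.cong[OF refl], rule degree) (use sub in blast)
    finally show ?thesis by simp
  qed
  have UW: "\<exists>x y. x \<in> arc e \<and> y \<in> arc e \<and> x \<noteq> y \<and> sides f \<inter> E = {x, y}" if "f \<in> U" for f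
  proof -
    obtain x y where xy: "f \<in> S2" "x \<in> arc e" "y \<in> arc e" "x \<noteq> y" "x \<in> sides f" "y \<in> sides f"
      using \<open>f \<in> U\<close> unfolding U_def by blast
    have "sides f \<inter> E = {x, y}" by (rule corner_eq[OF xy(1) _ _ xy(4)]) (use xy sub in blast)+
    then show ?thesis using xy(2-4) by (intro exI conjI)
  qed
  have finW: "finite ?W" using fU finite_edges_at by (intro finite_SigmaI) auto
  have cW: "card ?W = 2 * card U"
  proof -
    have "card ?W = (\<Sum>f\<in>U. card (sides f \<inter> E))" using fU finite_edges_at by (intro card_SigmaI) auto
    also have "\<dots> = (\<Sum>f\<in>U. 2)"
    proof (rule sum.cong[OF refl])
      fix f assume "f \<in> U"
      from UW[OF this] obtain x y where "x \<noteq> y" "sides f \<inter> E = {x, y}" by (elim exE conjE)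
      then show "card (sides f \<inter> E) = 2" by (simp only: card_2_iff) blast
    qed
    finally show ?thesis by simp
  qed
  have BT: "?B \<subseteq> ?T"
  proof
    fix h assume h: "h \<in> ?B"
    then have "prod.swap h \<in> (SIGMA x:arc e. {f \<in> S2. x \<in> sides f})" by (cases h) (auto simp: H_def)
    from imageI[OF this, of prod.swap] show "h \<in> ?T" by simp
  qed
  have WT: "?W \<subseteq> ?T"
  proof
    fix h assume h: "h \<in> ?W"
    obtain f x where hf: "h = (f, x)" "f \<in> U" "x \<in> sides f \<inter> E" using h by blast
    obtain p q where pq: "p \<in> arc e" "q \<in> arc e" "sides f \<inter> E = {p, q}" using UW[OF hf(2)] by (elim exE conjE)
    have "x \<in> {p, q}" using hf(3) unfolding pq(3) .
    then have "x \<in> arc e" "f \<in> S2" using pq(1,2) hf(2) by (auto simp: U_def)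
    then have "prod.swap h \<in> (SIGMA x:arc e. {f \<in> S2. x \<in> sides f})" using hf by auto
    from imageI[OF this, of prod.swap] show "h \<in> ?T" by simp
  qed
  have disj: "?B \<inter> ?W = {}"
  proof (rule ccontr)
    assume "?B \<inter> ?W \<noteq> {}"
    then obtain f x where h: "(f, x) \<in> H" "f \<in> U" "x \<in> sides f \<inter> E" by blast
    obtain p q where pq: "p \<in> arc e" "q \<in> arc e" "p \<noteq> q" "sides f \<inter> E = {p, q}" using UW[OF h(2)] by (elim exE conjE)
    have "x \<in> {p, q}" using h(3) unfolding pq(4) .
    then obtain x' where x': "x \<in> arc e" "x' \<in> arc e" "x' \<in> sides f \<inter> E - {x}" unfolding pq(4) using pq(1-3) by blast
    have "\<psi> x * \<psi> x' \<le> 0" using h(1) x'(3) by (simp add: H_def)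
    then show False using arc_sign[OF e(2) x'(1)] arc_sign[OF e(2) x'(2)]
      by (auto simp: zero_less_mult_iff mult_le_0_iff)
  qed
  have "card ?B + card ?W = card (?B \<union> ?W)"
    using card_Un_disjoint[OF finite_subset[OF BT finT] finW disj] by simp
  also have "\<dots> \<le> card ?T" using BT WT finT by (intro card_mono) auto
  also have "\<dots> \<le> 2 * Suc (card U)" unfolding cT using card_arc[OF e(1) U_def] by simp
  finally show ?thesis unfolding cW by simp
qed

lemma hit_pair:
  assumes "f \<in> S2" "hit v f"
  shows "\<exists>e e'. e \<noteq> e' \<and> sides f \<inter> E = {e, e'} \<and> \<psi> e * \<psi> e' < 0"
proof -
  obtain e e' where e: "e \<in> sides f \<inter> E" "e' \<in> sides f \<inter> E" "\<psi> e * \<psi> e' < 0"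
    using assms(2) unfolding hit_def by blast
  have "e \<noteq> e'" using e(3) by (auto simp: mult_less_0_iff)
  then show ?thesis using corner_eq[OF assms(1) e(1,2)] e(3) by (intro exI conjI)
qed

lemma zeros_at_corner: "z \<in> zeros_at v \<Longrightarrow> z \<in> S1 \<inter> E \<and> c z = 0 \<and> \<psi> z = 0"
  by (auto simp: zeros_at_def flags_iff oriented_eq_0_iff)

lemma G_H: "x \<in> BD \<Longrightarrow> G x \<subseteq> H"
proof
  fix h assume x: "x \<in> BD" "h \<in> G x"
  obtain f e where h: "h = (f, e)" by (cases h)
  show "h \<in> H"
  proof (cases x)
    case (Inl f')
    then have f: "f' = f" "f \<in> S2" "hit v f" "e \<in> sides f \<inter> E" using x h by (auto simp: BD_def G_def)
    obtain p q where pq: "p \<noteq> q" "sides f \<inter> E = {p, q}" "\<psi> p * \<psi> q < 0" using hit_pair[OF f(2,3)] by (elim exE conjE)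
    have "e \<in> {p, q}" using f(4) unfolding pq(2) .
    then have "e = p \<or> e = q" by simp
    then have "\<psi> e \<noteq> 0 \<and> (\<forall>e'\<in>sides f \<inter> E - {e}. \<psi> e * \<psi> e' \<le> 0)"
      unfolding pq(2) using pq(1,3) by (auto simp: mult.commute)
    then show ?thesis using f h unfolding H_def by blast
  next
    case (Inr z)
    then have z: "z \<in> zeros_at v" "f \<in> S2" "z \<in> sides f" "e \<in> sides f \<inter> E" "e \<noteq> z" using x h by (auto simp: BD_def G_def)
    note zz = zeros_at_corner[OF z(1)]
    have "\<psi> e \<noteq> 0" using corner_nonzero[OF z(2) _ z(4,5)] zz z(3) by blast
    moreover have "sides f \<inter> E = {e, z}"
      by (rule corner_eq[OF z(2,4)]) (use zz z in blast)+
    then have "\<forall>e'\<in>sides f \<inter> E - {e}. \<psi> e * \<psi> e' \<le> 0" using zz by (simp only:) simp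
    ultimately show ?thesis using z(2,4) h unfolding H_def by blast
  qed
qed

lemma card_G: "x \<in> BD \<Longrightarrow> card (G x) = 2"
proof -
  assume x: "x \<in> BD"
  show ?thesis
  proof (cases x)
    case (Inl f)
    then have f: "f \<in> S2" "hit v f" using x by (auto simp: BD_def)
    obtain p q where pq: "p \<noteq> q" "sides f \<inter> E = {p, q}" using hit_pair[OF f] by (elim exE conjE)
    then have "card (sides f \<inter> E) = 2" by (simp only: card_2_iff) blast
    then show ?thesis unfolding Inl G_def by (simp only: sum.case card_cartesian_product_singleton)
  next
    case (Inr z)
    then have z: "z \<in> zeros_at v" using x by (auto simp: BD_def)
    note zz = zeros_at_corner[OF z]
    obtain f g where fg: "f \<noteq> g" "{f \<in> S2. z \<in> sides f} = {f, g}" using two_facets[of z] zz by blast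
    have f: "f \<in> S2" "z \<in> sides f \<inter> E" and g: "g \<in> S2" "z \<in> sides g \<inter> E" using fg(2) zz by blast+
    obtain p where p: "p \<noteq> z" "sides f \<inter> E = {z, p}" using corner_pair[OF f] by (elim exE conjE)
    obtain q where q: "q \<noteq> z" "sides g \<inter> E = {z, q}" using corner_pair[OF g] by (elim exE conjE)
    have "G x = {(f, p), (g, q)}"
    proof (rule Set.set_eqI)
      fix h :: "'a \<times> 'a"
      obtain h1 h2 where h: "h = (h1, h2)" by (cases h)
      have "h \<in> G x \<longleftrightarrow> h1 \<in> {f \<in> S2. z \<in> sides f} \<and> h2 \<in> sides h1 \<inter> E - {z}"
        unfolding h Inr G_def sum.case mem_Collect_eq prod.case by (simp only: conj_assoc)
      also have "\<dots> \<longleftrightarrow> (h1 = f \<and> h2 \<in> sides f \<inter> E - {z}) \<or> (h1 = g \<and> h2 \<in> sides g \<inter> E - {z})"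
        unfolding fg(2) by blast
      also have "\<dots> \<longleftrightarrow> h \<in> {(f, p), (g, q)}" unfolding h p(2) q(2) using p(1) q(1) by auto
      finally show "h \<in> G x \<longleftrightarrow> h \<in> {(f, p), (g, q)}" .
    qed
    then show ?thesis using fg(1) by simp
  qed
qed

text \<open>A side fixes a facet and one of its two edges at \<open>v\<close>; whether the other
  edge is a zero edge or has the opposite sign determines the sign change.\<close>

lemma G_disjoint:
  assumes "x \<in> BD" "y \<in> BD" "x \<noteq> y"
  shows "G x \<inter> G y = {}"
proof (rule ccontr)
  assume "\<not> ?thesis"
  then obtain f e where h: "(f, e) \<in> G x" "(f, e) \<in> G y" by auto
  have mixed: False if z: "z \<in> zeros_at v" "(f, e) \<in> G (Inr z)" and g: "Inl g \<in> BD" "(f, e) \<in> G (Inl g)" for z g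
  proof -
    have g: "g = f" "f \<in> S2" "hit v f" using g by (auto simp: G_def BD_def)
    obtain p q where pq: "sides f \<inter> E = {p, q}" "\<psi> p * \<psi> q < 0" using hit_pair[OF g(2,3)] by (elim exE conjE)
    have "z \<in> sides f \<inter> E" "\<psi> z = 0" using z zeros_at_corner[OF z(1)] by (auto simp: G_def)
    then have "z \<in> {p, q}" unfolding pq(1) by -
    then show False using pq(2) \<open>\<psi> z = 0\<close> by auto
  qed
  show False
  proof (cases x)
    case (Inl f1)
    show False
    proof (cases y)
      case (Inl f2)
      then show False using h \<open>x = Inl f1\<close> assms(3) by (auto simp: G_def)
    next
      case (Inr z)
      then have "z \<in> zeros_at v" using assms by (auto simp: BD_def)
      then show False using mixed[of z f1] h assms(1) \<open>x = Inl f1\<close> Inr by simp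
    qed
  next
    case (Inr z)
    then have z: "z \<in> zeros_at v" using assms by (auto simp: BD_def)
    show False
    proof (cases y)
      case (Inl f2)
      then show False using mixed[of z f2] h z assms(2) \<open>x = Inr z\<close> by simp
    next
      case (Inr z')
      have z': "z' \<in> zeros_at v" using Inr assms by (auto simp: BD_def)
      have f: "f \<in> S2" "e \<in> sides f \<inter> E" "z \<in> sides f" "z' \<in> sides f" "z \<noteq> e" "z' \<noteq> e"
        using h \<open>x = Inr z\<close> Inr by (auto simp: G_def)
      have zE: "z \<in> sides f \<inter> E" "z' \<in> sides f \<inter> E" using f zeros_at_corner[OF z] zeros_at_corner[OF z'] by blast+
      have "z' \<in> {z, e}" using zE(2) unfolding corner_eq[OF f(1) zE(1) f(2,5)] .
      then have "z = z'" using f(6) by simp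
      then show False using assms(3) \<open>x = Inr z\<close> Inr by simp
    qed
  qed
qed

text \<open>If two fins had two path edges each at \<open>v\<close>, then for the later one
  \<open>v\<close> would be shared with an earlier fin, hence an endpoint of its path, where only
  one path edge ends.\<close>

lemma card_Iv: "card Iv \<le> 2"
proof (cases "\<exists>k\<in>I. 2 \<le> card (set (pe k) \<inter> E)")
  case False
  then have "Iv = {}" by (auto simp: Iv_def)
  then show ?thesis by simp
next
  case True
  then obtain k where k: "k \<in> I" "2 \<le> card (set (pe k) \<inter> E)" by blast
  have inF: "v \<in> F0 j" if j: "j \<in> I" "2 \<le> card (set (pe j) \<inter> E)" for j
  proof -
    have "set (pe j) \<inter> E \<noteq> {}" using j(2) by auto
    then obtain e where e: "e \<in> set (pe j)" "e \<in> E" by blast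
    then have "e \<in> F1 j" "(v, e) \<in> flags" using path_sets(2)[OF j(1)] by (auto simp: flags_iff)
    then show ?thesis using F_edge[OF j(1), of e] by (auto simp: flags_def)
  qed
  have uniq: False if jk: "j \<in> I" "2 \<le> card (set (pe j) \<inter> E)" "l \<in> I" "2 \<le> card (set (pe l) \<inter> E)" "j < l" for j l
  proof -
    have "v \<in> {hd (pv l), last (pv l)}" using F_order[OF jk(3,1,5)] inF[OF jk(1,2)] inF[OF jk(3,4)] by blast
    from card_path_edges_at_endpoint[OF jk(3) this] show False using jk(4) by simp
  qed
  have "j = k" if "j \<in> I" "2 \<le> card (set (pe j) \<inter> E)" for j
    using uniq[OF that k] uniq[OF k that] by (cases j k rule: linorder_cases) auto
  then have "{k \<in> I. 2 \<le> card (set (pe k) \<inter> E)} = {k}" using k by blast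
  then have "Iv = set (pe k) \<inter> E" unfolding Iv_def by simp
  then show ?thesis using card_path_edges_at[OF k(1)] by simp
qed

text \<open>Arcs through the at most two edges of \<open>Iv\<close> carry at most four of the six or
  more sides. An arc through a remaining side carries at most two sides in all and thus misses one
  of the sign changes.\<close>

lemma free_arc:
  assumes "3 \<le> card BD"
  shows "\<exists>e. e \<in> S1 \<inter> E \<and> \<psi> e \<noteq> 0 \<and> arc e \<inter> Iv = {} \<and> (\<exists>x\<in>BD. \<exists>h\<in>G x. snd h \<in> arc e) \<and>
    (\<exists>x\<in>BD. \<forall>h\<in>G x. snd h \<notin> arc e)"
proof -
  have finBD: "finite BD" using assms card.infinite by fastforce
  have finG: "finite (G x)" if "x \<in> BD" for x using card_G[OF that] card.infinite by fastforce
  have cU: "card (\<Union>x\<in>BD. G x) = 2 * card BD"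
    using card_UN_disjoint[OF finBD, of G] finG G_disjoint card_G by simp
  have "\<exists>x\<in>BD. \<exists>h\<in>G x. arc (snd h) \<inter> Iv = {}"
  proof (rule ccontr)
    assume no: "\<not> ?thesis"
    let ?J = "{i \<in> Iv. i \<in> S1 \<inter> E \<and> \<psi> i \<noteq> 0}"
    have finIv: "finite Iv"
    proof -
      have "Iv \<subseteq> E" by (auto simp: Iv_def)
      then show ?thesis using finite_edges_at finite_subset by blast
    qed
    have sub: "(\<Union>x\<in>BD. G x) \<subseteq> (\<Union>i\<in>?J. {h \<in> H. snd h \<in> arc i})"
    proof
      fix h assume "h \<in> (\<Union>x\<in>BD. G x)"
      then obtain x where x: "x \<in> BD" "h \<in> G x" by blast
      then have h: "h \<in> H" using G_H by blast
      obtain i where i: "i \<in> arc (snd h)" "i \<in> Iv" using no x by blast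
      have hp: "snd h \<in> S1 \<inter> E" "\<psi> (snd h) \<noteq> 0" using h corner_S1 by (auto simp: H_def)
      have "i \<in> S1 \<inter> E" using arc_S1[OF hp(1)] i(1) by blast
      moreover have "\<psi> i \<noteq> 0" using arc_sign[OF hp(2) i(1)] by auto
      ultimately have "i \<in> ?J" using i(2) by simp
      then show "h \<in> (\<Union>i\<in>?J. {h \<in> H. snd h \<in> arc i})" using h arc_sym[OF i(1)] by blast
    qed
    have finH: "finite {h \<in> H. snd h \<in> arc i}" for i
    proof (rule finite_subset)
      show "{h \<in> H. snd h \<in> arc i} \<subseteq> S2 \<times> E" by (auto simp: H_def)
      show "finite (S2 \<times> E)" using finite_S finite_edges_at by simp
    qed
    have "card (\<Union>x\<in>BD. G x) \<le> card (\<Union>i\<in>?J. {h \<in> H. snd h \<in> arc i})"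
      by (rule card_mono[OF _ sub]) (intro finite_UN_I finH, use finIv in simp)
    also have "\<dots> \<le> (\<Sum>i\<in>?J. card {h \<in> H. snd h \<in> arc i})" by (rule card_UN_le) (use finIv in simp)
    also have "\<dots> \<le> (\<Sum>i\<in>?J. 2)" by (rule sum_mono, rule card_half_edges_arc) auto
    also have "\<dots> \<le> 2 * card Iv" using card_mono[OF finIv, of ?J] by simp
    also have "\<dots> \<le> 4" using card_Iv by simp
    finally show False using cU assms by simp
  qed
  then obtain x h where x: "x \<in> BD" "h \<in> G x" "arc (snd h) \<inter> Iv = {}" by blast
  let ?e = "snd h"
  have hH: "h \<in> H" using x G_H by blast
  then have e: "?e \<in> S1 \<inter> E" "\<psi> ?e \<noteq> 0" using corner_S1 by (auto simp: H_def)
  have "\<exists>x\<in>BD. \<forall>h\<in>G x. snd h \<notin> arc ?e"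
  proof (rule ccontr)
    assume "\<not> ?thesis"
    then have "\<forall>x\<in>BD. \<exists>h. h \<in> G x \<and> snd h \<in> arc ?e" by blast
    from bchoice[OF this] obtain g where g: "\<And>x. x \<in> BD \<Longrightarrow> g x \<in> G x \<and> snd (g x) \<in> arc ?e" by blast
    have "card BD \<le> card {h \<in> H. snd h \<in> arc ?e}"
    proof (rule card_inj_on_le)
      show "inj_on g BD"
      proof (rule inj_onI)
        fix x y assume xy: "x \<in> BD" "y \<in> BD" "g x = g y"
        have "g x \<in> G x" "g x \<in> G y" using g[OF xy(1)] g[OF xy(2)] xy(3) by auto
        then have "G x \<inter> G y \<noteq> {}" by blast
        then show "x = y" using G_disjoint[OF xy(1,2)] by blast
      qed
      show "g ` BD \<subseteq> {h \<in> H. snd h \<in> arc ?e}" using g G_H by blast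
      have "{h \<in> H. snd h \<in> arc ?e} \<subseteq> S2 \<times> E" by (auto simp: H_def)
      then show "finite {h \<in> H. snd h \<in> arc ?e}" by (rule finite_subset) (use finite_S finite_edges_at in simp)
    qed
    then show False using card_half_edges_arc[OF e] assms by simp
  qed
  then show ?thesis using e x arc_self by blast
qed

end

section \<open>The plane given by an arc and the positive part\<close>

context harmonic_vertex
begin

abbreviation m :: "'a \<Rightarrow> 'a \<Rightarrow> real" where "m e e' \<equiv> real_of_int (local_intersection K \<alpha> v e e')"

lemma m_M: "m e e' = M (v, e) (v, e')" by (simp add: M_def)

lemma row_sum:
  assumes "e \<in> E"
  shows "(\<Sum>e'\<in>E. m e e' * y (v, e')) = row y (v, e)"
proof -
  have "row y (v, e) = (\<Sum>b\<in>Pair v ` E. M (v, e) b * y b)"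
    unfolding row_def by (rule sum.mono_neutral_right[OF finite_flags]) (auto simp: flags_iff M_def)
  then show ?thesis by (simp add: sum.reindex inj_on_def m_M)
qed

lemma kernel: "e \<in> E \<Longrightarrow> (\<Sum>e'\<in>E. m e e' * \<psi> e') = 0"
  using row_sum[of e "oriented c"] harm[of "(v, e)"] by (simp add: flags_iff)

lemma m_nonneg: "e \<noteq> e' \<Longrightarrow> 0 \<le> m e e'"
  unfolding m_M by (rule M_nonneg) simp

lemma m_pos: "f \<in> facets K \<Longrightarrow> e \<in> sides f \<inter> E \<Longrightarrow> e' \<in> sides f \<inter> E \<Longrightarrow> e \<noteq> e' \<Longrightarrow> 0 < m e e'"
  unfolding m_M by (rule M_pos) (auto simp: adj_def flags_iff)

lemma m_facet:
  assumes "e \<in> E" "e' \<in> E" "e \<noteq> e'" "m e e' \<noteq> 0"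
  shows "\<exists>f\<in>facets K. e \<in> sides f \<and> e' \<in> sides f"
proof -
  have "((v, e), (v, e')) \<in> adj" using M_nonzero[of "(v, e)" "(v, e')"] assms m_M by (auto simp: flags_iff)
  then show ?thesis unfolding adj_def by blast
qed

lemma two_reals_dependent:
  fixes p q :: real
  shows "\<exists>s t. (s, t) \<noteq> (0, 0) \<and> s * p + t * q = 0"
proof (cases "p = 0 \<and> q = 0")
  case False
  then show ?thesis by (intro exI[of _ q] exI[of _ "- p"]) (auto simp: mult.commute)
qed (intro exI[of _ 1], simp)

text \<open>By the weighted kernel identity only pairs \<open>i, j\<close> with \<open>b i \<noteq> b j\<close> contribute to the quadratic
  form, and the hypothesis on \<open>b\<close> makes all their contributions nonnegative.\<close>

lemma scaled_kernel:
  assumes const: "\<And>f i j. f \<in> facets K \<Longrightarrow> i \<in> sides f \<inter> E \<Longrightarrow> j \<in> sides f \<inter> E \<Longrightarrow> 0 < \<psi> i * \<psi> j \<Longrightarrow> b i = b j"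
    and neg: "quadratic E m (\<lambda>i. b i * \<psi> i) (\<lambda>i. b i * \<psi> i) \<le> 0"
  shows "quadratic E m (\<lambda>i. b i * \<psi> i) (\<lambda>i. b i * \<psi> i) = 0"
    and "\<And>f i j. f \<in> facets K \<Longrightarrow> i \<in> sides f \<inter> E \<Longrightarrow> j \<in> sides f \<inter> E \<Longrightarrow> \<psi> i * \<psi> j < 0 \<Longrightarrow> b i = b j"
proof -
  let ?T = "\<lambda>i j. - (m i j * (\<psi> i * \<psi> j) * (b i - b j)\<^sup>2)"
  have T: "0 \<le> ?T i j" if ij: "i \<in> E" "j \<in> E" for i j
  proof (cases "i = j \<or> m i j = 0")
    case False
    then obtain f where f: "f \<in> facets K" "i \<in> sides f" "j \<in> sides f" using m_facet[OF ij] by blast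
    show ?thesis
    proof (cases "0 < \<psi> i * \<psi> j")
      case True
      then have "b i = b j" using f ij by (intro const[OF f(1)]) blast+
      then show ?thesis by simp
    next
      case F: False
      have "0 \<le> m i j" using False m_nonneg by blast
      then have "m i j * (\<psi> i * \<psi> j) * (b i - b j)\<^sup>2 \<le> 0"
        using F by (intro mult_nonpos_nonneg[OF mult_nonneg_nonpos]) auto
      then show ?thesis by simp
    qed
  qed auto
  have Q: "2 * quadratic E m (\<lambda>i. b i * \<psi> i) (\<lambda>i. b i * \<psi> i) = (\<Sum>i\<in>E. \<Sum>j\<in>E. ?T i j)"
    unfolding sum_negf
    by (rule quadratic_of_weighted_kernel) (use kernel M_sym m_M in auto)
  moreover have nn: "0 \<le> (\<Sum>i\<in>E. \<Sum>j\<in>E. ?T i j)" using T by (intro sum_nonneg)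
  ultimately show Q0: "quadratic E m (\<lambda>i. b i * \<psi> i) (\<lambda>i. b i * \<psi> i) = 0" using neg by linarith
  then have S0: "(\<Sum>i\<in>E. \<Sum>j\<in>E. ?T i j) = 0" using Q by linarith
  have T0: "?T i j = 0" if ij: "i \<in> E" "j \<in> E" for i j
  proof -
    have "\<forall>i\<in>E. (\<Sum>j\<in>E. ?T i j) = 0"
      using S0 by (subst (asm) sum_nonneg_eq_0_iff[OF finite_edges_at]) (use T in \<open>auto intro!: sum_nonneg\<close>)
    then have "(\<Sum>j\<in>E. ?T i j) = 0" using ij(1) by blast
    then have "\<forall>j\<in>E. ?T i j = 0" using T ij(1) by (subst (asm) sum_nonneg_eq_0_iff[OF finite_edges_at]) auto
    then show ?thesis using ij(2) by blast
  qed
  show "b i = b j" if "f \<in> facets K" "i \<in> sides f \<inter> E" "j \<in> sides f \<inter> E" "\<psi> i * \<psi> j < 0" for f i j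
  proof -
    have "i \<noteq> j" using that(4) by (auto simp: mult_less_0_iff)
    then have "0 < m i j" using m_pos[OF that(1-3)] by blast
    moreover have "?T i j = 0" using T0 that(2,3) by blast
    ultimately show ?thesis using that(4) by auto
  qed
qed

text \<open>The diagonal entry is multiplied by \<open>\<psi> z\<close> = 0, so the row at a zero
  edge involves only its neighbours.\<close>

lemma zero_node_sum:
  assumes z: "z \<in> zeros_at v" and row: "(\<Sum>j\<in>E. m z j * (b j * \<psi> j)) = 0"
  shows "(\<Sum>f\<in>facets_at K z. \<Sum>e\<in>sides f \<inter> E - {z}. b e * \<psi> e) = 0"
proof -
  note zz = zeros_at_corner[OF z]
  have fl: "(v, z) \<in> flags" using zz by (simp add: flags_iff)
  have "row (\<lambda>a. b (snd a) * oriented c a) (v, z) = 0"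
    using row_sum[of z "\<lambda>a. b (snd a) * oriented c a"] row zz by simp
  then show ?thesis unfolding row_eq[OF fl] using zz by simp
qed

lemma zero_node_facet:
  assumes z: "z \<in> zeros_at v" and g: "g \<in> facets_at K z"
  shows "\<exists>e. e \<in> E \<and> e \<in> sides g \<and> e \<noteq> z \<and> sides g \<inter> E - {z} = {e}"
proof -
  have "g \<in> facets K" "z \<in> sides g" using g by (auto simp: facets_at_sides)
  then obtain e where e: "sides g \<inter> E - {z} = {e}"
    using third_side[of g z v] zeros_at_corner[OF z] unfolding flags_iff by blast
  then have "e \<in> sides g \<inter> E - {z}" by simp
  then show ?thesis using e by blast
qed

text \<open>If the positive parts added up to 0, no neighbour would be positive; since the
  neighbours add up to 0 by harmonicity, all would vanish, against \<open>corner_nonzero\<close> on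
  a surface facet.\<close>

lemma zero_node_positive:
  assumes z: "z \<in> zeros_at v"
  shows "(\<Sum>f\<in>facets_at K z. \<Sum>e\<in>sides f \<inter> E - {z}. (if 0 < \<psi> e then 1 else 0) * \<psi> e) \<noteq> 0"
proof
  let ?h = "\<lambda>f. \<Sum>e\<in>sides f \<inter> E - {z}. (if 0 < \<psi> e then 1 else 0) * \<psi> e"
  let ?g = "\<lambda>f. \<Sum>e\<in>sides f \<inter> E - {z}. \<psi> e"
  note zz = zeros_at_corner[OF z]
  have fl: "(v, z) \<in> flags" using zz by (simp add: flags_iff)
  assume h0: "(\<Sum>f\<in>facets_at K z. ?h f) = 0"
  have fin: "finite (facets_at K z)" by (rule finite_facets_at)
  have "0 \<le> ?h f" for f by (rule sum_nonneg) simp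
  then have h: "?h f = 0" if "f \<in> facets_at K z" for f
    using h0 that fin by (subst (asm) sum_nonneg_eq_0_iff) auto
  have le: "?g f \<le> 0" if f: "f \<in> facets_at K z" for f
  proof -
    obtain e where e: "sides f \<inter> E - {z} = {e}" using zero_node_facet[OF z f] by blast
    show ?thesis using h[OF f] unfolding e by (auto split: if_splits)
  qed
  have "(\<Sum>f\<in>facets_at K z. - ?g f) = 0" using zero_row[OF fl] zz by (simp add: sum_negf)
  then have "\<forall>f\<in>facets_at K z. - ?g f = 0"
    using fin le by (subst (asm) sum_nonneg_eq_0_iff) auto
  then have g0: "?g f = 0" if "f \<in> facets_at K z" for f using that by simp
  obtain f where f: "f \<in> S2" "z \<in> sides f" using two_facets[of z] zz by blast
  then have fz: "f \<in> facets_at K z" using S_sub by (auto simp: facets_at_sides)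
  obtain e where e: "e \<in> E" "e \<in> sides f" "e \<noteq> z" "sides f \<inter> E - {z} = {e}" using zero_node_facet[OF z fz] by blast
  have "\<psi> e = 0" using g0[OF fz] unfolding e(4) by simp
  moreover have "z \<in> sides f \<inter> E" "e \<in> sides f \<inter> E" using f e zz by blast+
  ultimately show False using corner_nonzero[OF f(1) _ _ e(3)] zz by blast
qed

text \<open>The products of \<open>\<psi>\<close> with \<open>a\<close> and \<open>a'\<close>
  generate the plane. A combination with coefficients \<open>s\<close>, \<open>t\<close> lies in the
  hyperplane and therefore in the kernel. At a sign change that the arc does not touch, only
  \<open>a'\<close> varies, which gives \<open>t\<close> = 0; at one where the arc ends,
  \<open>a\<close> varies, which gives \<open>s\<close> = 0.\<close>

lemma few_sign_changes: "card BD \<le> 2"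
proof (rule ccontr)
  assume "\<not> ?thesis"
  then have "3 \<le> card BD" by simp
  from free_arc[OF this] obtain e0 x1 h1 x2 where
    e0: "e0 \<in> S1 \<inter> E" "\<psi> e0 \<noteq> 0" "arc e0 \<inter> Iv = {}"
    and x1: "x1 \<in> BD" "h1 \<in> G x1" "snd h1 \<in> arc e0"
    and x2: "x2 \<in> BD" "\<And>h. h \<in> G x2 \<Longrightarrow> snd h \<notin> arc e0" by blast
  define B where "B = arc e0"
  have BS: "B \<subseteq> S1 \<inter> E" using arc_S1[OF e0(1)] by (simp add: B_def)
  \<comment> \<open>The indicator of the arc, continued with the value 1 over the fins whose paths
    meet the arc.\<close>
  define a :: "'a \<Rightarrow> real" where
    "a e = (if e \<in> B \<or> (e \<notin> S1 \<and> (\<exists>k\<in>I. e \<in> F1 k \<and> set (pe k) \<inter> B \<noteq> {})) then 1 else 0)" for e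
  define a' :: "'a \<Rightarrow> real" where "a' e = (if 0 < \<psi> e then 1 else 0)" for e
  have a_S1: "a e = (if e \<in> B then 1 else 0)" if "e \<in> S1" for e using that by (simp add: a_def)
  have a_fin: "a e = (if set (pe k) \<inter> B \<noteq> {} then 1 else 0)" if k: "k \<in> I" "e \<in> F1 k" "e \<in> E" for k e
  proof (cases "e \<in> S1")
    case True
    have ek: "e \<in> set (pe k) \<inter> E" using True k path_sets(2)[OF k(1)] by blast
    have "e \<in> B" if w: "w \<in> set (pe k) \<inter> B" for w
    proof (rule ccontr)
      assume "e \<notin> B"
      then have ne: "e \<noteq> w" using w by blast
      have "{e, w} \<subseteq> set (pe k) \<inter> E" using ek w BS by blast
      from card_mono[OF _ this] have "2 \<le> card (set (pe k) \<inter> E)" using ne by simp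
      then have "w \<in> Iv" using k(1) w BS unfolding Iv_def by blast
      then show False using w e0(3) by (auto simp: B_def)
    qed
    then show ?thesis using ek a_S1[OF True] by auto
  next
    case False
    then have "(\<exists>j\<in>I. e \<in> F1 j \<and> set (pe j) \<inter> B \<noteq> {}) \<longleftrightarrow> set (pe k) \<inter> B \<noteq> {}"
      using F_disjoint k by blast
    then show ?thesis using False BS unfolding a_def by auto
  qed
  \<comment> \<open>A facet off the surface lies in a fin, where \<open>a\<close> is constant, or
    has no edge in the surface or the fins, and then \<open>a\<close> is 0 on its sides.\<close>
  have a_off: "a i = a j" if f: "f \<in> facets K" "f \<notin> S2" "i \<in> sides f \<inter> E" "j \<in> sides f \<inter> E" for f i j
  proof (cases "f \<in> (\<Union>k\<in>I. F2 k)")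
    case True
    then obtain k where k: "k \<in> I" "f \<in> F2 k" by blast
    then have "i \<in> F1 k" "j \<in> F1 k" using F_facet[OF k] f by blast+
    then show ?thesis using a_fin[OF k(1)] f by simp
  next
    case False
    have "e \<notin> S1 \<union> (\<Union>k\<in>I. F1 k)" if "e \<in> sides f" for e using covered[OF f(1) that] f(2) False by blast
    then have "a e = 0" if "e \<in> sides f" for e using that BS unfolding a_def by auto
    then show ?thesis using f by simp
  qed
  have a_surf: "a i = a j" if f: "f \<in> S2" "i \<in> sides f \<inter> E" "j \<in> sides f \<inter> E" "0 < \<psi> i * \<psi> j" for f i j
  proof -
    have "(i, j) \<in> same" "(j, i) \<in> same" using f unfolding same_def by (auto simp: mult.commute)
    then have "i \<in> B \<longleftrightarrow> j \<in> B" using same_arc unfolding B_def by blast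
    moreover have "i \<in> S1" "j \<in> S1" using f corner_S1 by blast+
    ultimately show ?thesis using a_S1 by simp
  qed
  have sign: "0 < \<psi> e0 * \<psi> e" if "e \<in> B" for e using arc_sign[OF e0(2)] that by (simp add: B_def)
  show False
  proof (rule no_positive_plane_functional[OF finite_edges_at _ npp])
    show "v \<in> vertices K" using v S_sub by blast
    show "m i j = m j i" for i j unfolding m_M by (rule M_sym)
    fix l
    assume l: "\<And>y. (\<Sum>i\<in>E. l i * y i) = 0 \<Longrightarrow> quadratic E m y y \<le> 0"
      "\<And>y i. (\<Sum>i\<in>E. l i * y i) = 0 \<Longrightarrow> quadratic E m y y = 0 \<Longrightarrow> i \<in> E \<Longrightarrow> (\<Sum>j\<in>E. m i j * y j) = 0"
    obtain s t where st: "(s, t) \<noteq> (0, 0)"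
      "s * (\<Sum>i\<in>E. l i * (a i * \<psi> i)) + t * (\<Sum>i\<in>E. l i * (a' i * \<psi> i)) = 0"
      using two_reals_dependent by blast
    define b where "b i = s * a i + t * a' i" for i
    have "(\<Sum>i\<in>E. l i * (b i * \<psi> i)) = (\<Sum>i\<in>E. s * (l i * (a i * \<psi> i)) + t * (l i * (a' i * \<psi> i)))"
      by (rule sum.cong[OF refl]) (simp add: b_def algebra_simps)
    also have "\<dots> = 0" using st(2) by (simp only: sum.distrib sum_distrib_left)
    finally have lb: "(\<Sum>i\<in>E. l i * (b i * \<psi> i)) = 0" .
    have const: "b i = b j" if f: "f \<in> facets K" "i \<in> sides f \<inter> E" "j \<in> sides f \<inter> E" "0 < \<psi> i * \<psi> j" for f i j
    proof -
      have "a i = a j" using a_off a_surf f by blast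
      moreover have "a' i = a' j" using f(4) by (auto simp: a'_def zero_less_mult_iff)
      ultimately show ?thesis by (simp add: b_def)
    qed
    have sk1: "quadratic E m (\<lambda>i. b i * \<psi> i) (\<lambda>i. b i * \<psi> i) = 0"
      by (rule scaled_kernel(1)[OF _ l(1)[OF lb]]) (rule const)
    have sk2: "b i = b j" if "f \<in> facets K" "i \<in> sides f \<inter> E" "j \<in> sides f \<inter> E" "\<psi> i * \<psi> j < 0" for f i j
      by (rule scaled_kernel(2)[OF _ l(1)[OF lb] that]) (rule const)
    have rows: "(\<Sum>j\<in>E. m i j * (b j * \<psi> j)) = 0" if "i \<in> E" for i by (rule l(2)[OF lb sk1 that])
    have bd: "(\<exists>f. x = Inl f \<and> f \<in> S2 \<and> hit v f) \<or> (\<exists>z. x = Inr z \<and> z \<in> zeros_at v)" if "x \<in> BD" for x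
      using that by (auto simp: BD_def)
    \<comment> \<open>Around \<open>x2\<close> the function \<open>a\<close> is 0, so the kernel
      condition sees only \<open>t\<close> times the positive part.\<close>
    have t0: "t = 0"
      using bd[OF x2(1)]
    proof (elim disjE exE conjE)
      fix f assume f: "x2 = Inl f" "f \<in> S2" "hit v f"
      obtain i j where ij: "sides f \<inter> E = {i, j}" "\<psi> i * \<psi> j < 0" using hit_pair[OF f(2,3)] by (elim exE conjE)
      have m: "i \<in> sides f \<inter> E" "j \<in> sides f \<inter> E" unfolding ij(1) by simp_all
      then have "(f, i) \<in> G x2" "(f, j) \<in> G x2" by (auto simp: G_def f(1))
      then have "i \<notin> B" "j \<notin> B" using x2(2) unfolding B_def by fastforce+
      moreover have "i \<in> S1" "j \<in> S1" using corner_S1[OF f(2)] m by blast+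
      ultimately have "a i = 0" "a j = 0" using a_S1 by auto
      moreover have "b i = b j" using sk2[OF _ m ij(2)] f(2) S_sub by blast
      ultimately have "t * (a' i - a' j) = 0" by (simp add: b_def algebra_simps)
      moreover have "a' i \<noteq> a' j" using ij(2) by (auto simp: a'_def mult_less_0_iff)
      ultimately show "t = 0" by simp
    next
      fix z assume z: "x2 = Inr z" "z \<in> zeros_at v"
      note zz = zeros_at_corner[OF z(2)]
      have "z \<notin> B" using sign[of z] zz by auto
      then have az: "a z = 0" using a_S1 zz by simp
      have "(\<Sum>f\<in>facets_at K z. \<Sum>e\<in>sides f \<inter> E - {z}. b e * \<psi> e) =
          (\<Sum>f\<in>facets_at K z. \<Sum>e\<in>sides f \<inter> E - {z}. t * ((if 0 < \<psi> e then 1 else 0) * \<psi> e))"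
      proof (intro sum.cong refl)
        fix f e assume f: "f \<in> facets_at K z" and e: "e \<in> sides f \<inter> E - {z}"
        have fK: "f \<in> facets K" "z \<in> sides f" using f by (auto simp: facets_at_sides)
        have "a e = 0"
        proof (cases "f \<in> S2")
          case True
          then have "(f, e) \<in> G x2" using fK e by (simp add: G_def z(1))
          then have "e \<notin> B" using x2(2) unfolding B_def by fastforce
          then show ?thesis using a_S1 corner_S1[OF True] e by simp
        next
          case False
          then have "a e = a z" using zz fK e by (intro a_off[OF fK(1) False]) blast+
          then show ?thesis using az by simp
        qed
        then show "b e * \<psi> e = t * ((if 0 < \<psi> e then 1 else 0) * \<psi> e)" by (simp add: b_def a'_def)
      qed
      also have "\<dots> = t * (\<Sum>f\<in>facets_at K z. \<Sum>e\<in>sides f \<inter> E - {z}. (if 0 < \<psi> e then 1 else 0) * \<psi> e)"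
        by (simp only: sum_distrib_left)
      finally have "t * (\<Sum>f\<in>facets_at K z. \<Sum>e\<in>sides f \<inter> E - {z}. (if 0 < \<psi> e then 1 else 0) * \<psi> e) = 0"
        using zero_node_sum[OF z(2) rows] zz by simp
      then show "t = 0" using zero_node_positive[OF z(2)] by (simp only: mult_eq_0_iff simp_thms)
    qed
    have b: "b i = s * a i" for i by (simp add: b_def t0)
    \<comment> \<open>\<open>x1\<close> has a side in the arc. At a zero edge, multiplication by
      \<open>\<psi> e0\<close> makes all contributions of \<open>a\<close> nonnegative and the one
      from that side positive.\<close>
    have "s = 0"
      using bd[OF x1(1)]
    proof (elim disjE exE conjE)
      fix f assume f: "x1 = Inl f" "f \<in> S2" "hit v f"
      obtain i j where ij: "sides f \<inter> E = {i, j}" "\<psi> i * \<psi> j < 0" using hit_pair[OF f(2,3)] by (elim exE conjE)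
      have m: "i \<in> sides f \<inter> E" "j \<in> sides f \<inter> E" unfolding ij(1) by simp_all
      have "snd h1 \<in> sides f \<inter> E" using x1(2) by (auto simp: G_def f(1))
      then have "snd h1 \<in> {i, j}" unfolding ij(1) .
      then have "i \<in> B \<or> j \<in> B" using x1(3) by (auto simp: B_def)
      moreover have "\<not> (i \<in> B \<and> j \<in> B)" using sign[of i] sign[of j] ij(2) by (auto simp: zero_less_mult_iff mult_less_0_iff)
      moreover have "i \<in> S1" "j \<in> S1" using corner_S1[OF f(2)] m by blast+
      ultimately have "a i \<noteq> a j" using a_S1 by auto
      moreover have "b i = b j" using sk2[OF _ m ij(2)] f(2) S_sub by blast
      ultimately show "s = 0" by (simp add: b)
    next
      fix z assume z: "x1 = Inr z" "z \<in> zeros_at v"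
      note zz = zeros_at_corner[OF z(2)]
      have "z \<notin> B" using sign[of z] zz by auto
      then have az: "a z = 0" using a_S1 zz by simp
      let ?r = "\<lambda>f. \<Sum>e\<in>sides f \<inter> E - {z}. \<psi> e0 * (a e * \<psi> e)"
      have "s * \<psi> e0 * (\<Sum>f\<in>facets_at K z. \<Sum>e\<in>sides f \<inter> E - {z}. a e * \<psi> e) =
          \<psi> e0 * (\<Sum>f\<in>facets_at K z. \<Sum>e\<in>sides f \<inter> E - {z}. b e * \<psi> e)"
        by (simp add: b sum_distrib_left mult.assoc mult.left_commute)
      also have "\<dots> = 0" using zero_node_sum[OF z(2) rows] zz by simp
      finally have "s * (\<Sum>f\<in>facets_at K z. ?r f) = 0" by (simp only: sum_distrib_left mult.assoc)
      moreover have "(\<Sum>f\<in>facets_at K z. ?r f) \<noteq> 0"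
      proof
        assume s0: "(\<Sum>f\<in>facets_at K z. ?r f) = 0"
        have nn: "0 \<le> \<psi> e0 * (a e * \<psi> e)" if f: "f \<in> facets_at K z" and e: "e \<in> sides f \<inter> E - {z}" for f e
        proof -
          have fK: "f \<in> facets K" "z \<in> sides f" using f by (auto simp: facets_at_sides)
          show ?thesis
          proof (cases "f \<in> S2")
            case True
            have ae: "a e = (if e \<in> B then 1 else 0)" using a_S1 corner_S1[OF True] e by simp
            show ?thesis unfolding ae using sign[of e] by (simp add: less_imp_le)
          next
            case False
            then have "a e = a z" using zz fK e by (intro a_off[OF fK(1) False]) blast+
            then show ?thesis using az by simp
          qed
        qed
        obtain f e where h1: "h1 = (f, e)" by (cases h1)
        then have fe: "f \<in> S2" "z \<in> sides f" "e \<in> sides f \<inter> E - {z}" "e \<in> B"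
          using x1(2,3) by (auto simp: G_def z(1) B_def)
        have fz: "f \<in> facets_at K z" using fe S_sub by (auto simp: facets_at_sides)
        have "\<forall>f\<in>facets_at K z. ?r f = 0"
          using s0 by (subst (asm) sum_nonneg_eq_0_iff[OF finite_facets_at]) (use nn in \<open>auto intro!: sum_nonneg\<close>)
        then have "?r f = 0" using fz by blast
        moreover obtain d where d: "sides f \<inter> E - {z} = {d}" using zero_node_facet[OF z(2) fz] by blast
        moreover have "d = e" using fe(3) unfolding d by simp
        ultimately have "\<psi> e0 * (a e * \<psi> e) = 0" by (simp only: d sum.insert finite.emptyI empty_iff sum.empty) simp
        moreover have "a e = 1" using fe(4) by (simp add: a_def)
        ultimately show False using sign[OF fe(4)] by auto
      qed
      ultimately show "s = 0" by (simp only: mult_eq_0_iff simp_thms)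
    qed
    then show False using st(1) t0 by simp
  qed
qed

end

section \<open>The contradiction for surfaces with fins\<close>

context harmonic_surface
begin

theorem harmonic_surface_contradiction: False
proof -
  obtain v where w: "v \<in> S0" "3 \<le> card {f \<in> S2. hit v f} + card (zeros_at v)" using many_sign_changes by blast
  interpret harmonic_vertex K \<alpha> S0 S1 S2 I F0 F1 F2 pv pe c v
    by unfold_locales (rule w(1))
  have "finite (zeros_at v)" using finite_S by (auto simp: zeros_at_def)
  then have "card BD = card {f \<in> S2. hit v f} + card (zeros_at v)"
    unfolding BD_def using finite_S by (subst card_Un_disjoint) (auto simp: card_image)
  then show False using few_sign_changes w(2) by simp
qed

end

context finned_surface
begin

theorem finned_surface_contradiction: False
proof -
  show False
  proof (rule harmonic_cochain)
    fix c
    assume c: "\<And>f. f \<in> facets K \<Longrightarrow> closed_at c f" "\<And>a. a \<in> flags \<Longrightarrow> row (oriented c) a = 0"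
      "\<exists>e\<in>S1. c e \<noteq> 0"
      "\<And>i a. i \<in> I \<Longrightarrow> (\<And>e. e \<in> set (pe i) \<Longrightarrow> c e = 0) \<Longrightarrow> a \<in> X \<Longrightarrow> snd a \<in> F1 i \<Longrightarrow> c (snd a) = 0"
    interpret harmonic_surface K \<alpha> S0 S1 S2 I F0 F1 F2 pv pe c
      by unfold_locales (rule c; assumption)+
    show False by (rule harmonic_surface_contradiction)
  qed
qed

end

section \<open>From decompositions to surfaces with fins\<close>

lemma restrict_complex_simps [simp]:
  "simplices (restrict_complex K S) = S" "face (restrict_complex K S) = face K"
  by (simp_all add: restrict_complex_def)

lemma regular_2_complex_restrict:
  assumes "regular_2_complex K" "subcomplex S K"
  shows "regular_2_complex (restrict_complex K S)"
proof -
  interpret regular_2_complex K by fact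
  have sub: "S n \<subseteq> simplices K n" for n using assms(2) by (simp add: subcomplex_def)
  have face: "face K (Suc n) i \<sigma> \<in> S n" if "\<sigma> \<in> S (Suc n)" "i \<le> Suc n" for n i \<sigma>
    using assms(2) that by (simp add: subcomplex_def)
  show ?thesis
  proof
    show "delta_complex (restrict_complex K S)"
      using delta sub face unfolding delta_complex_def restrict_complex_simps by blast
    show "regular_complex (restrict_complex K S)"
      using regular sub unfolding regular_complex_def restrict_complex_simps by blast
    show "dimension_at_most 2 (restrict_complex K S)"
      using dim2 sub unfolding dimension_at_most_def restrict_complex_simps by blast
  qed
qed

lemma local_intersection_no_positive_plane:
  assumes T: "tropical_surface K \<alpha>" and v: "v \<in> vertices K" and fin: "finite (edges_at K v)"
  shows "no_positive_plane (edges_at K v) (\<lambda>e e'. real_of_int (local_intersection K \<alpha> v e e'))"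
proof -
  let ?m = "\<lambda>e e'. real_of_int (local_intersection K \<alpha> v e e')"
  obtain es where es: "distinct es" "set es = edges_at K v"
    using finite_distinct_list[OF fin] by blast
  have "num_positive_eigenvalues (local_intersection_matrix K \<alpha> v es) = 1"
    using T v es unfolding tropical_surface_def by blast
  then have "no_positive_plane {..<length es} (\<lambda>i j. ?m (es ! i) (es ! j))"
    unfolding local_intersection_matrix_def
    by (intro no_positive_plane_if_one_positive_eigenvalue) (auto simp: local_intersection_def Int_commute)
  then have "no_positive_plane ((!) es ` {..<length es}) ?m"
    by (rule no_positive_plane_reindex) (use es(1) in \<open>auto simp: inj_on_def nth_eq_iff_index_eq\<close>)
  moreover have "(!) es ` {..<length es} = edges_at K v" unfolding es(2)[symmetric] by (auto simp: set_conv_nth)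
  ultimately show ?thesis by simp
qed

lemma tropical_surface_weighted_complex:
  assumes T: "tropical_surface K \<alpha>"
  shows "weighted_complex K \<alpha>"
proof -
  have W: "delta_complex K" "finite_complex K" "regular_complex K" "dimension_at_most 2 K"
    "\<And>e. e \<in> edges K \<Longrightarrow> \<alpha> (face K 1 0 e) e + \<alpha> (face K 1 1 e) e = int (card (facets_at K e))"
    using T unfolding tropical_surface_def weak_tropical_surface_def by auto
  have fin: "finite (simplices K n)" for n
  proof -
    have "simplices K n \<subseteq> snd ` (SIGMA n:UNIV. simplices K n)" by force
    then show ?thesis using W(2) unfolding finite_complex_def by (meson finite_imageI finite_subset)
  qed
  interpret regular_2_complex K by unfold_locales (fact W)+
  show ?thesis
  proof
    show "finite (vertices K)" "finite (edges K)" "finite (facets K)" by (rule fin)+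
    show "\<alpha> (st e) e + \<alpha> (en e) e = int (card (facets_at K e))" if "e \<in> edges K" for e
      using W(5)[OF that] by (simp add: edge_start_def edge_end_def add.commute)
    show "no_positive_plane (edges_at K v) (\<lambda>e e'. real_of_int (local_intersection K \<alpha> v e e'))"
      if "v \<in> vertices K" for v
      by (rule local_intersection_no_positive_plane[OF T that]) (simp add: edges_at_def fin)
  qed
qed

lemma finned_surface_if_decomposition:
  assumes T: "tropical_surface K \<alpha>" and D: "fins_and_ornaments_decomposition K S k F Orn"
    and chi: "euler_characteristic S < 0"
  obtains pv pe where "finned_surface K \<alpha> (S 0) (S 1) (S 2) {1..k} (\<lambda>i. F i 0) (\<lambda>i. F i 1) (\<lambda>i. F i 2) pv pe"
proof -
  interpret weighted_complex K \<alpha> using T by (rule tropical_surface_weighted_complex)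
  note D = D[unfolded fins_and_ornaments_decomposition_def]
  have S: "subcomplex S K" and F': "\<forall>i\<in>{1..k}. subcomplex (F i) K" and O: "subcomplex Orn K"
    and cover': "\<forall>n. simplices K n = S n \<union> (\<Union>i\<in>{1..k}. F i n) \<union> Orn n"
    and man: "connected_2_manifold (realization (restrict_complex K S))"
    and Od': "\<forall>n\<ge>1. Orn n \<inter> (S n \<union> (\<Union>i\<in>{1..k}. F i n)) = {}"
    using D by - (elim conjE, assumption)+
  have F: "subcomplex (F i) K" if "i \<in> {1..k}" for i using F' that by (rule bspec)
  have cover: "simplices K n = S n \<union> (\<Union>i\<in>{1..k}. F i n) \<union> Orn n" for n using cover' by (rule spec)
  have Od: "Orn n \<inter> (S n \<union> (\<Union>i\<in>{1..k}. F i n)) = {}" if "1 \<le> n" for n using Od' that by (elim allE impE)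
  obtain A where A1: "\<forall>i\<in>{1..k}. contractible_space (realization (restrict_complex K (F i))) \<and>
      is_path K (\<lambda>n. F i n \<inter> S n) (A i)"
    and A2: "\<forall>i\<in>{1..k}. \<forall>j\<in>{1..k}. j < i \<longrightarrow> F j 0 \<inter> F i 0 \<subseteq> A i \<and> (\<forall>n\<ge>1. F j n \<inter> F i n = {})"
    using D by (elim conjE exE)
  have A: "is_path K (\<lambda>n. F i n \<inter> S n) (A i)" if "i \<in> {1..k}" for i
    using bspec[OF A1 that] by (rule conjunct2)
  have A_order: "F j 0 \<inter> F i 0 \<subseteq> A i" and A_disj: "\<And>n. 1 \<le> n \<Longrightarrow> F j n \<inter> F i n = {}"
    if "i \<in> {1..k}" "j \<in> {1..k}" "j < i" for i j
    using bspec[OF bspec[OF A2 that(1)] that(2)] that(3) by auto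
  \<comment> \<open>A single predicate on the pair of lists, so that paths can be chosen for all
    fins at once; it also ties \<open>A i\<close> to the endpoints of the chosen path.\<close>
  define P where "P i p \<longleftrightarrow> length (fst p) = Suc (length (snd p)) \<and> distinct (fst p) \<and>
      F i 0 \<inter> S 0 = set (fst p) \<and> F i 1 \<inter> S 1 = set (snd p) \<and> (\<forall>n\<ge>2. F i n \<inter> S n = {}) \<and>
      (\<forall>j<length (snd p). {face K 1 0 (snd p ! j), face K 1 1 (snd p ! j)} = {fst p ! j, fst p ! Suc j}) \<and>
      A i = {hd (fst p), last (fst p)}" for i p
  have "\<exists>p. P i p" if "i \<in> {1..k}" for i
  proof -
    from A[OF that] obtain vs es where
      "length vs = Suc (length es) \<and> distinct vs \<and>
        F i 0 \<inter> S 0 = set vs \<and> F i 1 \<inter> S 1 = set es \<and> (\<forall>n\<ge>2. F i n \<inter> S n = {}) \<and>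
        (\<forall>i<length es. {face K 1 0 (es ! i), face K 1 1 (es ! i)} = {vs ! i, vs ! Suc i}) \<and>
        A i = {hd vs, last vs}"
      unfolding is_path_def by (elim exE)
    then show ?thesis by (intro exI[of _ "(vs, es)"]) (unfold P_def fst_conv snd_conv)
  qed
  then obtain p where P: "P i (p i)" if "i \<in> {1..k}" for i by metis
  note p = P[unfolded P_def]
  have sub: "S' n \<subseteq> simplices K n" if "subcomplex S' K" for S' n using that by (simp add: subcomplex_def)
  have ends: "st e \<in> S' 0" "en e \<in> S' 0" if "subcomplex S' K" "e \<in> S' 1" for S' e
  proof -
    have "face K (Suc 0) i e \<in> S' 0" if "i \<le> Suc 0" for i
      using \<open>subcomplex S' K\<close> \<open>e \<in> S' 1\<close> that by (simp add: subcomplex_def)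
    then show "st e \<in> S' 0" "en e \<in> S' 0" by (simp_all add: edge_start_def edge_end_def)
  qed
  have sds: "sides f \<subseteq> S' 1" if "subcomplex S' K" "f \<in> S' 2" for S' f
  proof -
    have "\<forall>\<sigma>\<in>S' (Suc 1). \<forall>i\<le>Suc 1. face K (Suc 1) i \<sigma> \<in> S' 1"
      using \<open>subcomplex S' K\<close> unfolding subcomplex_def by (elim conjE allE)
    then have "\<forall>i\<le>2. face K 2 i f \<in> S' 1" using \<open>f \<in> S' 2\<close> unfolding Suc_1 by (rule bspec)
    then show ?thesis by (auto simp: side_def)
  qed
  interpret R: regular_2_complex "restrict_complex K S"
    by (rule regular_2_complex_restrict[OF regular_2_complex_axioms S])
  have same: "edge_start (restrict_complex K S) = st" "edge_end (restrict_complex K S) = en"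
    "side (restrict_complex K S) = sd"
    by (auto simp: fun_eq_iff edge_start_def edge_end_def side_def)
  have at: "edges_at (restrict_complex K S) v = {e \<in> S 1. (v, e) \<in> flags}" for v
    using sub[OF S, of 1] unfolding R.edges_at_eq by (auto simp: same flags_def)
  have fat: "facets_at (restrict_complex K S) e = {f \<in> S 2. e \<in> sides f}" for e
    by (simp add: R.facets_at_sides same)
  have finS: "finite (facets (restrict_complex K S))" unfolding restrict_complex_simps by (rule finite_subset[OF sub[OF S] finite_facets])
  show ?thesis
  proof (rule that[of "\<lambda>i. fst (p i)" "\<lambda>i. snd (p i)"], unfold_locales, goal_cases)
    case 1
    show ?case by (rule sub[OF S])
  next
    case 2
    show ?case by (rule sub[OF S])
  next
    case 3
    show ?case by (rule sub[OF S])
  next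
    case (4 e)
    then show ?case using ends[OF S] by blast
  next
    case (5 f)
    then show ?case by (rule sds[OF S])
  next
    case (6 i)
    then show ?case using sub[OF F] by blast
  next
    case (7 i e)
    then show ?case using ends[OF F] by blast
  next
    case (8 i f)
    then show ?case using sds[OF F] by blast
  next
    case (9 i j)
    then show ?case using A_disj[of i j 1] A_disj[of j i 1] by (cases i j rule: linorder_cases) (simp_all add: Int_commute)
  next
    case (10 i j)
    then have "A i = {hd (fst (p i)), last (fst (p i))}" using p by blast
    then show ?case using A_order[OF 10] by simp
  next
    case (11 f e)
    \<comment> \<open>An ornament facet would make its side \<open>e\<close> an ornament edge, but
      ornaments share no edge with the surface or the fins.\<close>
    have "f \<notin> Orn 2"
    proof
      assume "f \<in> Orn 2"
      then have "e \<in> Orn 1" using sds[OF O] 11(2) by blast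
      then show False using Od[of 1] 11(3) by blast
    qed
    then show ?case using cover[of 2] 11(1) by blast
  next
    case (12 i)
    then show ?case using p by blast
  next
    case (13 i)
    then show ?case using p by blast
  next
    case (14 i)
    then show ?case using p by blast
  next
    case (15 i)
    then show ?case using p by blast
  next
    case (16 i)
    then show ?case using p by simp
  next
    case (17 i j)
    then have "{face K 1 0 (snd (p i) ! j), face K 1 1 (snd (p i) ! j)} = {fst (p i) ! j, fst (p i) ! Suc j}"
      using p by blast
    then show ?case unfolding edge_start_def edge_end_def by (simp only: insert_commute)
  next
    case (18 v C)
    have "C = edges_at (restrict_complex K S) v"
    proof (rule R.link_connected[OF man])
      show "v \<in> vertices (restrict_complex K S)" "C \<subseteq> edges_at (restrict_complex K S) v" "C \<noteq> {}"
        using 18 by (simp_all add: at)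
      show "R.linked_at v C" unfolding R.linked_at_def same restrict_complex_simps
      proof (intro ballI allI impI, elim conjE)
        fix f i j assume f: "f \<in> S 2" and i: "i \<le> 2" and j: "j \<le> 2" and e: "sd i f \<in> C" "sd j f \<in> edges_at (restrict_complex K S) v"
        have "sd l f \<in> sides f" if "l \<le> 2" for l :: nat
        proof -
          have "l = 0 \<or> l = 1 \<or> l = 2" using that by linarith
          then show ?thesis by auto
        qed
        then show "sd j f \<in> C" using 18(4)[OF f, of "sd i f" "sd j f"] i j e by (simp add: at)
      qed
    qed
    then show ?case by (simp add: at)
  next
    case (19 A)
    have "connected_space (realization (restrict_complex K S))" using man by (simp add: connected_2_manifold_def)
    from R.graph_connected[OF this, of A] 19 show ?case by (simp add: same)
  next
    case (20 e)
    then show ?case using R.edge_degree[OF man _ finS, of e] by (simp add: fat)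
  next
    case 21
    then show ?case using chi unfolding euler_characteristic_def by linarith
  qed
qed

theorem theorem4:
  fixes \<Delta> :: "'a delta_data"
  assumes "hyperbolic_manifold_with_fins_and_ornaments \<Delta>"
  shows "\<not> (\<exists>\<alpha> :: 'a \<Rightarrow> 'a \<Rightarrow> int. tropical_surface \<Delta> \<alpha>)"
proof
  assume "\<exists>\<alpha> :: 'a \<Rightarrow> 'a \<Rightarrow> int. tropical_surface \<Delta> \<alpha>"
  then obtain \<alpha> :: "'a \<Rightarrow> 'a \<Rightarrow> int" where T: "tropical_surface \<Delta> \<alpha>" by (elim exE)
  obtain S k F Orn where D: "fins_and_ornaments_decomposition \<Delta> S k F Orn" "euler_characteristic S < 0"
    using assms unfolding hyperbolic_manifold_with_fins_and_ornaments_def by (elim exE conjE)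
  show False
  proof (rule finned_surface_if_decomposition[OF T D])
    fix pv pe
    assume "finned_surface \<Delta> \<alpha> (S 0) (S 1) (S 2) {1..k} (\<lambda>i. F i 0) (\<lambda>i. F i 1) (\<lambda>i. F i 2) pv pe"
    then show False by (rule finned_surface.finned_surface_contradiction)
  qed
qed

end
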